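(* Let $K/K_0$ be a PAC extension and let $L/K$ be a finite Galois extension. Assume that $\mathrm{Gal}(L/K)\leq G_0$ (i.e. $\mathrm{Gal}(L/K)$ is isomorphic to a subgroup of $G_0$), where $G_0$ is a finite group that is regular over $K_0$. Then there exists a Galois extension $L_0/K_0$ such that $\mathrm{Gal}(L_0/K_0)\leq G_0$ (i.e. $\mathrm{Gal}(L_0/K_0)$ is isomorphic to a subgroup of $G_0$) and $L=L_0K$.
   Context: A field extension $K/K_0$ (not necessarily algebraic) is called a PAC extension if for every absolutely irreducible variety $V$ of dimension $r\geq 1$ defined over $K$ and every separable dominating rational map $\nu\colon V\to\mathbb{A}^r$ defined over $K$ there exists $a\in V(K)$ for which $\nu(a)\in K_0^r$. A finite group $G_0$ is regular over $K_0$ if there exists a Galois extension $F_0/K_0(t)$ ($t$ transcendental over $K_0$) with Galois group isomorphic to $G_0$ and such that $F_0$ is a regular extension of $K_0$. The separable closure of $K_0$ is taken inside the separable closure of $K$, and composita are formed there. *)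

theory Defs
  imports
    "HOL-Algebra.Algebraic_Closure_Type"
    "HOL-Algebra.Bij"
    "HOL-Algebra.Generated_Fields"
    "HOL-Library.Poly_Mapping"
begin

section \<open>Field extensions inside an ambient field\<close>

text \<open>All fields of a given statement are subfields of one field, namely of a type of class
  \<^class>\<open>field\<close>, seen as a record so that the notions of HOL-Algebra apply to its subfields.\<close>

abbreviation ambient :: "'a::field ring" where
  "ambient \<equiv> ring_of_type_algebra"

definition field_extension :: "'a::field set \<Rightarrow> 'a set \<Rightarrow> bool" where
  "field_extension K L \<longleftrightarrow> subfield K ambient \<and> subfield L ambient \<and> K \<subseteq> L"

definition finite_field_extension :: "'a::field set \<Rightarrow> 'a set \<Rightarrow> bool" where
  "finite_field_extension K L \<longleftrightarrow> field_extension K L \<and> ring.finite_dimension ambient K L"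

definition adjoin :: "'a::field set \<Rightarrow> 'a set \<Rightarrow> 'a set" where
  "adjoin K S = generate_field ambient (K \<union> S)"

abbreviation compositum :: "'a::field set \<Rightarrow> 'a set \<Rightarrow> 'a set" where
  "compositum \<equiv> adjoin"

definition algebraic_extension :: "'a::field set \<Rightarrow> 'a set \<Rightarrow> bool" where
  "algebraic_extension K L \<longleftrightarrow>
     field_extension K L \<and> (\<forall>x\<in>L. (ring.algebraic ambient over K) x)"

text \<open>The minimal polynomial as a \<^typ>\<open>'a poly\<close>; HOL-Algebra lists coefficients from the leading
  one downwards.\<close>

definition min_poly :: "'a::field set \<Rightarrow> 'a \<Rightarrow> 'a poly" where
  "min_poly K x = Poly (rev (ring.Irr ambient K x))"

text \<open>Coprimality of a polynomial and its derivative does not depend on the field over which it is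
  tested, so it says that there is no multiple root in an algebraic closure.\<close>

definition separable_extension :: "'a::field set \<Rightarrow> 'a set \<Rightarrow> bool" where
  "separable_extension K L \<longleftrightarrow>
     algebraic_extension K L \<and> (\<forall>x\<in>L. coprime (min_poly K x) (pderiv (min_poly K x)))"

definition normal_extension :: "'a::field set \<Rightarrow> 'a set \<Rightarrow> bool" where
  "normal_extension K L \<longleftrightarrow>
     algebraic_extension K L \<and>
     (\<forall>x\<in>L. ring.splitted (ambient\<lparr>carrier := L\<rparr>) (ring.Irr ambient K x))"

definition galois_extension :: "'a::field set \<Rightarrow> 'a set \<Rightarrow> bool" where
  "galois_extension K L \<longleftrightarrow> normal_extension K L \<and> separable_extension K L"

definition galois_group :: "'a::field set \<Rightarrow> 'a set \<Rightarrow> ('a \<Rightarrow> 'a) monoid" where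
  "galois_group K L = BijGroup L
     \<lparr>carrier := {\<sigma> \<in> Bij L. \<sigma> \<in> ring_hom (ambient\<lparr>carrier := L\<rparr>) (ambient\<lparr>carrier := L\<rparr>) \<and>
                          (\<forall>x\<in>K. \<sigma> x = x)}\<rparr>"

definition iso_to_subgroup :: "('g, 'm) monoid_scheme \<Rightarrow> ('h, 'n) monoid_scheme \<Rightarrow> bool" where
  "iso_to_subgroup G H \<longleftrightarrow> (\<exists>U. subgroup U H \<and> G \<cong> H\<lparr>carrier := U\<rparr>)"

text \<open>The relative algebraic closure; it is an algebraic closure of \<open>K\<close> when the ambient field is
  algebraically closed.\<close>

definition algebraic_closure_of :: "'a::field set \<Rightarrow> 'a set" where
  "algebraic_closure_of K = {x. (ring.algebraic ambient over K) x}"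

definition linearly_disjoint :: "'a::field set \<Rightarrow> 'a set \<Rightarrow> 'a set \<Rightarrow> bool" where
  "linearly_disjoint K E F \<longleftrightarrow>
     (\<forall>us. set us \<subseteq> E \<and> ring.independent ambient K us \<longrightarrow> ring.independent ambient F us)"

definition regular_extension :: "'a::alg_closed_field set \<Rightarrow> 'a set \<Rightarrow> bool" where
  "regular_extension K F \<longleftrightarrow>
     field_extension K F \<and> linearly_disjoint K F (algebraic_closure_of K)"


section \<open>Polynomials in several variables and affine varieties\<close>

text \<open>Monomials are finitely supported exponent vectors; the variables are \<open>X\<^sub>0, X\<^sub>1, \<dots>\<close>.\<close>

type_synonym 'a mpoly = "(nat \<Rightarrow>\<^sub>0 nat) \<Rightarrow>\<^sub>0 'a"

definition mpoly_eval :: "'a::comm_ring_1 mpoly \<Rightarrow> (nat \<Rightarrow> 'a) \<Rightarrow> 'a" where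
  "mpoly_eval p x =
     (\<Sum>m\<in>Poly_Mapping.keys p. Poly_Mapping.lookup p m *
        (\<Prod>i\<in>Poly_Mapping.keys m. x i ^ Poly_Mapping.lookup m i))"

definition mpolys :: "'a::comm_ring_1 set \<Rightarrow> nat \<Rightarrow> 'a mpoly set" where
  "mpolys F n = {p. (\<forall>m. Poly_Mapping.lookup p m \<in> F) \<and>
                    (\<forall>m\<in>Poly_Mapping.keys p. Poly_Mapping.keys m \<subseteq> {..<n})}"

definition affine_space :: "'a set \<Rightarrow> nat \<Rightarrow> (nat \<Rightarrow> 'a) set" where
  "affine_space F n = {..<n} \<rightarrow>\<^sub>E F"

text \<open>Below, varieties are sets of points over the whole ambient field \<^typ>\<open>'a\<close>, which is meant to be
  a universal domain: algebraically closed and of infinite transcendence degree over \<open>K\<close>. The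
  parameter \<open>F\<close> is the field from which the coefficients of the equations are taken.\<close>

definition zariski_closed :: "'a::field set \<Rightarrow> nat \<Rightarrow> (nat \<Rightarrow> 'a) set \<Rightarrow> bool" where
  "zariski_closed F n V \<longleftrightarrow>
     (\<exists>S\<subseteq>mpolys F n. V = {x \<in> affine_space UNIV n. \<forall>p\<in>S. mpoly_eval p x = 0})"

definition zariski_irreducible :: "'a::field set \<Rightarrow> nat \<Rightarrow> (nat \<Rightarrow> 'a) set \<Rightarrow> bool" where
  "zariski_irreducible F n V \<longleftrightarrow>
     V \<noteq> {} \<and>
     (\<forall>V1 V2. zariski_closed F n V1 \<and> zariski_closed F n V2 \<and> V \<subseteq> V1 \<union> V2
        \<longrightarrow> V \<subseteq> V1 \<or> V \<subseteq> V2)"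

definition vanishing_ideal :: "'a::field set \<Rightarrow> nat \<Rightarrow> (nat \<Rightarrow> 'a) set \<Rightarrow> 'a mpoly set" where
  "vanishing_ideal F n V = {p \<in> mpolys F n. \<forall>x\<in>V. mpoly_eval p x = 0}"

definition mpoly_ideal_generated :: "'a::field set \<Rightarrow> nat \<Rightarrow> 'a mpoly set \<Rightarrow> 'a mpoly set" where
  "mpoly_ideal_generated F n S =
     {\<Sum>p\<in>T. q p * p | T q. finite T \<and> T \<subseteq> S \<and> (\<forall>p\<in>T. q p \<in> mpolys F n)}"

text \<open>A variety is defined over \<open>K\<close> if its ideal over the algebraic closure of \<open>K\<close> is generated by
  polynomials over \<open>K\<close>.\<close>

definition absolutely_irreducible_variety ::
  "'a::alg_closed_field set \<Rightarrow> nat \<Rightarrow> (nat \<Rightarrow> 'a) set \<Rightarrow> bool" where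
  "absolutely_irreducible_variety K n V \<longleftrightarrow>
     (let C = algebraic_closure_of K in
        zariski_closed C n V \<and> zariski_irreducible C n V \<and>
        vanishing_ideal C n V = mpoly_ideal_generated C n (vanishing_ideal K n V))"

text \<open>The function field of a variety \<open>V\<close> over \<open>K\<close> is \<open>K(x)\<close> for a generic point \<open>x\<close> of \<open>V\<close> over \<open>K\<close>.
  It is the fraction field of the coordinate ring \<open>K[X]/I(V)\<close>, hence independent of \<open>x\<close> up to
  \<open>K\<close>-isomorphism.\<close>

definition generic_point ::
  "'a::alg_closed_field set \<Rightarrow> nat \<Rightarrow> (nat \<Rightarrow> 'a) set \<Rightarrow> (nat \<Rightarrow> 'a) \<Rightarrow> bool" where
  "generic_point K n V x \<longleftrightarrow>
     x \<in> V \<and> (\<forall>p\<in>mpolys K n. mpoly_eval p x = 0 \<longrightarrow> p \<in> vanishing_ideal K n V)"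

definition function_field :: "'a::alg_closed_field set \<Rightarrow> nat \<Rightarrow> (nat \<Rightarrow> 'a) \<Rightarrow> 'a set" where
  "function_field K n x = adjoin K (x ` {..<n})"

definition algebraically_independent :: "'a::field set \<Rightarrow> nat \<Rightarrow> (nat \<Rightarrow> 'a) \<Rightarrow> bool" where
  "algebraically_independent K r b \<longleftrightarrow> (\<forall>p\<in>mpolys K r. mpoly_eval p b = 0 \<longrightarrow> p = 0)"

definition has_transcendence_degree :: "'a::field set \<Rightarrow> 'a set \<Rightarrow> nat \<Rightarrow> bool" where
  "has_transcendence_degree K E r \<longleftrightarrow>
     (\<exists>b \<in> affine_space E r. algebraically_independent K r b \<and>
        algebraic_extension (adjoin K (b ` {..<r})) E)"

definition has_dimension ::
  "'a::alg_closed_field set \<Rightarrow> nat \<Rightarrow> (nat \<Rightarrow> 'a) set \<Rightarrow> nat \<Rightarrow> bool" where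
  "has_dimension K n V r \<longleftrightarrow>
     (\<exists>x. generic_point K n V x \<and> has_transcendence_degree K (function_field K n x) r)"

text \<open>A rational map over \<open>K\<close> from \<open>V\<close> to affine \<open>r\<close>-space is an \<open>r\<close>-tuple \<open>\<nu>\<close> of elements of the
  function field \<open>K(x)\<close>. It is defined at \<open>a \<in> V\<close> if every component can be written as \<open>f(x)/g(x)\<close>
  with \<open>g(a) \<noteq> 0\<close>; the value \<open>f(a)/g(a)\<close> does not depend on this representation.\<close>

definition rational_map ::
  "'a::alg_closed_field set \<Rightarrow> nat \<Rightarrow> (nat \<Rightarrow> 'a) \<Rightarrow> nat \<Rightarrow> (nat \<Rightarrow> 'a) \<Rightarrow> bool" where
  "rational_map K n x r \<nu> \<longleftrightarrow> \<nu> \<in> affine_space (function_field K n x) r"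

definition rational_map_value ::
  "'a::alg_closed_field set \<Rightarrow> nat \<Rightarrow> (nat \<Rightarrow> 'a) \<Rightarrow> nat \<Rightarrow> (nat \<Rightarrow> 'a) \<Rightarrow> (nat \<Rightarrow> 'a)
     \<Rightarrow> (nat \<Rightarrow> 'a) \<Rightarrow> bool" where
  "rational_map_value K n x r \<nu> a b \<longleftrightarrow>
     b \<in> affine_space UNIV r \<and>
     (\<forall>i<r. \<exists>f\<in>mpolys K n. \<exists>g\<in>mpolys K n. mpoly_eval g x \<noteq> 0 \<and> mpoly_eval g a \<noteq> 0 \<and>
        \<nu> i = mpoly_eval f x / mpoly_eval g x \<and> b i = mpoly_eval f a / mpoly_eval g a)"

definition dominating ::
  "'a::alg_closed_field set \<Rightarrow> nat \<Rightarrow> (nat \<Rightarrow> 'a) set \<Rightarrow> (nat \<Rightarrow> 'a) \<Rightarrow> nat \<Rightarrow> (nat \<Rightarrow> 'a) \<Rightarrow> bool"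
  where
  "dominating K n V x r \<nu> \<longleftrightarrow>
     (\<forall>W. zariski_closed (algebraic_closure_of K) r W \<and>
          {b. \<exists>a\<in>V. rational_map_value K n x r \<nu> a b} \<subseteq> W
        \<longrightarrow> W = affine_space UNIV r)"

text \<open>Only used for dominating maps with \<open>dim V = r\<close>, where \<open>K(x)/K(\<nu>)\<close> is a finite extension.\<close>

definition separable_map ::
  "'a::alg_closed_field set \<Rightarrow> nat \<Rightarrow> (nat \<Rightarrow> 'a) \<Rightarrow> nat \<Rightarrow> (nat \<Rightarrow> 'a) \<Rightarrow> bool" where
  "separable_map K n x r \<nu> \<longleftrightarrow>
     separable_extension (adjoin K (\<nu> ` {..<r})) (function_field K n x)"


section \<open>PAC extensions and regular groups\<close>

text \<open>The algebraic closure of \<open>'a(X\<^sub>0, X\<^sub>1, \<dots>)\<close> is a universal domain for all subfields of \<open>'a\<close>.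
  Every generic point of a variety over such a subfield, and every algebraic extension of the field of
  rational functions in one variable over it, can be realised there.\<close>

type_synonym 'a universal_domain = "'a mpoly fract alg_closure"

definition to_universal :: "'a::field \<Rightarrow> 'a universal_domain" where
  "to_universal c = to_ac (Fract (Poly_Mapping.single 0 c) 1)"

definition pac_in_domain :: "'a::alg_closed_field set \<Rightarrow> 'a set \<Rightarrow> bool" where
  "pac_in_domain K0 K \<longleftrightarrow>
     (\<forall>n r V x \<nu>.
        r \<ge> 1 \<and> absolutely_irreducible_variety K n V \<and> has_dimension K n V r \<and>
        generic_point K n V x \<and> rational_map K n x r \<nu> \<and>
        dominating K n V x r \<nu> \<and> separable_map K n x r \<nu>
        \<longrightarrow> (\<exists>a \<in> V \<inter> affine_space K n. \<exists>b \<in> affine_space K0 r. rational_map_value K n x r \<nu> a b))"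

definition pac_extension :: "'a::field set \<Rightarrow> 'a set \<Rightarrow> bool" where
  "pac_extension K0 K \<longleftrightarrow>
     field_extension K0 K \<and> pac_in_domain (to_universal ` K0) (to_universal ` K)"

definition regular_in_domain :: "('g, 'm) monoid_scheme \<Rightarrow> 'a::alg_closed_field set \<Rightarrow> bool" where
  "regular_in_domain G0 K0 \<longleftrightarrow>
     (\<exists>t F0. (ring.transcendental ambient over K0) t \<and>
        galois_extension (adjoin K0 {t}) F0 \<and> galois_group (adjoin K0 {t}) F0 \<cong> G0 \<and>
        regular_extension K0 F0)"

definition regular_group_over :: "('g, 'm) monoid_scheme \<Rightarrow> 'a::field set \<Rightarrow> bool" where
  "regular_group_over G0 K0 \<longleftrightarrow> regular_in_domain G0 (to_universal ` K0)"

end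

theory Submission
  imports Defs
begin

text \<open>Let \<open>F\<^sub>0/K\<^sub>0(t)\<close> be a regular realisation of \<open>G\<^sub>0\<close> with \<open>t\<close> transcendental over \<open>K\<close>, and let \<open>z\<close> be a
  generator of \<open>F\<^sub>0\<close>. Since \<open>F\<^sub>0\<close> is regular over \<open>K\<^sub>0\<close>, the minimal polynomial of \<open>z\<close> stays irreducible over
  \<open>C(t)\<close>, where \<open>C\<close> is the algebraic closure of \<open>K\<close>. Hence \<open>G\<^sub>0 \<times> Gal(L/K)\<close> acts on the compositum \<open>M = F\<^sub>0L\<close> with
  fixed field \<open>K(t)\<close>. Given an embedding \<open>\<psi>\<close> of \<open>Gal(L/K)\<close> into \<open>G\<^sub>0\<close>, the fixed field \<open>E\<close> of the graph of \<open>\<psi>\<close> in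
  \<open>M\<close> is separable over \<open>K(t)\<close> and linearly disjoint from \<open>C\<close> over \<open>K\<close>, so finitely many of its elements form a generic point of
  an absolutely irreducible curve over \<open>K\<close>. The PAC property yields a point of this curve over \<open>K\<close> whose
  \<open>t\<close>-coordinate lies in \<open>K\<^sub>0\<close>, that is, a specialisation \<open>\<phi>\<close> which is the identity on \<open>C\<close> and maps these elements into \<open>K\<close> and
  \<open>t\<close> into \<open>K\<^sub>0\<close>. By the choice of these elements it satisfies \<open>h(\<phi>(z)) = \<phi>(\<psi>(h)(z))\<close> for all \<open>h\<close> in \<open>Gal(L/K)\<close>. Therefore
  \<open>L\<^sub>0 = K\<^sub>0(\<phi>(z))\<close>, the residue field of \<open>F\<^sub>0\<close> at this place, generates \<open>L\<close> over \<open>K\<close>.\<close>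

section \<open>Subfields, polynomials and homomorphisms\<close>

text \<open>The PAC property yields one point with finitely many coordinates, so whatever the
  argument needs later has to be built into the coordinates. They must be invariant under the
  twisted action, yet \<open>z\<close> must be recoverable: hence the sums over g of \<psi>(g)(z)
  g(w)^j, with \<open>w\<close> a primitive element of L/K, from which Lagrange interpolation over
  \<open>L\<close> returns \<open>z\<close>. The conjugates of \<open>z\<close> and the inverses of
  their differences have a common denominator D(t) over K0; with 1/D(t) among the coordinates the
  specialisation is defined on all of them and cannot merge two conjugates. So a ring homomorphism
  on a finitely generated C-algebra suffices, without valuations or decomposition groups: Gal(L0/K0)
  embeds into G0 by comparing \<tau>(\<phi>(z)) with the values \<phi>(\<sigma>(z)). Linear
  disjointness is therefore moved to the larger constants by factoring polynomials and descended
  from L to K by Artin's argument. K is shown to be infinite, since primitive elements are found by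
  avoiding finitely many exceptions.\<close>

abbreviation is_subfield :: "'a::field set \<Rightarrow> bool" where
  "is_subfield K \<equiv> subfield K ambient"

lemma ambient_simps [simp]:
  "carrier (ambient :: 'a::field ring) = UNIV"
  "x \<otimes>\<^bsub>ambient\<^esub> y = x * y" "x \<oplus>\<^bsub>ambient\<^esub> y = x + y"
  "\<one>\<^bsub>ambient\<^esub> = (1 :: 'a)" "\<zero>\<^bsub>ambient\<^esub> = (0 :: 'a)"
  by (simp_all add: ring_of_type_algebra_def)

lemma ambient_field: "field (ambient :: 'a::field ring)"
  by (rule field_from_type_algebra)

lemma ambient_domain: "domain (ambient :: 'a::field ring)"
  using ambient_field field.axioms(1) by blast

lemma ambient_uminus [simp]: "\<ominus>\<^bsub>ambient\<^esub> x = - (x :: 'a::field)"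
proof -
  interpret field "ambient :: 'a ring" by (rule ambient_field)
  show ?thesis using minus_equality[of "- x" x] by simp
qed

lemma ambient_inverse: "x \<noteq> 0 \<Longrightarrow> inv\<^bsub>ambient\<^esub> x = inverse (x :: 'a::field)"
proof -
  interpret field "ambient :: 'a ring" by (rule ambient_field)
  assume "x \<noteq> 0"
  then show ?thesis using comm_inv_char[of x "inverse x"] by simp
qed

lemma ambient_pow [simp]: "x [^]\<^bsub>ambient\<^esub> (n::nat) = (x :: 'a::field) ^ n"
proof -
  interpret field "ambient :: 'a ring" by (rule ambient_field)
  show ?thesis by (induction n) (simp_all add: mult.commute)
qed

lemma is_subfieldI:
  assumes "1 \<in> K" "\<And>x y. x \<in> K \<Longrightarrow> y \<in> K \<Longrightarrow> x + y \<in> K" "\<And>x y. x \<in> K \<Longrightarrow> y \<in> K \<Longrightarrow> x * y \<in> K"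
    "\<And>x. x \<in> K \<Longrightarrow> - x \<in> K" "\<And>x. x \<in> K \<Longrightarrow> x \<noteq> 0 \<Longrightarrow> inverse x \<in> K"
  shows "is_subfield (K :: 'a::field set)"
proof -
  interpret field "ambient :: 'a ring" by (rule ambient_field)
  show ?thesis
    by (rule subfieldI'[OF subringI]) (use assms in \<open>auto simp: ambient_inverse\<close>)
qed

lemma is_subfield_closed:
  assumes K: "is_subfield (K :: 'a::field set)"
  shows "0 \<in> K" "1 \<in> K" "x \<in> K \<Longrightarrow> y \<in> K \<Longrightarrow> x + y \<in> K" "x \<in> K \<Longrightarrow> y \<in> K \<Longrightarrow> x * y \<in> K"
    "x \<in> K \<Longrightarrow> - x \<in> K" "x \<in> K \<Longrightarrow> y \<in> K \<Longrightarrow> x - y \<in> K" "x \<in> K \<Longrightarrow> inverse x \<in> K"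
    "x \<in> K \<Longrightarrow> y \<in> K \<Longrightarrow> x / y \<in> K" "x \<in> K \<Longrightarrow> x ^ n \<in> K"
    "(\<And>i. i \<in> A \<Longrightarrow> f i \<in> K) \<Longrightarrow> sum f A \<in> K" "(\<And>i. i \<in> A \<Longrightarrow> f i \<in> K) \<Longrightarrow> prod f A \<in> K"
proof -
  interpret field "ambient :: 'a ring" by (rule ambient_field)
  note p = subringE[OF subfieldE(1)[OF K]]
  show 0: "0 \<in> K" "1 \<in> K" using p(2,3) by auto
  have add: "\<And>x y. x \<in> K \<Longrightarrow> y \<in> K \<Longrightarrow> x + y \<in> K"
    and mult: "\<And>x y. x \<in> K \<Longrightarrow> y \<in> K \<Longrightarrow> x * y \<in> K" and neg: "\<And>x. x \<in> K \<Longrightarrow> - x \<in> K"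
    using p(5-7) by auto
  have inv: "\<And>x. x \<in> K \<Longrightarrow> inverse x \<in> K"
    using subfield_m_inv(1)[OF K] 0 by (metis DiffD1 DiffI ambient_inverse ambient_simps(5) inverse_zero singletonD)
  show "x \<in> K \<Longrightarrow> y \<in> K \<Longrightarrow> x + y \<in> K" "x \<in> K \<Longrightarrow> y \<in> K \<Longrightarrow> x * y \<in> K"
    "x \<in> K \<Longrightarrow> - x \<in> K" "x \<in> K \<Longrightarrow> inverse x \<in> K" using add mult neg inv by auto
  show "x \<in> K \<Longrightarrow> y \<in> K \<Longrightarrow> x - y \<in> K" using add[of x "- y"] neg by simp
  show "x \<in> K \<Longrightarrow> y \<in> K \<Longrightarrow> x / y \<in> K" using mult[of x "inverse y"] inv by (simp add: divide_inverse)
  show "x \<in> K \<Longrightarrow> x ^ n \<in> K" by (induction n) (auto intro: 0 mult)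
  show "(\<And>i. i \<in> A \<Longrightarrow> f i \<in> K) \<Longrightarrow> sum f A \<in> K"
    by (induction A rule: infinite_finite_induct) (auto intro: 0 add)
  show "(\<And>i. i \<in> A \<Longrightarrow> f i \<in> K) \<Longrightarrow> prod f A \<in> K"
    by (induction A rule: infinite_finite_induct) (auto intro: 0 mult)
qed

lemma is_subfield_UNIV: "is_subfield UNIV"
  by (rule is_subfieldI) auto

lemma adjoin_is_subfield: "is_subfield (adjoin K S)"
  and adjoin_base: "K \<subseteq> adjoin K S"
  and adjoin_gens: "S \<subseteq> adjoin K S"
  and adjoin_least: "is_subfield E \<Longrightarrow> K \<subseteq> E \<Longrightarrow> S \<subseteq> E \<Longrightarrow> adjoin K S \<subseteq> E"
  using field.generate_fieldE[OF ambient_field, of "K \<union> S" "adjoin K S"]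
  by (auto simp: adjoin_def)

text \<open>Only a zero is asked of the coefficient type, so that the construction can be iterated
  to describe K[t][X].\<close>

definition polys_over :: "'a::zero set \<Rightarrow> 'a poly set" where
  "polys_over K = {p. \<forall>i. coeff p i \<in> K}"

lemma polys_overD: "p \<in> polys_over K \<Longrightarrow> coeff p i \<in> K"
  by (simp add: polys_over_def)

lemma polys_overI: "(\<And>i. coeff p i \<in> K) \<Longrightarrow> p \<in> polys_over K"
  by (simp add: polys_over_def)

lemma polys_over_mono: "K \<subseteq> L \<Longrightarrow> polys_over K \<subseteq> polys_over L"
  by (auto simp: polys_over_def)

lemma polys_over_closed:
  assumes K: "is_subfield K"
  shows "0 \<in> polys_over K" "1 \<in> polys_over K"
    "p \<in> polys_over K \<Longrightarrow> q \<in> polys_over K \<Longrightarrow> p + q \<in> polys_over K"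
    "p \<in> polys_over K \<Longrightarrow> q \<in> polys_over K \<Longrightarrow> p * q \<in> polys_over K"
    "p \<in> polys_over K \<Longrightarrow> - p \<in> polys_over K"
    "p \<in> polys_over K \<Longrightarrow> q \<in> polys_over K \<Longrightarrow> p - q \<in> polys_over K"
    "a \<in> K \<Longrightarrow> p \<in> polys_over K \<Longrightarrow> smult a p \<in> polys_over K"
    "a \<in> K \<Longrightarrow> p \<in> polys_over K \<Longrightarrow> pCons a p \<in> polys_over K"
    "a \<in> K \<Longrightarrow> monom a n \<in> polys_over K"
    "(\<And>i. i \<in> A \<Longrightarrow> f i \<in> polys_over K) \<Longrightarrow> sum f A \<in> polys_over K"
    "(\<And>i. i \<in> A \<Longrightarrow> f i \<in> polys_over K) \<Longrightarrow> prod f A \<in> polys_over K"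
    "p \<in> polys_over K \<Longrightarrow> p ^ n \<in> polys_over K"
proof -
  note c = is_subfield_closed[OF K]
  show 0: "0 \<in> polys_over K" and 1: "1 \<in> polys_over K"
    by (auto simp: polys_over_def c coeff_1)
  have add: "\<And>p q. p \<in> polys_over K \<Longrightarrow> q \<in> polys_over K \<Longrightarrow> p + q \<in> polys_over K"
    and mult: "\<And>p q. p \<in> polys_over K \<Longrightarrow> q \<in> polys_over K \<Longrightarrow> p * q \<in> polys_over K"
    by (auto simp: polys_over_def c coeff_mult intro!: c)
  then show "p \<in> polys_over K \<Longrightarrow> q \<in> polys_over K \<Longrightarrow> p + q \<in> polys_over K"
    "p \<in> polys_over K \<Longrightarrow> q \<in> polys_over K \<Longrightarrow> p * q \<in> polys_over K" by auto
  show "p \<in> polys_over K \<Longrightarrow> - p \<in> polys_over K"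
    "p \<in> polys_over K \<Longrightarrow> q \<in> polys_over K \<Longrightarrow> p - q \<in> polys_over K"
    "a \<in> K \<Longrightarrow> p \<in> polys_over K \<Longrightarrow> smult a p \<in> polys_over K"
    "a \<in> K \<Longrightarrow> p \<in> polys_over K \<Longrightarrow> pCons a p \<in> polys_over K"
    "a \<in> K \<Longrightarrow> monom a n \<in> polys_over K"
    by (auto simp: polys_over_def c coeff_pCons split: nat.splits)
  show "(\<And>i. i \<in> A \<Longrightarrow> f i \<in> polys_over K) \<Longrightarrow> sum f A \<in> polys_over K"
    by (induction A rule: infinite_finite_induct) (auto intro: 0 add)
  show "(\<And>i. i \<in> A \<Longrightarrow> f i \<in> polys_over K) \<Longrightarrow> prod f A \<in> polys_over K"
    by (induction A rule: infinite_finite_induct) (auto intro: 1 mult)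
  show "p \<in> polys_over K \<Longrightarrow> p ^ n \<in> polys_over K"
    by (induction n) (auto intro: 1 mult)
qed

lemma poly_mem_subfield:
  assumes K: "is_subfield K" and p: "p \<in> polys_over K" and x: "x \<in> K"
  shows "poly p x \<in> K"
  unfolding poly_altdef by (intro is_subfield_closed[OF K] polys_overD[OF p] x)

text \<open>Long division inverts only the leading coefficient of \<open>m\<close>, so quotient and
  remainder keep their coefficients in \<open>K\<close>.\<close>

lemma polys_over_div_mod:
  assumes K: "is_subfield K" and p: "p \<in> polys_over K" and m: "m \<in> polys_over K" "m \<noteq> 0"
  shows "\<exists>q\<in>polys_over K. \<exists>r\<in>polys_over K. p = m * q + r \<and> (r = 0 \<or> degree r < degree m)"
  using p
\<comment> \<open>The length of the coefficient list, unlike the degree, drops from a nonzero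
  constant to 0, which is the remainder when \<open>m\<close> is constant.\<close>
proof (induction "length (coeffs p)" arbitrary: p rule: less_induct)
  case less
  note c = is_subfield_closed[OF K] and pc = polys_over_closed[OF K]
  show ?case
  proof (cases "p = 0 \<or> degree p < degree m")
    case True
    then show ?thesis using less.prems pc(1)
      by (intro bexI[of _ 0] bexI[of _ p]) auto
  next
    case False
    then have p0: "p \<noteq> 0" and deg: "degree m \<le> degree p" by auto
    define t where "t = monom (lead_coeff p / lead_coeff m) (degree p - degree m)"
    have t: "t \<in> polys_over K"
      unfolding t_def using less.prems m(1) by (auto intro!: pc c simp: polys_overD)
    have t0: "t \<noteq> 0" using p0 m(2) by (simp add: t_def)
    have degt: "degree (t * m) = degree p"
      using t0 m(2) p0 deg by (simp add: degree_mult_eq) (simp add: t_def degree_monom_eq)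
    have lc: "coeff (t * m) (degree p) = lead_coeff p"
      using degt m(2) p0 by (metis (no_types, lifting) lead_coeff_mult lead_coeff_monom leading_coeff_0_iff
          nonzero_eq_divide_eq t_def)
    define p' where "p' = p - t * m"
    have p': "p' \<in> polys_over K" unfolding p'_def by (intro pc t m(1) less.prems)
    have "p' = 0 \<or> degree p' < degree p"
    proof -
      have "degree p' \<le> degree p" unfolding p'_def using degt by (intro degree_diff_le) auto
      moreover have "coeff p' (degree p) = 0" by (simp add: p'_def lc)
      ultimately show ?thesis by (metis leading_coeff_0_iff nat_less_le)
    qed
    then have "length (coeffs p') < length (coeffs p)"
      using p0 by (cases "p' = 0") (auto simp: length_coeffs)
    from less.hyps[OF this p'] obtain q r where qr: "q \<in> polys_over K" "r \<in> polys_over K"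
      "p' = m * q + r" "r = 0 \<or> degree r < degree m" by blast
    have "p = m * (q + t) + r" using qr(3) by (simp add: p'_def algebra_simps)
    then show ?thesis using qr t pc(3) by blast
  qed
qed

text \<open>Quotient and remainder are unique over the ambient field, so division carried out over
  \<open>K\<close> must return \<open>q\<close> and remainder 0.\<close>

lemma polys_over_cancel:
  assumes K: "is_subfield K" and m: "m \<in> polys_over K" "m \<noteq> 0" and mq: "m * q \<in> polys_over K"
  shows "q \<in> polys_over K"
proof -
  from polys_over_div_mod[OF K mq m] obtain q' r where qr: "q' \<in> polys_over K" "r \<in> polys_over K"
    "m * q = m * q' + r" "r = 0 \<or> degree r < degree m" by blast
  have r: "r = m * (q - q')" using qr(3) by (simp add: algebra_simps)
  have "q - q' = 0"
  proof (rule ccontr)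
    assume "q - q' \<noteq> 0"
    then have "degree m \<le> degree r" "r \<noteq> 0" unfolding r using m(2) by (auto simp: degree_mult_eq)
    then show False using qr(4) by auto
  qed
  then show ?thesis using qr(1) by simp
qed

text \<open>The function is total but constrained on \<open>F\<close> alone; \<open>h 1 = 1\<close>
  rules out the zero map and makes it injective when \<open>F\<close> is a field.\<close>

definition hom_on :: "'a::field set \<Rightarrow> ('a \<Rightarrow> 'b::field) \<Rightarrow> bool" where
  "hom_on F h \<longleftrightarrow> h 1 = 1 \<and> (\<forall>x\<in>F. \<forall>y\<in>F. h (x + y) = h x + h y \<and> h (x * y) = h x * h y)"

lemma hom_on_mono: "hom_on F h \<Longrightarrow> E \<subseteq> F \<Longrightarrow> hom_on E h"
  by (auto simp: hom_on_def)

lemma hom_on_cong: "(\<And>x. x \<in> F \<Longrightarrow> h x = h' x) \<Longrightarrow> is_subfield F \<Longrightarrow> hom_on F h \<longleftrightarrow> hom_on F h'"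
  using is_subfield_closed[of F] by (auto simp: hom_on_def)

lemma hom_on_compose:
  "hom_on F h \<Longrightarrow> h ` F \<subseteq> E \<Longrightarrow> hom_on E g \<Longrightarrow> hom_on F (\<lambda>x. g (h x))"
  by (auto simp: hom_on_def image_subset_iff)

lemma hom_on_simps:
  assumes F: "is_subfield F" and h: "hom_on F h"
  shows "h 0 = 0" "h 1 = 1" "x \<in> F \<Longrightarrow> y \<in> F \<Longrightarrow> h (x + y) = h x + h y"
    "x \<in> F \<Longrightarrow> y \<in> F \<Longrightarrow> h (x * y) = h x * h y" "x \<in> F \<Longrightarrow> h (- x) = - h x"
    "x \<in> F \<Longrightarrow> y \<in> F \<Longrightarrow> h (x - y) = h x - h y" "x \<in> F \<Longrightarrow> h (inverse x) = inverse (h x)"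
    "x \<in> F \<Longrightarrow> y \<in> F \<Longrightarrow> h (x / y) = h x / h y" "x \<in> F \<Longrightarrow> h (x ^ n) = h x ^ n"
    "(\<And>i. i \<in> A \<Longrightarrow> f i \<in> F) \<Longrightarrow> h (sum f A) = (\<Sum>i\<in>A. h (f i))"
    "(\<And>i. i \<in> A \<Longrightarrow> f i \<in> F) \<Longrightarrow> h (prod f A) = (\<Prod>i\<in>A. h (f i))"
    "inj_on h F" "x \<in> F \<Longrightarrow> h x = 0 \<longleftrightarrow> x = 0"
proof -
  note c = is_subfield_closed[OF F]
  show 1: "h 1 = 1" using h by (simp add: hom_on_def)
  have add: "\<And>x y. x \<in> F \<Longrightarrow> y \<in> F \<Longrightarrow> h (x + y) = h x + h y"
    and mult: "\<And>x y. x \<in> F \<Longrightarrow> y \<in> F \<Longrightarrow> h (x * y) = h x * h y"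
    using h by (auto simp: hom_on_def)
  have "h 0 + h 0 = h 0" using add[OF c(1) c(1)] by simp
  then show 0: "h 0 = 0" using add_cancel_right_right by metis
  have neg: "\<And>x. x \<in> F \<Longrightarrow> h (- x) = - h x"
    by (metis 0 add add_eq_0_iff c(5) add.right_inverse)
  have zero: "h x = 0 \<longleftrightarrow> x = 0" if "x \<in> F" for x
  proof (cases "x = 0")
    case False
    then have "h x * h (inverse x) = 1" using mult[OF that c(7)[OF that]] 1 by simp
    then show ?thesis using False by auto
  qed (simp add: 0)
  have inv: "h (inverse x) = inverse (h x)" if "x \<in> F" for x
  proof (cases "x = 0")
    case False
    then have "h x * h (inverse x) = 1" using mult[OF that c(7)[OF that]] 1 by simp
    then show ?thesis by (simp add: inverse_unique)
  qed (simp add: 0)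
  have diff: "\<And>x y. x \<in> F \<Longrightarrow> y \<in> F \<Longrightarrow> h (x - y) = h x - h y"
    using add neg c(5) by (metis diff_conv_add_uminus)
  show "x \<in> F \<Longrightarrow> y \<in> F \<Longrightarrow> h (x + y) = h x + h y"
    "x \<in> F \<Longrightarrow> y \<in> F \<Longrightarrow> h (x * y) = h x * h y" "x \<in> F \<Longrightarrow> h (- x) = - h x"
    "x \<in> F \<Longrightarrow> y \<in> F \<Longrightarrow> h (x - y) = h x - h y" "x \<in> F \<Longrightarrow> h (inverse x) = inverse (h x)"
    "x \<in> F \<Longrightarrow> h x = 0 \<longleftrightarrow> x = 0"
    using add mult neg diff inv zero by auto
  show "x \<in> F \<Longrightarrow> y \<in> F \<Longrightarrow> h (x / y) = h x / h y"
    using mult[OF _ c(7)] inv by (simp add: divide_inverse)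
  show "x \<in> F \<Longrightarrow> h (x ^ n) = h x ^ n"
    by (induction n) (auto simp: 1 mult c)
  show "(\<And>i. i \<in> A \<Longrightarrow> f i \<in> F) \<Longrightarrow> h (sum f A) = (\<Sum>i\<in>A. h (f i))"
    by (induction A rule: infinite_finite_induct) (auto simp: 0 add c)
  show "(\<And>i. i \<in> A \<Longrightarrow> f i \<in> F) \<Longrightarrow> h (prod f A) = (\<Prod>i\<in>A. h (f i))"
    by (induction A rule: infinite_finite_induct) (auto simp: 1 mult c)
  show "inj_on h F"
    using diff zero c(6) by (intro inj_onI) (metis eq_iff_diff_eq_0)
qed

lemma is_subfield_image:
  assumes F: "is_subfield F" and h: "hom_on F h"
  shows "is_subfield (h ` F)"
proof -
  note c = is_subfield_closed[OF F] and s = hom_on_simps[OF F h]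
  show ?thesis
    by (rule is_subfieldI) (auto simp: c s(2)[symmetric] simp flip: s(3-5,7) intro!: imageI c)
qed

lemma map_poly_hom:
  assumes F: "is_subfield F" and h: "hom_on F h" and p: "p \<in> polys_over F"
  shows "coeff (map_poly h p) i = h (coeff p i)"
    "x \<in> F \<Longrightarrow> poly (map_poly h p) (h x) = h (poly p x)"
    "degree (map_poly h p) = degree p" "map_poly h p = 0 \<longleftrightarrow> p = 0"
    "map_poly h p \<in> polys_over (h ` F)"
    "q \<in> polys_over F \<Longrightarrow> map_poly h (p * q) = map_poly h p * map_poly h q"
    "q \<in> polys_over F \<Longrightarrow> map_poly h (p + q) = map_poly h p + map_poly h q"
    "q \<in> polys_over F \<Longrightarrow> map_poly h (p - q) = map_poly h p - map_poly h q"
proof -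
  note c = is_subfield_closed[OF F] and s = hom_on_simps[OF F h] and pc = polys_over_closed[OF F]
  have co: "coeff (map_poly h p) i = h (coeff p i)" for p i by (simp add: coeff_map_poly s)
  then show "coeff (map_poly h p) i = h (coeff p i)" by simp
  show deg: "degree (map_poly h p) = degree p"
  proof (rule antisym)
    show "degree (map_poly h p) \<le> degree p"
      by (intro degree_le) (simp add: co s coeff_eq_0)
    show "degree p \<le> degree (map_poly h p)"
      using s(13)[OF polys_overD[OF p], of "degree p"] by (cases "p = 0") (auto simp: co intro!: le_degree)
  qed
  show "map_poly h p = 0 \<longleftrightarrow> p = 0"
    using s(13)[OF polys_overD[OF p]] by (auto simp: poly_eq_iff co s)
  show "map_poly h p \<in> polys_over (h ` F)" using p by (auto simp: polys_over_def co)
  show "poly (map_poly h p) (h x) = h (poly p x)" if x: "x \<in> F"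
    unfolding poly_altdef deg using x p
    by (simp add: s(10,4,9) co c(4,9) polys_overD)
  show "q \<in> polys_over F \<Longrightarrow> map_poly h (p * q) = map_poly h p * map_poly h q"
    using p by (auto simp: poly_eq_iff co coeff_mult s(10) s(4) c polys_overD)
  show "q \<in> polys_over F \<Longrightarrow> map_poly h (p + q) = map_poly h p + map_poly h q"
    "q \<in> polys_over F \<Longrightarrow> map_poly h (p - q) = map_poly h p - map_poly h q"
    using p by (auto simp: poly_eq_iff co s polys_overD)
qed

lemma map_poly_id_on: 
  assumes "\<And>x. x \<in> K \<Longrightarrow> h x = x" "p \<in> polys_over K" "0 \<in> K"
  shows "map_poly h p = p"
  using assms by (auto simp: poly_eq_iff coeff_map_poly polys_overD)

lemma map_poly_linear_factors:
  assumes F: "is_subfield F" and h: "hom_on F h" and S: "finite S" "S \<subseteq> F"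
  shows "map_poly h (\<Prod>s\<in>S. [:- s, 1:]) = (\<Prod>s\<in>S. [:- h s, 1:])"
  using S
proof (induction S rule: finite_induct)
  case (insert s S)
  note c = is_subfield_closed[OF F] and s = hom_on_simps[OF F h] and pc = polys_over_closed[OF F]
  have 1: "map_poly h [:- s, 1:] = [:- h s, 1:]"
    using insert.prems by (simp add: map_poly_pCons s)
  have "map_poly h ([:- s, 1:] * (\<Prod>s\<in>S. [:- s, 1:])) =
      map_poly h [:- s, 1:] * map_poly h (\<Prod>s\<in>S. [:- s, 1:])"
    by (rule map_poly_hom(6)[OF F h]) (use insert.prems in \<open>auto intro!: pc c\<close>)
  then show ?case using insert 1 by simp
qed (simp add: hom_on_simps[OF F h])

section \<open>Algebraic elements and minimal polynomials\<close>

lemma coeff_Poly_rev: "coeff (Poly (rev p)) i = ring.coeff (ambient :: 'a::field ring) p i"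
proof -
  interpret field "ambient :: 'a ring" by (rule ambient_field)
  show ?thesis
    by (induction p) (auto simp: nth_default_append nth_default_def nth_append)
qed

lemma eval_eq_poly: "ring.eval (ambient :: 'a::field ring) p x = poly (Poly (rev p)) x"
proof -
  interpret field "ambient :: 'a ring" by (rule ambient_field)
  show ?thesis
    by (induction p) (auto simp: Poly_append poly_monom algebra_simps)
qed

lemma carrier_univ_poly_ambient:
  "p \<in> carrier (univ_poly (ambient :: 'a::field ring) K) \<longleftrightarrow> p = [] \<or> set p \<subseteq> K \<and> hd p \<noteq> 0"
  by (simp add: univ_poly_def polynomial_def)

lemma Poly_rev_mem:
  assumes "is_subfield K" "p \<in> carrier (univ_poly ambient K)"
  shows "Poly (rev p) \<in> polys_over K"
  using assms is_subfield_closed(1)[OF assms(1)]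
  by (auto simp: polys_over_def carrier_univ_poly_ambient nth_default_def)
     (metis length_rev nth_mem set_rev subsetD)

lemma Poly_rev_eq_0:
  "p \<in> carrier (univ_poly ambient K) \<Longrightarrow> Poly (rev p) = 0 \<longleftrightarrow> p = []"
  by (cases p) (auto simp: carrier_univ_poly_ambient poly_eq_iff nth_default_append nth_default_def
      nth_append intro!: exI[of _ "length p - 1"])

lemma rev_coeffs_mem:
  "p \<in> polys_over K \<Longrightarrow> rev (coeffs p) \<in> carrier (univ_poly ambient K)"
  by (auto simp: carrier_univ_poly_ambient polys_over_def coeffs_def hd_rev last_map)

text \<open>Together with \<open>min_poly_is_min_poly\<close> this leads from the coefficient lists
  of the definitions to polynomials of type \<open>poly\<close>, list reversal being the translation
  in both directions.\<close>

lemma algebraic_iff: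
  assumes K: "is_subfield K"
  shows "(ring.algebraic ambient over K) x \<longleftrightarrow> (\<exists>p\<in>polys_over K. p \<noteq> 0 \<and> poly p x = 0)"
proof -
  interpret field "ambient :: 'a ring" by (rule ambient_field)
  show ?thesis
  proof
    assume "(algebraic over K) x"
    then obtain p where p: "p \<in> carrier (univ_poly ambient K)" "p \<noteq> []" "eval p x = 0"
      using algebraicE[OF subfieldE(1)[OF K]] by (metis UNIV_I ambient_simps(1,5))
    then show "\<exists>p\<in>polys_over K. p \<noteq> 0 \<and> poly p x = 0"
      using Poly_rev_mem[OF K] Poly_rev_eq_0[of p K] eval_eq_poly[of p x] by metis
  next
    assume "\<exists>p\<in>polys_over K. p \<noteq> 0 \<and> poly p x = 0"
    then obtain p where p: "p \<in> polys_over K" "p \<noteq> 0" "poly p x = 0" by blast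
    show "(algebraic over K) x"
      by (rule algebraicI[OF rev_coeffs_mem[OF p(1)]]) (use p in \<open>auto simp: eval_eq_poly\<close>)
  qed
qed

lemma transcendental_iff:
  assumes K: "is_subfield K"
  shows "(ring.transcendental ambient over K) x \<longleftrightarrow> (\<forall>p\<in>polys_over K. poly p x = 0 \<longrightarrow> p = 0)"
  using algebraic_iff[OF K, of x] by (auto simp: over_def)

text \<open>Minimality is divisibility with a quotient over \<open>K\<close>. As a relation it can
  be claimed for one and the same \<open>m\<close> over several fields, which is how the persistence
  of irreducibility under constant extension is expressed.\<close>

definition is_min_poly :: "'a::field set \<Rightarrow> 'a \<Rightarrow> 'a poly \<Rightarrow> bool" where
  "is_min_poly K x m \<longleftrightarrow> m \<in> polys_over K \<and> lead_coeff m = 1 \<and> poly m x = 0 \<and>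
     (\<forall>p\<in>polys_over K. poly p x = 0 \<longrightarrow> (\<exists>q\<in>polys_over K. p = m * q))"

lemma is_min_polyI:
  assumes K: "is_subfield K" and m: "m \<in> polys_over K" "lead_coeff m = 1" "poly m x = 0"
    and min: "\<And>p. p \<in> polys_over K \<Longrightarrow> p \<noteq> 0 \<Longrightarrow> poly p x = 0 \<Longrightarrow> degree m \<le> degree p"
  shows "is_min_poly K x m"
proof -
  have "\<exists>q\<in>polys_over K. p = m * q" if p: "p \<in> polys_over K" "poly p x = 0" for p
  proof -
    have "m \<noteq> 0" using m(2) by auto
    from polys_over_div_mod[OF K p(1) m(1) this] obtain q r where
      qr: "q \<in> polys_over K" "r \<in> polys_over K" "p = m * q + r" "r = 0 \<or> degree r < degree m" by blast
    have "poly r x = 0" using p(2) m(3) qr(3) by simp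
    then have "r = 0" using min[OF qr(2)] qr(4) by fastforce
    then show ?thesis using qr by auto
  qed
  then show ?thesis using m by (auto simp: is_min_poly_def)
qed

lemma is_min_poly_exists:
  assumes K: "is_subfield K" and "\<exists>p\<in>polys_over K. p \<noteq> 0 \<and> poly p x = 0"
  shows "\<exists>m. is_min_poly K x m"
proof -
  define P where "P p \<longleftrightarrow> p \<in> polys_over K \<and> p \<noteq> 0 \<and> poly p x = 0" for p
  obtain p where p: "P p" "\<And>q. P q \<Longrightarrow> degree p \<le> degree q"
    using assms(2) ex_has_least_nat[of P _ degree] unfolding P_def by blast
  define m where "m = smult (inverse (lead_coeff p)) p"
  have "m \<in> polys_over K" unfolding m_def using p(1)
    by (intro polys_over_closed[OF K] is_subfield_closed[OF K]) (auto simp: P_def polys_overD)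
  then have "is_min_poly K x m"
    using p by (intro is_min_polyI[OF K]) (auto simp: m_def P_def)
  then show ?thesis ..
qed

lemma finsum_ambient: "finsum (ambient :: 'a::field ring) f A = sum f A"
proof -
  interpret field "ambient :: 'a ring" by (rule ambient_field)
  show ?thesis by (induction A rule: infinite_finite_induct) auto
qed

lemma Poly_rev_mult:
  "Poly (rev (ring.poly_mult ambient p q)) = Poly (rev p) * Poly (rev (q :: 'a::field list))"
proof -
  interpret field "ambient :: 'a ring" by (rule ambient_field)
  show ?thesis
  proof (rule poly_eqI)
    fix i
    show "poly.coeff (Poly (rev (poly_mult p q))) i = poly.coeff (Poly (rev p) * Poly (rev q)) i"
      using fun_cong[OF poly_mult_coeff[of p q], of i]
      by (simp only: coeff_Poly_rev coeff_mult finsum_ambient ambient_simps subset_UNIV simp_thms True_implies_equals)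
  qed
qed

lemma pdivides_imp_dvd:
  "p pdivides\<^bsub>ambient\<^esub> q \<Longrightarrow> Poly (rev p) dvd Poly (rev (q :: 'a::field list))"
  by (auto simp: pdivides_def factor_def univ_poly_mult Poly_rev_mult)

lemma min_poly_is_min_poly:
  assumes K: "is_subfield K" and alg: "(ring.algebraic ambient over K) x"
  shows "is_min_poly K x (min_poly K x)"
proof -
  interpret domain "ambient :: 'a ring" by (rule ambient_domain)
  note I = IrrE[OF K _ alg]
  have m: "min_poly K x \<in> polys_over K" "poly (min_poly K x) x = 0"
    using I Poly_rev_mem[OF K] by (auto simp: min_poly_def simp flip: eval_eq_poly)
  obtain a l where al: "Irr K x = a # l"
    using I(2) Poly_rev_eq_0 I(1,4) by (metis UNIV_I ambient_simps(1) list.exhaust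
        pirreducibleE(1)[OF subfieldE(1)[OF K] I(1)])
  then have a: "a = 1" using I(3) by simp
  have "degree (min_poly K x) = length l"
    unfolding min_poly_def al a by (intro antisym degree_le le_degree) 
      (auto simp: nth_default_append nth_default_def nth_append)
  then have lc: "lead_coeff (min_poly K x) = 1"
    by (simp add: min_poly_def al a nth_default_append nth_default_def nth_append)
  have "\<exists>q\<in>polys_over K. p = min_poly K x * q" if p: "p \<in> polys_over K" "poly p x = 0" for p
  proof -
    have "Irr K x pdivides\<^bsub>ambient\<^esub> rev (coeffs p)"
      by (rule Irr_minimal[OF K _ alg rev_coeffs_mem[OF p(1)]]) (use p in \<open>auto simp: eval_eq_poly\<close>)
    from pdivides_imp_dvd[OF this] obtain q where q: "p = min_poly K x * q"
      by (auto simp: min_poly_def)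
    then show ?thesis using polys_over_cancel[OF K m(1), of q] p(1) lc by fastforce
  qed
  then show ?thesis using m lc by (auto simp: is_min_poly_def)
qed

lemma degree_Irr:
  assumes K: "is_subfield K" and alg: "(ring.algebraic ambient over K) x"
  shows "length (ring.Irr ambient K x) - 1 = degree (min_poly K x)" "ring.Irr ambient K x \<noteq> []"
proof -
  interpret domain "ambient :: 'a ring" by (rule ambient_domain)
  note I = IrrE[OF K _ alg]
  have "min_poly K x \<noteq> 0" using min_poly_is_min_poly[OF K alg] by (auto simp: is_min_poly_def)
  then obtain a l where al: "Irr K x = a # l"
    by (cases "Irr K x") (auto simp: min_poly_def)
  then have a: "a = 1" using I(3) by simp
  show "length (Irr K x) - 1 = degree (min_poly K x)" "Irr K x \<noteq> []"
    unfolding min_poly_def al a by (auto intro!: antisym[OF le_degree degree_le] 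
      simp: nth_default_append nth_default_def nth_append)
qed

subsection \<open>Products of linear factors\<close>

text \<open>The product runs over a set, so its roots are simple; for finite \<open>S\<close>,
  \<open>lin_prod S \<in> polys_over K\<close> says that the elements of \<open>S\<close> are
  separable over \<open>K\<close> and that \<open>S\<close> is closed under conjugation.\<close>

abbreviation lin_prod :: "'a::comm_ring_1 set \<Rightarrow> 'a poly" where
  "lin_prod S \<equiv> (\<Prod>s\<in>S. [:- s, 1:])"

lemma degree_lin_prod: "degree (lin_prod (S :: 'a::idom set)) = card S"
  by (induction S rule: infinite_finite_induct) (auto simp: degree_mult_eq simp del: mult_pCons_left)

lemma lead_coeff_lin_prod: "lead_coeff (lin_prod (S :: 'a::idom set)) = 1"
  by (simp add: lead_coeff_prod)

lemma lin_prod_nz: "lin_prod (S :: 'a::idom set) \<noteq> 0"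
  using lead_coeff_lin_prod[of S] by (metis leading_coeff_0_iff zero_neq_one)

lemma poly_lin_prod: "finite S \<Longrightarrow> poly (lin_prod (S :: 'a::idom set)) x = 0 \<longleftrightarrow> x \<in> S"
  by (auto simp: poly_prod)

text \<open>Induction on \<open>S\<close>: the factor X - s belongs to \<open>m\<close> or to its
  cofactor, and is cancelled there.\<close>

lemma dvd_lin_prod:
  assumes "finite S" "m dvd lin_prod S" "lead_coeff m = (1 :: 'a::field)"
  shows "\<exists>S'\<subseteq>S. m = lin_prod S'"
  using assms
proof (induction S arbitrary: m rule: finite_induct)
  case empty
  then have "degree m = 0" using is_unit_iff_degree[of m] by fastforce
  then obtain c where "m = [:c:]" by (metis degree_eq_zeroE)
  then show ?case using empty by (auto simp: one_pCons)
next
  case (insert s S)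
  from insert.prems insert.hyps obtain c where c: "[:- s, 1:] * lin_prod S = m * c"
    by (auto elim!: dvdE)
  show ?case
  proof (cases "poly m s = 0")
    case True
    then obtain m' where m': "m = [:- s, 1:] * m'" by (auto simp: poly_eq_0_iff_dvd elim!: dvdE)
    then have "[:- s, 1:] * lin_prod S = [:- s, 1:] * (m' * c)" using c by (metis mult.assoc)
    then have "lin_prod S = m' * c" using mult_left_cancel[of "[:- s, 1:]"] by fastforce
    then have "m' dvd lin_prod S" by simp
    moreover have "lead_coeff m' = 1" using insert.prems(2) unfolding m' lead_coeff_mult by simp
    ultimately obtain S' where "S' \<subseteq> S" "m' = lin_prod S'" using insert.IH by blast
    moreover from this have "s \<notin> S'" "finite S'" using insert.hyps finite_subset by auto
    then have "lin_prod (insert s S') = [:- s, 1:] * lin_prod S'" by (rule prod.insert[rotated])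
    ultimately show ?thesis using m' by (intro exI[of _ "insert s S'"]) auto
  next
    case False
    have "poly (m * c) s = 0" using arg_cong[OF c, of "\<lambda>p. poly p s"] by simp
    then have "poly c s = 0" using False by simp
    then obtain c' where c': "c = [:- s, 1:] * c'" by (auto simp: poly_eq_0_iff_dvd elim!: dvdE)
    then have "[:- s, 1:] * lin_prod S = [:- s, 1:] * (m * c')" using c by (metis mult.left_commute)
    then have "lin_prod S = m * c'" using mult_left_cancel[of "[:- s, 1:]"] by fastforce
    then have "m dvd lin_prod S" by simp
    then show ?thesis using insert.IH insert.prems by blast
  qed
qed

text \<open>A common divisor, made monic, is a product over a subset of \<open>S\<close>. At an s in
  that subset the derivative equals the product of the differences s - s' with s' \<noteq> s, which
  is nonzero; so the subset is empty.\<close>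

lemma coprime_pderiv_lin_prod:
  assumes "finite (S :: 'a::field set)"
  shows "coprime (lin_prod S) (pderiv (lin_prod S))"
proof (rule coprimeI)
  fix d assume d: "d dvd lin_prod S" "d dvd pderiv (lin_prod S)"
  have d0: "d \<noteq> 0" using d(1) lin_prod_nz[of S] by auto
  define d' where "d' = smult (inverse (lead_coeff d)) d"
  have d'd: "d' dvd d" "d dvd d'" using d0 by (auto simp: d'_def smult_dvd_iff dvd_smult_iff)
  have "lead_coeff d' = 1" using d0 by (simp add: d'_def)
  then obtain S' where S': "S' \<subseteq> S" "d' = lin_prod S'"
    using dvd_lin_prod[OF assms, of d'] d(1) d'd dvd_trans by blast
  have "S' = {}"
  proof (rule ccontr)
    assume "S' \<noteq> {}"
    then obtain s where s: "s \<in> S'" by blast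
    have fin: "finite S'" using S'(1) assms finite_subset by blast
    have "poly d' s = 0" using S' s fin by (simp add: poly_lin_prod)
    then have 0: "poly (pderiv (lin_prod S)) s = 0"
      using d(2) d'd(1) dvd_trans by (metis poly_eq_0_iff_dvd)
    have "s \<in> S" using s S' by blast
    then have "lin_prod S = [:- s, 1:] * lin_prod (S - {s})" using assms by (rule prod.remove[rotated])
    then have "poly (pderiv (lin_prod S)) s = poly (lin_prod (S - {s})) s"
      by (simp add: pderiv_mult pderiv_pCons del: mult_pCons_left)
    then show False using 0 assms by (simp add: poly_lin_prod)
  qed
  then have "d' = 1" using S'(2) by simp
  then show "is_unit d" using d'd by simp
qed

text \<open>A repeated linear factor would also divide the derivative.\<close>

lemma distinct_linear_factors:
  assumes "coprime m (pderiv m)" "m = (\<Prod>x\<in>#A. [:- x, 1 :: 'a::field:])"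
  shows "m = lin_prod (set_mset A)"
proof -
  have "count A x = 1" if x: "x \<in># A" for x
  proof (rule ccontr)
    assume "count A x \<noteq> 1"
    then have "x \<in># A - {#x#}" using x by (metis One_nat_def count_single count_diff count_greater_zero_iff diff_is_0_eq
        in_diff_count le_neq_implies_less less_one linorder_not_le)
    then obtain A' where "A = add_mset x (add_mset x A')" by (metis insert_DiffM x)
    then have "m = [:- x, 1:] * ([:- x, 1:] * (\<Prod>x\<in>#A'. [:- x, 1:]))" using assms(2) by simp
    then have "[:- x, 1:] dvd m" "[:- x, 1:] dvd pderiv m"
      by (auto simp: pderiv_mult simp del: mult_pCons_left intro!: dvd_add)
    then have "is_unit [:- x, 1:]" using assms(1) by (meson coprime_common_divisor)
    then show False by (simp add: is_unit_iff_degree)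
  qed
  then have "A = mset_set (set_mset A)"
    by (intro multiset_eqI) (metis count_mset_set count_eq_zero_iff finite_set_mset)
  then show ?thesis using assms(2) by (metis prod_unfold_prod_mset)
qed

subsection \<open>A characterisation of Galois extensions\<close>

text \<open>\<open>splitted\<close> says that there are as many roots in \<open>L\<close> as the
  degree allows. Each root is divided off in the polynomial ring over the field \<open>L\<close>,
  and the identity is read over the ambient field, where multiplication is the same.\<close>

lemma splitted_imp_linear_factors:
  assumes L: "is_subfield L" and p: "p \<in> carrier (univ_poly ambient L)" "p \<noteq> []"
    and split: "ring.splitted (ambient\<lparr>carrier := L\<rparr>) p"
  shows "\<exists>A. set_mset A \<subseteq> L \<and> Poly (rev p) = smult (hd p) (\<Prod>x\<in>#A. [:- x, 1:])"
proof -
  interpret A: field "ambient :: 'a ring" by (rule ambient_field)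
  let ?R = "ambient\<lparr>carrier := L\<rparr>"
  interpret R: field ?R using A.subfield_iff(2)[OF L] .
  have sub: "subring L ambient" using L by (rule subfieldE)
  have UP: "univ_poly ?R (carrier ?R) = univ_poly ambient L"
    using A.univ_poly_consistent[OF sub, symmetric] by simp
  have mult: "R.poly_mult = A.poly_mult" using A.poly_mult_consistent[OF sub] by simp
  interpret UP: domain "poly_ring ?R" using R.univ_poly_is_domain[OF R.carrier_is_subring] .
  have min: "\<ominus>\<^bsub>?R\<^esub> x = - x" if "x \<in> L" for x
    using R.minus_equality[of "- x" x] that is_subfield_closed[OF L] by simp
  show ?thesis using p split
  proof (induction "length p" arbitrary: p rule: less_induct)
    case less
    show ?case
    proof (cases "length p = 1")
      case True
      then obtain a where "p = [a]" by (auto simp: length_Suc_conv)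
      then show ?thesis using less.prems by (intro exI[of _ "{#}"]) auto
    next
      case False
      then have deg: "length p \<ge> 2" using less.prems(2) by (cases p) (auto simp: Suc_le_eq)
      then have "R.roots p \<noteq> {#}" using less.prems(3) by (auto simp: R.splitted_def)
      then obtain a where "a \<in># R.roots p" by blast
      then have root: "R.is_root p a"
        using R.roots_mem_iff_is_root[of p] less.prems(1) UP by simp
      then have aL: "a \<in> L" by (simp add: R.is_root_def)
      obtain q where q: "q \<in> carrier (poly_ring ?R)" "p = [1, - a] \<otimes>\<^bsub>poly_ring ?R\<^esub> q"
        using R.is_root_imp_pdivides[OF _ root] less.prems(1) UP min[OF aL]
        by (auto simp: pdivides_def factor_def)
      have "[1, - a] \<in> carrier (poly_ring ?R)"
        using aL is_subfield_closed(2,5)[OF L] unfolding UP by (simp add: carrier_univ_poly_ambient)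
      then have q0: "q \<noteq> []"
        using q less.prems(2) UP.r_null[of "[1, - a]"] unfolding univ_poly_zero by blast
      have Pp: "Poly (rev p) = [:- a, 1:] * Poly (rev q)"
        unfolding q(2) univ_poly_mult mult Poly_rev_mult by simp
      have roots: "R.roots p = add_mset a (R.roots q)"
        using R.poly_mult_degree_one_monic_imp_same_roots[of a q] q q0 aL min[OF aL] by simp
      have lenq: "length p = Suc (length q)"
      proof -
        have 1: "length r = Suc (degree (Poly (rev r)))" "hd r = lead_coeff (Poly (rev r))"
          if "r \<in> carrier (univ_poly ambient L)" "r \<noteq> []" for r
        proof -
          from that obtain b l where r: "r = b # l" "b \<noteq> 0" by (cases r) (auto simp: carrier_univ_poly_ambient)
          have d: "degree (Poly (rev r)) = length l"
            unfolding r using r(2) by (intro antisym degree_le le_degree)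
              (auto simp: nth_default_append nth_default_def nth_append)
          then show "length r = Suc (degree (Poly (rev r)))" by (simp add: r)
          show "hd r = lead_coeff (Poly (rev r))"
            unfolding d by (simp add: r nth_default_append nth_default_def nth_append)
        qed
        have "degree (Poly (rev p)) = Suc (degree (Poly (rev q)))"
          unfolding Pp using q q0 UP Poly_rev_eq_0[of q L]
          by (subst degree_mult_eq) auto
        then show ?thesis using 1(1)[OF less.prems(1,2)] 1(1)[of q] q q0 UP by simp
      qed
      have "hd p = hd q"
      proof -
        have 1: "hd r = coeff (Poly (rev r)) (length r - 1)" if "r \<noteq> []" for r :: "'a list"
          using that by (cases r) (auto simp: nth_default_append nth_default_def nth_append)
        have "coeff (Poly (rev q)) (length q) = 0"
          by (simp add: nth_default_def)
        then have "coeff (Poly (rev p)) (length q) = coeff (Poly (rev q)) (length q - 1)"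
          unfolding Pp using q0 by (cases "length q") (auto simp: coeff_pCons)
        then show ?thesis using 1[OF less.prems(2)] 1[OF q0] lenq by simp
      qed
      moreover have "R.splitted q"
        using less.prems(3) roots lenq q0 by (cases q) (auto simp: R.splitted_def)
      then obtain A where "set_mset A \<subseteq> L" "Poly (rev q) = smult (hd q) (\<Prod>x\<in>#A. [:- x, 1:])"
        using less.hyps[of q] lenq q q0 UP by auto
      ultimately show ?thesis using Pp aL
        by (intro exI[of _ "add_mset a A"]) (simp add: algebra_simps)
    qed
  qed
qed

text \<open>The minimal polynomial divides \<open>lin_prod S\<close>, so it is itself a product of
  distinct linear factors.\<close>

lemma separable_elementI:
  assumes K: "is_subfield K" and S: "finite S" "x \<in> S" "lin_prod S \<in> polys_over K"
  shows "(ring.algebraic ambient over K) x" "coprime (min_poly K x) (pderiv (min_poly K x))"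
    "\<exists>S'\<subseteq>S. min_poly K x = lin_prod S'"
proof -
  have root: "poly (lin_prod S) x = 0" using S poly_lin_prod by blast
  then show alg: "(ring.algebraic ambient over K) x"
    using algebraic_iff[OF K, of x] S(3) lin_prod_nz[of S] by blast
  note m = min_poly_is_min_poly[OF K alg]
  have "min_poly K x dvd lin_prod S"
    using m root S(3) unfolding is_min_poly_def by fastforce
  then show "\<exists>S'\<subseteq>S. min_poly K x = lin_prod S'"
    using dvd_lin_prod[OF S(1)] m unfolding is_min_poly_def by blast
  then show "coprime (min_poly K x) (pderiv (min_poly K x))"
    using coprime_pderiv_lin_prod S(1) finite_subset by metis
qed

lemma card_set_mset_le_size: "card (set_mset A) \<le> size A"
  by (induction A) (auto simp: card_insert_if)

text \<open>The working form of Galois: normality and separability are merged into one condition,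
  and the polynomial for \<open>x\<close> need not be minimal. Hence a finite orbit containing
  \<open>x\<close> can serve as a witness.\<close>

lemma galois_extension_iff:
  "galois_extension K L \<longleftrightarrow> is_subfield K \<and> is_subfield L \<and> K \<subseteq> L \<and>
     (\<forall>x\<in>L. \<exists>S. finite S \<and> S \<subseteq> L \<and> x \<in> S \<and> lin_prod S \<in> polys_over K)"
proof
  assume G: "galois_extension K L"
  then have K: "is_subfield K" and L: "is_subfield L" and KL: "K \<subseteq> L"
    and alg: "\<And>x. x \<in> L \<Longrightarrow> (ring.algebraic ambient over K) x"
    and split: "\<And>x. x \<in> L \<Longrightarrow> ring.splitted (ambient\<lparr>carrier := L\<rparr>) (ring.Irr ambient K x)"
    and sep: "\<And>x. x \<in> L \<Longrightarrow> coprime (min_poly K x) (pderiv (min_poly K x))"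
    by (auto simp: galois_extension_def normal_extension_def separable_extension_def
        algebraic_extension_def field_extension_def)
  have "\<exists>S. finite S \<and> S \<subseteq> L \<and> x \<in> S \<and> lin_prod S \<in> polys_over K" if x: "x \<in> L" for x
  proof -
    interpret domain "ambient :: 'a ring" by (rule ambient_domain)
    have "Irr K x \<in> carrier (univ_poly ambient K)" "hd (Irr K x) = 1"
      using IrrE(1,3)[OF K _ alg[OF x]] by auto
    then have "Irr K x \<in> carrier (univ_poly ambient L)" and hd: "hd (Irr K x) = 1"
      using KL unfolding carrier_univ_poly_ambient by (blast, simp)
    from splitted_imp_linear_factors[OF L this(1) degree_Irr(2)[OF K alg[OF x]] split[OF x]]
    obtain A where A: "set_mset A \<subseteq> L" "min_poly K x = (\<Prod>x\<in>#A. [:- x, 1:])"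
      unfolding min_poly_def hd by auto
    note m = min_poly_is_min_poly[OF K alg[OF x]]
    have eq: "min_poly K x = lin_prod (set_mset A)"
      by (rule distinct_linear_factors[OF sep[OF x] A(2)])
    then have "lin_prod (set_mset A) \<in> polys_over K" using m by (simp add: is_min_poly_def)
    moreover have "x \<in> set_mset A"
      using m eq poly_lin_prod[of "set_mset A" x] by (simp add: is_min_poly_def)
    ultimately show ?thesis using A(1) by blast
  qed
  then show "is_subfield K \<and> is_subfield L \<and> K \<subseteq> L \<and>
     (\<forall>x\<in>L. \<exists>S. finite S \<and> S \<subseteq> L \<and> x \<in> S \<and> lin_prod S \<in> polys_over K)"
    using K L KL by blast
next
  assume R: "is_subfield K \<and> is_subfield L \<and> K \<subseteq> L \<and>
     (\<forall>x\<in>L. \<exists>S. finite S \<and> S \<subseteq> L \<and> x \<in> S \<and> lin_prod S \<in> polys_over K)"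
  then have K: "is_subfield K" and L: "is_subfield L" and KL: "K \<subseteq> L" by auto
  have "(ring.algebraic ambient over K) x \<and> coprime (min_poly K x) (pderiv (min_poly K x)) \<and>
      ring.splitted (ambient\<lparr>carrier := L\<rparr>) (ring.Irr ambient K x)" if x: "x \<in> L" for x
  proof -
    from R x obtain S where S: "finite S" "S \<subseteq> L" "x \<in> S" "lin_prod S \<in> polys_over K" by blast
    note se = separable_elementI[OF K S(1,3,4)]
    from se(3) obtain S' where S': "S' \<subseteq> S" "min_poly K x = lin_prod S'" by blast
    interpret A: field "ambient :: 'a ring" by (rule ambient_field)
    let ?R = "ambient\<lparr>carrier := L\<rparr>"
    interpret R: field ?R using A.subfield_iff(2)[OF L] .
    have sub: "subring L ambient" using L by (rule subfieldE)
    have UP: "univ_poly ?R (carrier ?R) = univ_poly ambient L"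
      using A.univ_poly_consistent[OF sub, symmetric] by simp
    let ?p = "A.Irr K x"
    have "?p \<in> carrier (univ_poly ambient K)" using A.IrrE(1)[OF K _ se(1)] by simp
    then have p: "?p \<in> carrier (poly_ring ?R)"
      using KL unfolding UP carrier_univ_poly_ambient by blast
    have fin: "finite S'" using S' S finite_subset by blast
    \<comment> \<open>The elements of \<open>S'\<close> are roots in \<open>L\<close>, and their
      number is the degree of the minimal polynomial; the bound on the number of roots then forces
      splitting.\<close>
    have "S' \<subseteq> set_mset (R.roots ?p)"
    proof
      fix s assume s: "s \<in> S'"
      have "poly (min_poly K x) s = 0" using s S' fin by (simp add: poly_lin_prod)
      then have "R.eval ?p s = 0"
        unfolding A.eval_consistent[OF sub] eval_eq_poly min_poly_def .
      then have "R.is_root ?p s" using s S' S degree_Irr(2)[OF K se(1)] by (auto simp: R.is_root_def)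
      then show "s \<in># R.roots ?p" using R.roots_mem_iff_is_root[OF p] by simp
    qed
    then have "card S' \<le> card (set_mset (R.roots ?p))" by (intro card_mono) auto
    also have "\<dots> \<le> size (R.roots ?p)"
      by (rule card_set_mset_le_size)
    finally have "length ?p - 1 \<le> size (R.roots ?p)"
      using S'(2) degree_lin_prod[of S'] degree_Irr(1)[OF K se(1)] by simp
    then have "R.splitted ?p" using R.size_roots_le_degree[OF p] by (simp add: R.splitted_def)
    then show ?thesis using se by simp
  qed
  then show "galois_extension K L"
    using K L KL by (auto simp: galois_extension_def normal_extension_def separable_extension_def
        algebraic_extension_def field_extension_def)
qed

subsection \<open>Algebraic closures inside the ambient field\<close>

lemma algebraic_closure_is_subfield:
  "is_subfield K \<Longrightarrow> is_subfield (algebraic_closure_of K)"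
  using field.subfield_of_algebraics[OF ambient_field] by (simp add: algebraic_closure_of_def)

lemma algebraic_closure_base: "is_subfield K \<Longrightarrow> K \<subseteq> algebraic_closure_of K"
  using domain.algebraic_self[OF ambient_domain subfieldE(1)]
  by (auto simp: algebraic_closure_of_def)

text \<open>The coefficients of \<open>p\<close> generate a finite extension of \<open>K\<close>,
  and \<open>x\<close> is algebraic over that; the tower is finite over \<open>K\<close>.\<close>

lemma mem_algebraic_closure:
  assumes K: "is_subfield K" and p: "p \<in> polys_over (algebraic_closure_of K)" "p \<noteq> 0" "poly p x = 0"
  shows "x \<in> algebraic_closure_of K"
proof -
  interpret field "ambient :: 'a ring" by (rule ambient_field)
  let ?E = "finite_extension K (coeffs p)"
  have alg: "\<And>c. c \<in> set (coeffs p) \<Longrightarrow> (algebraic over K) c"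
    using p(1) by (auto simp: algebraic_closure_of_def polys_over_def coeffs_def split: if_splits)
  have E: "is_subfield ?E" by (rule finite_extension_is_subfield[OF K]) (use alg in auto)
  have "set (coeffs p) \<subseteq> ?E" by (rule finite_extension_mem[OF subfieldE(1)[OF K]]) auto
  then have "p \<in> polys_over ?E"
    using is_subfield_closed(1)[OF E] by (intro polys_overI) (metis coeff_in_coeffs le_degree p(2) subsetD)
  then have algE: "(algebraic over ?E) x" using algebraic_iff[OF E] p by blast
  have "finite_dimension K ?E" by (rule finite_extension_finite_dimension(1)[OF K]) (use alg in auto)
  then have "finite_dimension K (simple_extension ?E x)"
    by (rule telescopic_base_dim(1)[OF K E _ finite_dimensionI[OF dimension_simple_extension[OF E _ algE]]]) simp
  then have "(algebraic over K) x"
    using finite_dimension_imp_algebraic[OF K simple_extension_is_subring[OF subfieldE(1)[OF E]]]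
      simple_extension_mem[OF subfieldE(1)[OF E]] by (metis UNIV_I ambient_simps(1))
  then show ?thesis by (simp add: algebraic_closure_of_def)
qed

lemma transcendental_over_closure:
  assumes "is_subfield K" "(ring.transcendental ambient over K) x"
  shows "(ring.transcendental ambient over algebraic_closure_of K) x"
  unfolding transcendental_iff[OF algebraic_closure_is_subfield[OF assms(1)]]
  using mem_algebraic_closure[OF assms(1), of _ x] assms(2) by (auto simp: algebraic_closure_of_def over_def)

lemma algebraic_closure_root:
  fixes K :: "'a::alg_closed_field set"
  assumes K: "is_subfield K" and p: "p \<in> polys_over (algebraic_closure_of K)" "degree p > 0"
  shows "\<exists>x\<in>algebraic_closure_of K. poly p x = 0"
proof -
  obtain x where "poly p x = 0" using alg_closed_imp_poly_has_root[OF p(2)] by blast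
  moreover have "p \<noteq> 0" using p(2) by auto
  ultimately show ?thesis using mem_algebraic_closure[OF K p(1), of x] by auto
qed

subsection \<open>Simple extensions and extension of homomorphisms\<close>

lemma poly_mem_adjoin:
  "p \<in> polys_over K \<Longrightarrow> poly p v \<in> adjoin K {v}"
  using polys_over_mono[OF adjoin_base[of K "{v}"]] adjoin_gens[of "{v}" K]
  by (auto intro!: poly_mem_subfield adjoin_is_subfield)

lemma adjoin_simple_fractions:
  assumes K: "is_subfield K"
  shows "adjoin K {v} = {poly P v / poly Q v | P Q. P \<in> polys_over K \<and> Q \<in> polys_over K \<and> poly Q v \<noteq> 0}"
    (is "_ = ?R")
proof
  note pc = polys_over_closed[OF K]
  show "?R \<subseteq> adjoin K {v}"
    by (auto intro!: is_subfield_closed[OF adjoin_is_subfield] poly_mem_adjoin)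
  have R: "poly P v / poly Q v \<in> ?R" if "P \<in> polys_over K" "Q \<in> polys_over K" "poly Q v \<noteq> 0" for P Q
    using that by blast
  have "is_subfield ?R"
  proof (rule is_subfieldI)
    show "1 \<in> ?R" using R[OF pc(2) pc(2)] by simp
  next
    fix x y assume "x \<in> ?R" "y \<in> ?R"
    then obtain P Q P' Q' where x: "x = poly P v / poly Q v" "P \<in> polys_over K" "Q \<in> polys_over K" "poly Q v \<noteq> 0"
      and y: "y = poly P' v / poly Q' v" "P' \<in> polys_over K" "Q' \<in> polys_over K" "poly Q' v \<noteq> 0"
      by blast
    have e: "x + y = poly (P * Q' + P' * Q) v / poly (Q * Q') v" "x * y = poly (P * P') v / poly (Q * Q') v"
      unfolding x(1) y(1) using x(4) y(4) by (simp_all add: add_frac_eq)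
    have mem: "P * Q' + P' * Q \<in> polys_over K" "Q * Q' \<in> polys_over K" "P * P' \<in> polys_over K"
      by (intro pc x y)+
    have "poly (Q * Q') v \<noteq> 0" using x(4) y(4) by simp
    then show "x + y \<in> ?R" "x * y \<in> ?R"
      unfolding e by (intro R mem; assumption)+
  next
    fix x assume "x \<in> ?R"
    then obtain P Q where x: "x = poly P v / poly Q v" "P \<in> polys_over K" "Q \<in> polys_over K" "poly Q v \<noteq> 0"
      by blast
    have "- x = poly (- P) v / poly Q v" using x by simp
    then show "- x \<in> ?R" using R[OF pc(5)[OF x(2)] x(3,4)] by simp
    show "inverse x \<in> ?R" if "x \<noteq> 0"
      using R[OF x(3,2)] that x by auto
  qed
  then show "adjoin K {v} \<subseteq> ?R"
  proof (rule adjoin_least)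
    show "K \<subseteq> ?R"
    proof
      fix c assume "c \<in> K"
      then show "c \<in> ?R" using R[OF pc(8)[OF _ pc(1)] pc(2), of c] by simp
    qed
    show "{v} \<subseteq> ?R"
      using R[OF pc(9)[OF is_subfield_closed(2)[OF K], of 1] pc(2)] by (simp add: poly_monom)
  qed
qed

text \<open>Euclid's algorithm: divide \<open>m\<close> by \<open>P\<close> and recurse on the
  remainder. If the remainder vanishes at \<open>v\<close>, it is 0 by its degree; the quotient then
  vanishes at \<open>v\<close>, is a multiple of \<open>m\<close>, and \<open>P\<close> is a
  constant.\<close>

lemma inverse_poly_value:
  assumes K: "is_subfield K" and m: "is_min_poly K v m" and P: "P \<in> polys_over K" "poly P v \<noteq> 0"
  shows "\<exists>Q\<in>polys_over K. poly P v * poly Q v = 1"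
proof -
  note c = is_subfield_closed[OF K] and pc = polys_over_closed[OF K]
  have mK: "m \<in> polys_over K" "m \<noteq> 0" "poly m v = 0"
    and min: "\<And>p. p \<in> polys_over K \<Longrightarrow> poly p v = 0 \<Longrightarrow> \<exists>q\<in>polys_over K. p = m * q"
    using m by (auto simp: is_min_poly_def)
  have *: "\<exists>Q\<in>polys_over K. poly P v * poly Q v = 1"
    if "P \<in> polys_over K" "poly P v \<noteq> 0" "degree P < degree m" for P
    using that
  proof (induction "degree P" arbitrary: P rule: less_induct)
    case less
    have P0: "P \<noteq> 0" using less.prems by auto
    from polys_over_div_mod[OF K mK(1) less.prems(1) P0] obtain q r where
      qr: "q \<in> polys_over K" "r \<in> polys_over K" "m = P * q + r" "r = 0 \<or> degree r < degree P" by blast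
    have rv: "poly r v = - (poly P v * poly q v)" using qr(3) mK(3) by (simp add: eq_neg_iff_add_eq_0 add.commute)
    show ?case
    proof (cases "poly r v = 0")
      case False
      then have "r \<noteq> 0" by auto
      then obtain A where A: "A \<in> polys_over K" "poly r v * poly A v = 1"
        using less.hyps[of r] qr less.prems False by auto
      then have "poly P v * poly (- (q * A)) v = 1" using rv by (simp add: algebra_simps)
      then show ?thesis using A qr pc by blast
    next
      case True
      then obtain s where s: "r = m * s" using min[OF qr(2)] by blast
      have r0: "r = 0"
      proof (rule ccontr)
        assume "r \<noteq> 0"
        then have "degree m \<le> degree r" using s mK by (auto simp: degree_mult_eq)
        then show False using qr(4) \<open>r \<noteq> 0\<close> less.prems(3) by auto
      qed
      then have "poly q v = 0" using rv less.prems(2) by simp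
      then obtain s where "q = m * s" using min[OF qr(1)] by blast
      then have "m = m * (P * s)" using qr(3) r0 by (simp add: algebra_simps)
      then have "P * s = 1" using mK(2) by (metis mult.right_neutral mult_left_cancel)
      then have "is_unit P" by (metis dvdI)
      then have "degree P = 0" using P0 is_unit_iff_degree by blast
      then obtain a where a: "P = [:a:]" by (metis degree_eq_zeroE)
      have "[:inverse a:] \<in> polys_over K"
        using less.prems(1) a pc(8)[OF c(7) pc(1)] polys_overD[of P K 0] by simp
      then show ?thesis using a P0 by (intro bexI[of _ "[:inverse a:]"]) auto
    qed
  qed
  from polys_over_div_mod[OF K P(1) mK(1,2)] obtain q r where
    qr: "q \<in> polys_over K" "r \<in> polys_over K" "P = m * q + r" "r = 0 \<or> degree r < degree m" by blast
  have "poly P v = poly r v" using qr(3) mK(3) by simp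
  then show ?thesis using *[OF qr(2)] qr(4) P(2) by auto
qed

lemma adjoin_algebraic:
  assumes K: "is_subfield K" and m: "is_min_poly K v m"
  shows "adjoin K {v} = {poly P v | P. P \<in> polys_over K \<and> (P = 0 \<or> degree P < degree m)}"
proof
  show "{poly P v | P. P \<in> polys_over K \<and> (P = 0 \<or> degree P < degree m)} \<subseteq> adjoin K {v}"
    using poly_mem_adjoin[of _ K v] by auto
  show "adjoin K {v} \<subseteq> {poly P v | P. P \<in> polys_over K \<and> (P = 0 \<or> degree P < degree m)}"
  proof
    fix x assume "x \<in> adjoin K {v}"
    then obtain P Q where x: "x = poly P v / poly Q v" "P \<in> polys_over K" "Q \<in> polys_over K" "poly Q v \<noteq> 0"
      unfolding adjoin_simple_fractions[OF K] by blast
    obtain Q' where Q': "Q' \<in> polys_over K" "poly Q v * poly Q' v = 1"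
      using inverse_poly_value[OF K m x(3,4)] by blast
    have x': "x = poly (P * Q') v" using x(1,4) Q'(2) by (simp add: inverse_unique divide_inverse)
    have PQ: "P * Q' \<in> polys_over K" using polys_over_closed(4)[OF K] x Q' by blast
    have mm: "m \<in> polys_over K" "m \<noteq> 0" "poly m v = 0" using m by (auto simp: is_min_poly_def)
    from polys_over_div_mod[OF K PQ mm(1,2)] obtain q r where
      qr: "r \<in> polys_over K" "P * Q' = m * q + r" "r = 0 \<or> degree r < degree m" by blast
    have "x = poly r v" using x' qr(2) mm(3) by simp
    then show "x \<in> {poly P v | P. P \<in> polys_over K \<and> (P = 0 \<or> degree P < degree m)}" using qr by blast
  qed
qed

text \<open>Two polynomials with the same value at \<open>v\<close> differ by a multiple of
  \<open>m\<close>, whose image kills \<open>v'\<close>; so sending \<open>poly P v\<close> to the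
  image of \<open>P\<close> at \<open>v'\<close> is well defined.\<close>

lemma hom_extend_algebraic:
  assumes K: "is_subfield K" and h: "hom_on K h" and m: "is_min_poly K v m"
    and v': "poly (map_poly h m) v' = 0"
  shows "\<exists>h'. hom_on (adjoin K {v}) h' \<and> (\<forall>P\<in>polys_over K. h' (poly P v) = poly (map_poly h P) v')"
proof -
  note pc = polys_over_closed[OF K] and mp = map_poly_hom[OF K h]
  have wd: "poly (map_poly h P) v' = poly (map_poly h Q) v'"
    if "P \<in> polys_over K" "Q \<in> polys_over K" "poly P v = poly Q v" for P Q
  proof -
    have "P - Q \<in> polys_over K" using that pc(6) by blast
    moreover have "poly (P - Q) v = 0" using that by simp
    ultimately obtain q where q: "q \<in> polys_over K" "P - Q = m * q"
      using m by (auto simp: is_min_poly_def)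
    have "map_poly h P - map_poly h Q = map_poly h m * map_poly h q"
      using mp(8)[OF that(1,2)] mp(6)[OF _ q(1), of m] m q(2) by (simp add: is_min_poly_def)
    then have "poly (map_poly h P - map_poly h Q) v' = 0" using v' by simp
    then show ?thesis by simp
  qed
  define h' where "h' x = poly (map_poly h (SOME P. P \<in> polys_over K \<and> poly P v = x)) v'" for x
  have h': "h' (poly P v) = poly (map_poly h P) v'" if "P \<in> polys_over K" for P
    unfolding h'_def by (rule wd[OF _ that]) (use that in \<open>metis (mono_tags, lifting) someI_ex\<close>)+
  have "hom_on (adjoin K {v}) h'"
    unfolding hom_on_def
  proof (intro conjI ballI)
    show "h' 1 = 1" using h'[OF pc(2)] hom_on_simps(2)[OF K h] by simp
  next
    fix x y assume "x \<in> adjoin K {v}" "y \<in> adjoin K {v}"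
    then obtain P Q where xy: "x = poly P v" "P \<in> polys_over K" "y = poly Q v" "Q \<in> polys_over K"
      unfolding adjoin_algebraic[OF K m] by blast
    show "h' (x + y) = h' x + h' y"
      using h'[OF pc(3)[OF xy(2,4)]] h'[OF xy(2)] h'[OF xy(4)] mp(7)[OF xy(2,4)] xy(1,3) by simp
    show "h' (x * y) = h' x * h' y"
      using h'[OF pc(4)[OF xy(2,4)]] h'[OF xy(2)] h'[OF xy(4)] mp(6)[OF xy(2,4)] xy(1,3) by simp
  qed
  then show ?thesis using h' by blast
qed

text \<open>Fractions have well defined images because no nonzero polynomial over \<open>K\<close>
  becomes 0 at \<open>v\<close> or, after \<open>h\<close>, at \<open>v'\<close>.\<close>

lemma hom_extend_transcendental:
  assumes K: "is_subfield K" and h: "hom_on K h"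
    and v: "(ring.transcendental ambient over K) v" and v': "(ring.transcendental ambient over (h ` K)) v'"
  shows "\<exists>h'. hom_on (adjoin K {v}) h' \<and> (\<forall>P\<in>polys_over K. h' (poly P v) = poly (map_poly h P) v')"
proof -
  note pc = polys_over_closed[OF K] and mp = map_poly_hom[OF K h]
  have v0: "\<And>p. p \<in> polys_over K \<Longrightarrow> poly p v = 0 \<longleftrightarrow> p = 0"
    using v transcendental_iff[OF K] by auto
  have v'0: "\<And>p. p \<in> polys_over K \<Longrightarrow> poly (map_poly h p) v' = 0 \<longleftrightarrow> p = 0"
    using v' transcendental_iff[OF is_subfield_image[OF K h]] mp(4,5) by auto
  define R where "R x P Q \<longleftrightarrow> P \<in> polys_over K \<and> Q \<in> polys_over K \<and> Q \<noteq> 0 \<and> x = poly P v / poly Q v" for x P Q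
  define ev where "ev P Q = poly (map_poly h P) v' / poly (map_poly h Q) v'" for P Q
  have wd: "ev P Q = ev P' Q'" if "R x P Q" "R x P' Q'" for x P Q P' Q'
  proof -
    have PQ: "P \<in> polys_over K" "Q \<in> polys_over K" "P' \<in> polys_over K" "Q' \<in> polys_over K" "Q \<noteq> 0" "Q' \<noteq> 0"
      using that by (auto simp: R_def)
    have "poly P v / poly Q v = poly P' v / poly Q' v" using that by (simp add: R_def)
    then have "poly (P * Q' - P' * Q) v = 0" using v0 PQ by (simp add: frac_eq_eq)
    moreover have "P * Q' - P' * Q \<in> polys_over K" by (intro pc PQ)
    ultimately have "P * Q' - P' * Q = 0" using v0 by blast
    then have "P * Q' = P' * Q" by simp
    then have "map_poly h P * map_poly h Q' = map_poly h P' * map_poly h Q"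
      using mp(6)[OF PQ(1,4)] mp(6)[OF PQ(3,2)] by simp
    then have "poly (map_poly h P) v' * poly (map_poly h Q') v' = poly (map_poly h P') v' * poly (map_poly h Q) v'"
      by (metis poly_mult)
    then show ?thesis unfolding ev_def using v'0 PQ by (simp add: frac_eq_eq)
  qed
  define h' where "h' x = (let (P, Q) = (SOME (P, Q). R x P Q) in ev P Q)" for x
  have h'R: "h' x = ev P Q" if "R x P Q" for x P Q
  proof -
    obtain P' Q' where *: "(SOME (P, Q). R x P Q) = (P', Q')" by (metis surj_pair)
    have "(\<lambda>(P, Q). R x P Q) (SOME (P, Q). R x P Q)" by (rule someI[of _ "(P, Q)"]) (simp add: that)
    then have "R x P' Q'" by (simp add: *)
    from wd[OF this that] show ?thesis by (simp add: h'_def *)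
  qed
  have h': "h' (poly P v) = poly (map_poly h P) v'" if "P \<in> polys_over K" for P
    using h'R[of "poly P v" P 1] that pc(2) hom_on_simps[OF K h] by (simp add: R_def ev_def)
  have "hom_on (adjoin K {v}) h'"
    unfolding hom_on_def
  proof (intro conjI ballI)
    show "h' 1 = 1" using h'[OF pc(2)] hom_on_simps(2)[OF K h] by simp
  next
    fix x y assume "x \<in> adjoin K {v}" "y \<in> adjoin K {v}"
    then obtain P Q P' Q' where xy: "R x P Q" "R y P' Q'"
      unfolding adjoin_simple_fractions[OF K] R_def using v0 by blast
    have PQ: "P \<in> polys_over K" "Q \<in> polys_over K" "P' \<in> polys_over K" "Q' \<in> polys_over K" "Q \<noteq> 0" "Q' \<noteq> 0"
      "x = poly P v / poly Q v" "y = poly P' v / poly Q' v" using xy by (auto simp: R_def)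
    have ne: "poly Q v \<noteq> 0" "poly Q' v \<noteq> 0" "poly (map_poly h Q) v' \<noteq> 0" "poly (map_poly h Q') v' \<noteq> 0"
      using v0 v'0 PQ by auto
    have mem: "P * Q' + P' * Q \<in> polys_over K" "Q * Q' \<in> polys_over K" "P * P' \<in> polys_over K"
      "P * Q' \<in> polys_over K" "P' * Q \<in> polys_over K"
      by (intro pc PQ)+
    have "R (x + y) (P * Q' + P' * Q) (Q * Q')" "R (x * y) (P * P') (Q * Q')"
      unfolding R_def PQ(7,8) using PQ(5,6) mem ne by (simp_all add: add_frac_eq)
    from this[THEN h'R]
    have 1: "h' (x + y) = ev (P * Q' + P' * Q) (Q * Q')" "h' (x * y) = ev (P * P') (Q * Q')" .
    show "h' (x + y) = h' x + h' y"
      unfolding 1 h'R[OF xy(1)] h'R[OF xy(2)] ev_def mp(7)[OF mem(4,5)] mp(6)[OF PQ(1,4)] mp(6)[OF PQ(3,2)]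
        mp(6)[OF PQ(2,4)] using ne by (simp add: add_frac_eq)
    show "h' (x * y) = h' x * h' y"
      unfolding 1 h'R[OF xy(1)] h'R[OF xy(2)] ev_def mp(6)[OF PQ(1,3)] mp(6)[OF PQ(2,4)] by simp
  qed
  then show ?thesis using h' by blast
qed

lemma hom_extend_values:
  assumes K: "is_subfield K" and h: "hom_on K h"
    and h': "\<And>P. P \<in> polys_over K \<Longrightarrow> h' (poly P v) = poly (map_poly h P) v'"
  shows "x \<in> K \<Longrightarrow> h' x = h x" "h' v = v'"
proof -
  note pc = polys_over_closed[OF K] and s = hom_on_simps[OF K h]
  show "h' x = h x" if "x \<in> K" using h'[OF pc(8)[OF that pc(1)]] s by (simp add: map_poly_pCons)
  show "h' v = v'" using h'[OF pc(9)[OF is_subfield_closed(2)[OF K], of 1]] s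
    by (simp add: poly_monom map_poly_monom)
qed

text \<open>Zorn's lemma is applied to graphs of partial homomorphisms.\<close>

lemma hom_extend:
  fixes h :: "'a::field \<Rightarrow> 'b::field"
  assumes k: "is_subfield k" and F: "is_subfield F" and kF: "k \<subseteq> F" and T: "is_subfield T"
    and h: "hom_on k h" "h ` k \<subseteq> T"
    and split: "\<And>v. v \<in> F \<Longrightarrow> \<exists>p\<in>polys_over k. p \<noteq> 0 \<and> poly p v = 0 \<and>
       (\<forall>q. q dvd map_poly h p \<longrightarrow> degree q > 0 \<longrightarrow> (\<exists>t\<in>T. poly q t = 0))"
  shows "\<exists>h'. hom_on F h' \<and> h' ` F \<subseteq> T \<and> (\<forall>x\<in>k. h' x = h x)"
proof -
  \<comment> \<open>The clause about pairs (0, y) replaces single-valuedness: in a relation closed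
    under addition and negation, two values of one argument differ by a value of 0. Such relations
    can simply be united along a chain.\<close>
  define good where "good r \<longleftrightarrow> (\<forall>x\<in>k. (x, h x) \<in> r) \<and> r \<subseteq> F \<times> T \<and>
     (\<forall>x y x' y'. (x, y) \<in> r \<longrightarrow> (x', y') \<in> r \<longrightarrow> (x + x', y + y') \<in> r \<and> (x * x', y * y') \<in> r) \<and>
     (\<forall>x y. (x, y) \<in> r \<longrightarrow> (- x, - y) \<in> r \<and> (inverse x, inverse y) \<in> r) \<and> (\<forall>y. (0, y) \<in> r \<longrightarrow> y = 0)" for r
  have graph: "good ((\<lambda>x. (x, g x)) ` E)"
    if "is_subfield E" "k \<subseteq> E" "E \<subseteq> F" "hom_on E g" "g ` E \<subseteq> T" "\<And>x. x \<in> k \<Longrightarrow> g x = h x" for E g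
  proof -
    note c = is_subfield_closed[OF that(1)] and s = hom_on_simps[OF that(1,4)]
    have iff: "(x, y) \<in> (\<lambda>x. (x, g x)) ` E \<longleftrightarrow> x \<in> E \<and> y = g x" for x y by auto
    show ?thesis
      unfolding good_def iff using that(2,3,5,6) c(3,4,5,7) by (auto simp: s(1,3,4,5,7))
  qed
  have "\<exists>M\<in>{r. good r}. \<forall>Y\<in>{r. good r}. M \<subseteq> Y \<longrightarrow> Y = M"
  proof (rule subset_Zorn_nonempty)
    show "{r. good r} \<noteq> {}" using graph[OF k order_refl kF h] by auto
    fix C assume C: "C \<noteq> {}" "subset.chain {r. good r} C"
    then have g: "\<And>r. r \<in> C \<Longrightarrow> good r" by (auto simp: subset.chain_def)
    have two: "\<exists>r\<in>C. p \<in> r \<and> q \<in> r" if pq: "p \<in> \<Union>C" "q \<in> \<Union>C" for p q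
    proof -
      obtain r1 r2 where r12: "r1 \<in> C" "p \<in> r1" "r2 \<in> C" "q \<in> r2" using pq by blast
      then have "r1 \<subseteq> r2 \<or> r2 \<subseteq> r1" using C(2) unfolding subset_chain_def by blast
      then show ?thesis using r12 by blast
    qed
    have "good (\<Union>C)"
      unfolding good_def
    proof (intro conjI allI impI ballI)
      fix x assume "x \<in> k"
      then show "(x, h x) \<in> \<Union>C" using C(1) g by (auto simp: good_def)
    next
      show "\<Union>C \<subseteq> F \<times> T" using g unfolding good_def by (intro Union_least) blast
    next
      fix x y x' y' assume "(x, y) \<in> \<Union>C" "(x', y') \<in> \<Union>C"
      from two[OF this] obtain r where r: "r \<in> C" "(x, y) \<in> r" "(x', y') \<in> r" by blast
      then have "(x + x', y + y') \<in> r" "(x * x', y * y') \<in> r" using g[OF r(1)] by (auto simp: good_def)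
      then show "(x + x', y + y') \<in> \<Union>C" "(x * x', y * y') \<in> \<Union>C" using r(1) by auto
    next
      fix x y assume "(x, y) \<in> \<Union>C"
      then obtain r where r: "r \<in> C" "(x, y) \<in> r" by blast
      then have "(- x, - y) \<in> r" "(inverse x, inverse y) \<in> r" using g[OF r(1)] by (auto simp: good_def)
      then show "(- x, - y) \<in> \<Union>C" "(inverse x, inverse y) \<in> \<Union>C" using r(1) by auto
    next
      fix y assume "(0, y) \<in> \<Union>C"
      then show "y = 0" using g by (auto simp: good_def)
    qed
    then show "\<Union>C \<in> {r. good r}" by simp
  qed
  then obtain r where r: "good r" and max: "\<And>Y. good Y \<Longrightarrow> r \<subseteq> Y \<Longrightarrow> Y = r" by blast
  have rk: "\<And>x. x \<in> k \<Longrightarrow> (x, h x) \<in> r" and rFT: "r \<subseteq> F \<times> T"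
    and radd: "\<And>x y x' y'. (x, y) \<in> r \<Longrightarrow> (x', y') \<in> r \<Longrightarrow> (x + x', y + y') \<in> r"
    and rmult: "\<And>x y x' y'. (x, y) \<in> r \<Longrightarrow> (x', y') \<in> r \<Longrightarrow> (x * x', y * y') \<in> r"
    and rneg: "\<And>x y. (x, y) \<in> r \<Longrightarrow> (- x, - y) \<in> r" and rinv: "\<And>x y. (x, y) \<in> r \<Longrightarrow> (inverse x, inverse y) \<in> r"
    and r0: "\<And>y. (0, y) \<in> r \<Longrightarrow> y = 0"
    using r unfolding good_def by blast+
  have uniq: "y = y'" if "(x, y) \<in> r" "(x, y') \<in> r" for x y y'
    using r0[of "y + - y'"] radd[OF that(1) rneg[OF that(2)]] by simp
  define E where "E = Domain r"
  define g where "g x = (THE y. (x, y) \<in> r)" for x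
  have gr: "g x = y \<longleftrightarrow> (x, y) \<in> r" if "x \<in> E" for x y
    using that uniq unfolding E_def g_def by (metis Domain.cases the_equality)
  have rg: "(x, g x) \<in> r" if "x \<in> E" for x using gr[OF that] by blast
  have kE: "k \<subseteq> E" unfolding E_def using rk by blast
  have EF: "E \<subseteq> F" "g ` E \<subseteq> T" using rFT rg by (auto simp: E_def)
  have h1: "(1, 1) \<in> r" using rk[of 1] is_subfield_closed(2)[OF k] hom_on_simps(2)[OF k h(1)] by simp
  have E: "is_subfield E"
  proof (rule is_subfieldI)
    show "1 \<in> E" unfolding E_def by (rule DomainI[OF h1])
  next
    fix x y assume "x \<in> E" "y \<in> E"
    then have "(x, g x) \<in> r" "(y, g y) \<in> r" by (auto intro: rg)
    from radd[OF this] rmult[OF this] show "x + y \<in> E" "x * y \<in> E" unfolding E_def by (auto intro: DomainI)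
  next
    fix x assume "x \<in> E"
    then have "(x, g x) \<in> r" by (rule rg)
    from rneg[OF this] rinv[OF this] show "- x \<in> E" "inverse x \<in> E" unfolding E_def by (auto intro: DomainI)
  qed
  note cE = is_subfield_closed[OF E]
  have g: "hom_on E g"
    unfolding hom_on_def
  proof (intro conjI ballI)
    show "g 1 = 1" using gr[OF cE(2)] h1 by blast
    fix x y assume xy: "x \<in> E" "y \<in> E"
    show "g (x + y) = g x + g y" using gr[OF cE(3)[OF xy]] radd[OF rg[OF xy(1)] rg[OF xy(2)]] by blast
    show "g (x * y) = g x * g y" using gr[OF cE(4)[OF xy]] rmult[OF rg[OF xy(1)] rg[OF xy(2)]] by blast
  qed
  have gk: "\<And>x. x \<in> k \<Longrightarrow> g x = h x" using gr rk kE by blast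
  have rE: "r = (\<lambda>x. (x, g x)) ` E"
  proof (rule Set.set_eqI)
    fix z :: "'a \<times> 'b"
    obtain x y where z: "z = (x, y)" by (cases z)
    show "z \<in> r \<longleftrightarrow> z \<in> (\<lambda>x. (x, g x)) ` E"
    proof (cases "x \<in> E")
      case True
      then show ?thesis using gr[OF True, of y] z by auto
    next
      case False
      then show ?thesis using z by (auto simp: E_def)
    qed
  qed
  have "F \<subseteq> E"
  proof
    fix v assume v: "v \<in> F"
    show "v \<in> E"
    proof (rule ccontr)
      assume vE: "v \<notin> E"
      from split[OF v] obtain p where p: "p \<in> polys_over k" "p \<noteq> 0" "poly p v = 0"
        and sp: "\<And>q. q dvd map_poly h p \<Longrightarrow> degree q > 0 \<Longrightarrow> \<exists>t\<in>T. poly q t = 0" by blast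
      have pE: "p \<in> polys_over E" using p(1) polys_over_mono[OF kE] by blast
      from is_min_poly_exists[OF E, of v] obtain m where m: "is_min_poly E v m" using pE p by blast
      have mE: "m \<in> polys_over E" "lead_coeff m = 1" "poly m v = 0" using m by (auto simp: is_min_poly_def)
      obtain q where q: "q \<in> polys_over E" "p = m * q" using m pE p(3) by (auto simp: is_min_poly_def)
      have "map_poly g p = map_poly h p"
        using gk p(1) is_subfield_closed(1)[OF k] by (auto simp: poly_eq_iff coeff_map_poly polys_overD
          hom_on_simps(1)[OF E g] hom_on_simps(1)[OF k h(1)])
      \<comment> \<open>The minimal polynomial of \<open>v\<close> over the larger field
        \<open>E\<close> divides \<open>p\<close>; this is why \<open>split\<close> speaks of all
        nonconstant divisors of the image of \<open>p\<close>.\<close>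
      then have "map_poly g m dvd map_poly h p"
        using map_poly_hom(6)[OF E g mE(1) q(1)] q(2) by (metis dvdI)
      moreover have "degree (map_poly g m) > 0"
        unfolding map_poly_hom(3)[OF E g mE(1)] using mE(2,3) by (cases "degree m") (auto elim: degree_eq_zeroE)
      ultimately obtain v' where v': "v' \<in> T" "poly (map_poly g m) v' = 0" using sp by blast
      from hom_extend_algebraic[OF E g m v'(2)] obtain g' where
        g': "hom_on (adjoin E {v}) g'" "\<And>P. P \<in> polys_over E \<Longrightarrow> g' (poly P v) = poly (map_poly g P) v'" by blast
      note g'v = hom_extend_values[OF E g g'(2)]
      have "good ((\<lambda>x. (x, g' x)) ` adjoin E {v})"
      proof (rule graph)
        show "is_subfield (adjoin E {v})" by (rule adjoin_is_subfield)
        show "k \<subseteq> adjoin E {v}" using kE adjoin_base by blast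
        show "adjoin E {v} \<subseteq> F" using adjoin_least[OF F EF(1)] v by simp
        show "hom_on (adjoin E {v}) g'" by fact
        show "g' ` adjoin E {v} \<subseteq> T"
        proof
          fix y assume "y \<in> g' ` adjoin E {v}"
          then obtain P where "P \<in> polys_over E" "y = g' (poly P v)"
            unfolding adjoin_algebraic[OF E m] by blast
          then have "y = poly (map_poly g P) v'" "map_poly g P \<in> polys_over T"
            using g'(2) map_poly_hom(5)[OF E g] polys_over_mono[OF EF(2)] by auto
          then show "y \<in> T" using poly_mem_subfield[OF T _ v'(1)] by blast
        qed
        show "\<And>x. x \<in> k \<Longrightarrow> g' x = h x" using g'v(1) gk kE by auto
      qed
      moreover have "r \<subseteq> (\<lambda>x. (x, g' x)) ` adjoin E {v}"
        unfolding rE using g'v(1) adjoin_base[of E "{v}"] by force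
      ultimately have "(\<lambda>x. (x, g' x)) ` adjoin E {v} = r" by (rule max)
      then have "(v, g' v) \<in> r" using adjoin_gens[of "{v}" E] by blast
      then show False using vE by (auto simp: E_def)
    qed
  qed
  then have "F = E" using EF by blast
  then show ?thesis using g EF gk by blast
qed

section \<open>Galois groups\<close>

abbreviation Gal :: "'a::field set \<Rightarrow> 'a set \<Rightarrow> ('a \<Rightarrow> 'a) set" where
  "Gal K L \<equiv> carrier (galois_group K L)"

lemma mem_Gal_iff:
  assumes L: "is_subfield L"
  shows "\<sigma> \<in> Gal K L \<longleftrightarrow> \<sigma> \<in> extensional L \<and> bij_betw \<sigma> L L \<and> hom_on L \<sigma> \<and> (\<forall>x\<in>K. \<sigma> x = x)"
  by (auto simp: galois_group_def Bij_def ring_hom_def hom_on_def bij_betw_def)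

lemma GalD:
  assumes "is_subfield L" "\<sigma> \<in> Gal K L"
  shows "\<sigma> \<in> extensional L" "bij_betw \<sigma> L L" "hom_on L \<sigma>" "x \<in> K \<Longrightarrow> \<sigma> x = x"
    "x \<in> L \<Longrightarrow> \<sigma> x \<in> L" "\<sigma> ` L = L" "\<sigma> \<in> Bij L"
  using assms(2) unfolding mem_Gal_iff[OF assms(1)] by (auto simp: bij_betw_def Bij_def)

lemma Gal_mult:
  assumes "is_subfield L" "\<sigma> \<in> Gal K L" "\<tau> \<in> Gal K L"
  shows "\<sigma> \<otimes>\<^bsub>galois_group K L\<^esub> \<tau> = compose L \<sigma> \<tau>"
  using GalD(7)[OF assms(1,2)] GalD(7)[OF assms(1,3)] by (simp add: galois_group_def BijGroup_def)

lemma Gal_one: "\<one>\<^bsub>galois_group K L\<^esub> = (\<lambda>x\<in>L. x)"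
  by (simp add: galois_group_def BijGroup_def)

lemma galois_group_group:
  assumes L: "is_subfield L" and K: "K \<subseteq> L"
  shows "group (galois_group K L)"
proof -
  interpret B: group "BijGroup L" by (rule group_BijGroup)
  have c: "carrier (BijGroup L) = Bij L" by (simp add: BijGroup_def)
  note cL = is_subfield_closed[OF L]
  have "subgroup (Gal K L) (BijGroup L)"
  proof (rule B.subgroupI)
    show "Gal K L \<subseteq> carrier (BijGroup L)" using GalD(7)[OF L] c by blast
    have "(\<lambda>x\<in>L. x) \<in> Gal K L"
      unfolding mem_Gal_iff[OF L] using K by (auto simp: hom_on_def bij_betw_def inj_on_def cL)
    then show "Gal K L \<noteq> {}" by blast
  next
    fix \<sigma> assume s: "\<sigma> \<in> Gal K L"
    have inv: "inv\<^bsub>BijGroup L\<^esub> \<sigma> = (\<lambda>x\<in>L. inv_into L \<sigma> x)" using inv_BijGroup[OF GalD(7)[OF L s]] .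
    note s' = hom_on_simps[OF L GalD(3)[OF L s]]
    have i: "inv_into L \<sigma> (\<sigma> x) = x" if "x \<in> L" for x using that s'(12) by (simp add: inv_into_f_f)
    have "(\<lambda>x\<in>L. inv_into L \<sigma> x) \<in> Gal K L"
      unfolding mem_Gal_iff[OF L]
    proof (intro conjI ballI)
      show "bij_betw (\<lambda>x\<in>L. inv_into L \<sigma> x) L L"
        using bij_betw_inv_into[OF GalD(2)[OF L s]] by (simp add: bij_betw_def inj_on_def)
      show "hom_on L (\<lambda>x\<in>L. inv_into L \<sigma> x)"
        unfolding hom_on_def
      proof (intro conjI ballI)
        show "(\<lambda>x\<in>L. inv_into L \<sigma> x) 1 = 1" using i[OF cL(2)] s'(2) cL(2) by simp
        fix x y assume "x \<in> L" "y \<in> L"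
        then obtain a b where ab: "x = \<sigma> a" "y = \<sigma> b" "a \<in> L" "b \<in> L" using GalD(6)[OF L s] by blast
        then have m: "\<sigma> a \<in> L" "\<sigma> b \<in> L" "\<sigma> a + \<sigma> b \<in> L" "\<sigma> a * \<sigma> b \<in> L" using GalD(5)[OF L s] cL(3,4) by auto
        show "(\<lambda>x\<in>L. inv_into L \<sigma> x) (x + y) = (\<lambda>x\<in>L. inv_into L \<sigma> x) x + (\<lambda>x\<in>L. inv_into L \<sigma> x) y"
          using m i[OF ab(3)] i[OF ab(4)] i[OF cL(3)[OF ab(3,4)]] s'(3)[OF ab(3,4)] by (simp add: ab)
        show "(\<lambda>x\<in>L. inv_into L \<sigma> x) (x * y) = (\<lambda>x\<in>L. inv_into L \<sigma> x) x * (\<lambda>x\<in>L. inv_into L \<sigma> x) y"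
          using m i[OF ab(3)] i[OF ab(4)] i[OF cL(4)[OF ab(3,4)]] s'(4)[OF ab(3,4)] by (simp add: ab)
      qed
      fix x assume x: "x \<in> K"
      then have "x \<in> L" "\<sigma> x = x" using K GalD(4)[OF L s] by auto
      then show "(\<lambda>x\<in>L. inv_into L \<sigma> x) x = x" using i[of x] by simp
    qed auto
    then show "inv\<^bsub>BijGroup L\<^esub> \<sigma> \<in> Gal K L" using inv by simp
  next
    fix \<sigma> \<tau> assume st: "\<sigma> \<in> Gal K L" "\<tau> \<in> Gal K L"
    have "\<sigma> \<otimes>\<^bsub>BijGroup L\<^esub> \<tau> = compose L \<sigma> \<tau>"
      using GalD(7)[OF L st(1)] GalD(7)[OF L st(2)] by (simp add: BijGroup_def)
    moreover have "compose L \<sigma> \<tau> \<in> Gal K L"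
      unfolding mem_Gal_iff[OF L]
    proof (intro conjI ballI)
      show "bij_betw (compose L \<sigma> \<tau>) L L"
        by (rule bij_betw_compose[OF GalD(2)[OF L st(2)] GalD(2)[OF L st(1)]])
      have "hom_on L (\<lambda>x. \<sigma> (\<tau> x))"
        by (rule hom_on_compose[OF GalD(3)[OF L st(2)] _ GalD(3)[OF L st(1)]]) (simp add: GalD(6)[OF L st(2)])
      then show "hom_on L (compose L \<sigma> \<tau>)"
        using hom_on_cong[OF _ L, of "compose L \<sigma> \<tau>" "\<lambda>x. \<sigma> (\<tau> x)"] by (simp add: compose_def)
      fix x assume "x \<in> K"
      then show "compose L \<sigma> \<tau> x = x"
        using GalD(4)[OF L st(1)] GalD(4)[OF L st(2)] K by (auto simp: compose_def)
    qed simp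
    ultimately show "\<sigma> \<otimes>\<^bsub>BijGroup L\<^esub> \<tau> \<in> Gal K L" by simp
  qed
  then have "group (BijGroup L\<lparr>carrier := Gal K L\<rparr>)" by (rule B.subgroup_imp_group)
  moreover have "BijGroup L\<lparr>carrier := Gal K L\<rparr> = galois_group K L" by (simp add: galois_group_def)
  ultimately show ?thesis by simp
qed

lemma Gal_compose:
  assumes L: "is_subfield L" and K: "K \<subseteq> L" and st: "\<sigma> \<in> Gal K L" "\<tau> \<in> Gal K L"
  shows "compose L \<sigma> \<tau> \<in> Gal K L"
  using group.is_monoid[OF galois_group_group[OF L K]] monoid.m_closed st Gal_mult[OF L st] by metis

lemma Gal_id:
  assumes L: "is_subfield L" and K: "K \<subseteq> L"
  shows "(\<lambda>x\<in>L. x) \<in> Gal K L"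
  using group.is_monoid[OF galois_group_group[OF L K]] monoid.one_closed Gal_one by metis

lemma Gal_eqI:
  assumes "is_subfield L" "\<sigma> \<in> Gal K L" "\<tau> \<in> Gal K L" "\<And>x. x \<in> L \<Longrightarrow> \<sigma> x = \<tau> x"
  shows "\<sigma> = \<tau>"
  using GalD(1)[OF assms(1,2)] GalD(1)[OF assms(1,3)] assms(4) by (rule extensionalityI)

text \<open>Roots go to roots, and an injective map of a finite set into itself is onto.\<close>

lemma hom_maps_roots:
  assumes L: "is_subfield L" and h: "hom_on L h" and S: "finite S" "S \<subseteq> L"
    and coeffs_fixed: "\<And>i. h (coeff (lin_prod S) i) = coeff (lin_prod S) i"
  shows "h ` S = S"
proof -
  have pL: "lin_prod S \<in> polys_over L"
    using S by (intro polys_over_closed[OF L] is_subfield_closed[OF L]) auto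
  have mp: "map_poly h (lin_prod S) = lin_prod S"
    by (rule poly_eqI) (simp only: map_poly_hom(1)[OF L h pL] coeffs_fixed)
  have "h ` S \<subseteq> S"
  proof
    fix y assume "y \<in> h ` S"
    then obtain s where s: "s \<in> S" "y = h s" by blast
    have "poly (lin_prod S) y = h (poly (lin_prod S) s)"
      using map_poly_hom(2)[OF L h pL, of s] s S(2) mp by auto
    also have "\<dots> = 0" using s S(1) poly_lin_prod[of S s] hom_on_simps(1)[OF L h] by simp
    finally show "y \<in> S" using poly_lin_prod[OF S(1)] by blast
  qed
  moreover have "inj_on h S" using hom_on_simps(12)[OF L h] S(2) inj_on_subset by blast
  ultimately show ?thesis using S(1) endo_inj_surj by blast
qed

text \<open>Surjectivity holds because \<open>L\<close> is a union of finite root sets of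
  polynomials over \<open>K\<close>, each permuted by \<open>h\<close>.\<close>

lemma normal_hom_mem_Gal:
  assumes G: "galois_extension K L" and h: "hom_on L h" "h ` L \<subseteq> L" "\<And>x. x \<in> K \<Longrightarrow> h x = x"
  shows "restrict h L \<in> Gal K L"
proof -
  have K: "is_subfield K" and L: "is_subfield L" and KL: "K \<subseteq> L"
    and ex: "\<And>x. x \<in> L \<Longrightarrow> \<exists>S. finite S \<and> S \<subseteq> L \<and> x \<in> S \<and> lin_prod S \<in> polys_over K"
    using G unfolding galois_extension_iff by auto
  have "L \<subseteq> h ` L"
  proof
    fix x assume "x \<in> L"
    then obtain S where S: "finite S" "S \<subseteq> L" "x \<in> S" "lin_prod S \<in> polys_over K" using ex by blast
    have "h ` S = S" by (rule hom_maps_roots[OF L h(1) S(1,2)]) (simp add: h(3) polys_overD[OF S(4)])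
    then show "x \<in> h ` L" using S(2,3) by blast
  qed
  then have "bij_betw h L L" using h(2) hom_on_simps(12)[OF L h(1)] by (auto simp: bij_betw_def)
  then have "bij_betw (restrict h L) L L" by (simp add: bij_betw_restrict_eq)
  moreover have "hom_on L (restrict h L)"
    using h(1) hom_on_cong[OF _ L, of "restrict h L" h] by simp
  ultimately show ?thesis unfolding mem_Gal_iff[OF L] using h(3) KL by auto
qed

lemma dvd_lin_prod_root:
  assumes "finite S" "q dvd lin_prod (S :: 'a::field set)" "degree q > 0"
  shows "\<exists>s\<in>S. poly q s = 0"
proof -
  have q0: "q \<noteq> 0" using assms(3) by auto
  define q' where "q' = smult (inverse (lead_coeff q)) q"
  have "q' dvd lin_prod S" "lead_coeff q' = 1" using assms(2) q0 by (auto simp: q'_def smult_dvd_iff)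
  then obtain S' where S': "S' \<subseteq> S" "q' = lin_prod S'" using dvd_lin_prod[OF assms(1)] by blast
  have "degree q' = degree q" using q0 by (simp add: q'_def)
  then have "S' \<noteq> {}" using S'(2) assms(3) by auto
  then obtain s where s: "s \<in> S'" by blast
  then have "poly q' s = 0" using S' poly_lin_prod[of S' s] finite_subset[OF S'(1) assms(1)] by auto
  then show ?thesis using s S'(1) q0 by (auto simp: q'_def)
qed

text \<open>An element outside \<open>K\<close> has a further conjugate u' in \<open>L\<close>. The
  map over \<open>K\<close> that sends u to u' extends to \<open>L\<close>, with values in
  \<open>L\<close> because all polynomials involved split there.\<close>

lemma galois_fixed_field:
  assumes G: "galois_extension K L" and u: "u \<in> L" "\<And>\<sigma>. \<sigma> \<in> Gal K L \<Longrightarrow> \<sigma> u = u"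
  shows "u \<in> K"
proof (rule ccontr)
  assume uK: "u \<notin> K"
  have K: "is_subfield K" and L: "is_subfield L" and KL: "K \<subseteq> L"
    and ex: "\<And>x. x \<in> L \<Longrightarrow> \<exists>S. finite S \<and> S \<subseteq> L \<and> x \<in> S \<and> lin_prod S \<in> polys_over K"
    using G unfolding galois_extension_iff by auto
  obtain S where S: "finite S" "S \<subseteq> L" "u \<in> S" "lin_prod S \<in> polys_over K" using ex[OF u(1)] by blast
  note se = separable_elementI[OF K S(1,3,4)]
  note m = min_poly_is_min_poly[OF K se(1)]
  obtain S' where S': "S' \<subseteq> S" "min_poly K u = lin_prod S'" using se(3) by blast
  have fin: "finite S'" using S'(1) S(1) finite_subset by blast
  have uS': "u \<in> S'" using m S'(2) poly_lin_prod[OF fin] by (auto simp: is_min_poly_def)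
  have "S' \<noteq> {u}"
  proof
    assume "S' = {u}"
    then have "[:- u, 1:] \<in> polys_over K" using m S'(2) by (simp add: is_min_poly_def)
    then have "- u \<in> K" using polys_overD[of "[:- u, 1:]" K 0] by simp
    then show False using uK is_subfield_closed(5)[OF K] by fastforce
  qed
  then obtain u' where u': "u' \<in> S'" "u' \<noteq> u" using uS' by blast
  have u'L: "u' \<in> L" using u' S' S by blast
  have idK: "hom_on K (\<lambda>x. x)" by (simp add: hom_on_def)
  have "poly (map_poly (\<lambda>x. x) (min_poly K u)) u' = 0"
    using S'(2) poly_lin_prod[OF fin] u' by simp
  from hom_extend_algebraic[OF K idK m this] obtain h0 where
    h0: "hom_on (adjoin K {u}) h0" "\<And>P. P \<in> polys_over K \<Longrightarrow> h0 (poly P u) = poly (map_poly (\<lambda>x. x) P) u'" by blast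
  note v0 = hom_extend_values[OF K idK h0(2)]
  let ?k = "adjoin K {u}"
  have k: "is_subfield ?k" "K \<subseteq> ?k" "?k \<subseteq> L"
    using adjoin_least[OF L KL, of "{u}"] u(1) by (simp_all add: adjoin_is_subfield adjoin_base)
  have "\<exists>h'. hom_on L h' \<and> h' ` L \<subseteq> L \<and> (\<forall>x\<in>?k. h' x = h0 x)"
  proof (rule hom_extend[OF k(1) L k(3) L h0(1)])
    show "h0 ` ?k \<subseteq> L"
    proof
      fix y assume "y \<in> h0 ` ?k"
      then obtain P where P: "P \<in> polys_over K" "y = h0 (poly P u)" unfolding adjoin_algebraic[OF K m] by blast
      then have "y = poly P u'" using h0(2)[OF P(1)] by simp
      then show "y \<in> L" using poly_mem_subfield[OF L _ u'L] P(1) polys_over_mono[OF KL] by blast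
    qed
    fix v assume v: "v \<in> L"
    obtain S where S: "finite S" "S \<subseteq> L" "v \<in> S" "lin_prod S \<in> polys_over K" using ex[OF v] by blast
    have mp: "map_poly h0 (lin_prod S) = lin_prod S"
      by (rule map_poly_id_on[OF _ S(4) is_subfield_closed(1)[OF K]]) (rule v0(1))
    show "\<exists>p\<in>polys_over ?k. p \<noteq> 0 \<and> poly p v = 0 \<and>
        (\<forall>q. q dvd map_poly h0 p \<longrightarrow> 0 < degree q \<longrightarrow> (\<exists>t\<in>L. poly q t = 0))"
    proof (intro bexI[of _ "lin_prod S"] conjI allI impI)
      show "lin_prod S \<in> polys_over ?k" using S(4) polys_over_mono[OF k(2)] by blast
      show "lin_prod S \<noteq> 0" by (rule lin_prod_nz)
      show "poly (lin_prod S) v = 0" using S(1,3) poly_lin_prod by blast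
      fix q assume q: "q dvd map_poly h0 (lin_prod S)" "0 < degree q"
      from dvd_lin_prod_root[OF S(1) q(1)[unfolded mp] q(2)] show "\<exists>t\<in>L. poly q t = 0" using S(2) by blast
    qed
  qed
  then obtain h where h: "hom_on L h" "h ` L \<subseteq> L" "\<And>x. x \<in> ?k \<Longrightarrow> h x = h0 x" by blast
  have hK: "\<And>x. x \<in> K \<Longrightarrow> h x = x" using h(3) v0(1) k(2) by auto
  have "restrict h L \<in> Gal K L" by (rule normal_hom_mem_Gal[OF G h(1,2) hK])
  then have "restrict h L u = u" by (rule u(2))
  moreover have "h u = u'" using h(3)[of u] v0(2) adjoin_gens[of "{u}" K] by auto
  ultimately show False using u(1) u'(2) by simp
qed

text \<open>The fixed field theorem for \<open>L\<close> over K(z), whose automorphisms are trivial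
  by \<open>distinct\<close>.\<close>

lemma galois_primitive_element:
  assumes G: "galois_extension K L" and z: "z \<in> L"
    and distinct: "\<And>\<sigma> x. \<sigma> \<in> Gal K L \<Longrightarrow> \<sigma> z = z \<Longrightarrow> x \<in> L \<Longrightarrow> \<sigma> x = x"
  shows "L = adjoin K {z}"
proof -
  have K: "is_subfield K" and L: "is_subfield L" and KL: "K \<subseteq> L"
    and ex: "\<And>x. x \<in> L \<Longrightarrow> \<exists>S. finite S \<and> S \<subseteq> L \<and> x \<in> S \<and> lin_prod S \<in> polys_over K"
    using G unfolding galois_extension_iff by auto
  let ?k = "adjoin K {z}"
  have k: "is_subfield ?k" "K \<subseteq> ?k" "?k \<subseteq> L" "z \<in> ?k"
    using adjoin_least[OF L KL, of "{z}"] z adjoin_gens[of "{z}" K]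
    by (simp_all add: adjoin_is_subfield adjoin_base)
  have "galois_extension ?k L"
    unfolding galois_extension_iff
  proof (intro conjI ballI)
    fix x assume "x \<in> L"
    from ex[OF this] obtain S where "finite S" "S \<subseteq> L" "x \<in> S" "lin_prod S \<in> polys_over K" by blast
    then show "\<exists>S. finite S \<and> S \<subseteq> L \<and> x \<in> S \<and> lin_prod S \<in> polys_over ?k"
      using subsetD[OF polys_over_mono[OF k(2)]] by (intro exI[of _ S]) simp
  qed (use k(1,3) L in auto)
  moreover have "\<sigma> x = x" if "\<sigma> \<in> Gal ?k L" "x \<in> L" for \<sigma> x
  proof -
    have "\<sigma> \<in> Gal K L" "\<sigma> z = z" using that(1) k(2,4) unfolding mem_Gal_iff[OF L] by auto
    then show ?thesis using distinct that(2) by blast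
  qed
  ultimately have "L \<subseteq> ?k" using galois_fixed_field[of ?k L] by (intro subsetI) simp
  then show ?thesis using k(3) by (rule equalityI)
qed

text \<open>Every map in \<open>G\<close> permutes \<open>U\<close> and so fixes the coefficients of
  the product. \<open>G\<close> is any set of homomorphisms, which covers Galois groups, the
  endomorphisms of a simple extension and the group \<open>\<Gamma>\<close> of the
  compositum.\<close>

lemma invariant_lin_prod:
  assumes M: "is_subfield M" and hom: "\<And>\<tau>. \<tau> \<in> G \<Longrightarrow> hom_on M \<tau>"
    and U: "finite U" "U \<subseteq> M" "\<And>\<tau>. \<tau> \<in> G \<Longrightarrow> \<tau> ` U \<subseteq> U"
    and fixed: "\<And>u. u \<in> M \<Longrightarrow> (\<And>\<tau>. \<tau> \<in> G \<Longrightarrow> \<tau> u = u) \<Longrightarrow> u \<in> k"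
  shows "lin_prod U \<in> polys_over k"
proof (rule polys_overI, rule fixed)
  fix i
  have UM: "lin_prod U \<in> polys_over M"
    using U(2) by (intro polys_over_closed[OF M] is_subfield_closed[OF M]) auto
  then show "coeff (lin_prod U) i \<in> M" by (rule polys_overD)
  fix \<tau> assume t: "\<tau> \<in> G"
  have inj: "inj_on \<tau> U" using hom_on_simps(12)[OF M hom[OF t]] U(2) inj_on_subset by blast
  then have "\<tau> ` U = U" using U(1) U(3)[OF t] endo_inj_surj by blast
  then have "(\<Prod>s\<in>U. [:- \<tau> s, 1:]) = lin_prod U"
    using prod.reindex[OF inj, of "\<lambda>s. [:- s, 1:]"] by simp
  then have "map_poly \<tau> (lin_prod U) = lin_prod U"
    using map_poly_linear_factors[OF M hom[OF t] U(1,2)] by simp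
  then show "\<tau> (coeff (lin_prod U) i) = coeff (lin_prod U) i"
    using map_poly_hom(1)[OF M hom[OF t] UM, of i] by simp
qed

lemma finite_if_all_eq: "(\<And>x y. x \<in> A \<Longrightarrow> y \<in> A \<Longrightarrow> x = y) \<Longrightarrow> finite A"
  by (metis finite.emptyI finite_insert insertI1 subsetI finite_subset ex_in_conv)

text \<open>Induction on the set of pairs: if \<open>v\<close> separates the new pair and
  \<open>z\<close> the old ones, then z + c v separates all of them except for finitely many
  c.\<close>

lemma exists_separating_element:
  assumes M: "is_subfield M" and k: "k \<subseteq> M" "infinite k" and P: "finite P"
    and hom: "\<And>\<sigma> \<tau>. (\<sigma>, \<tau>) \<in> P \<Longrightarrow> hom_on M \<sigma> \<and> hom_on M \<tau> \<and> (\<forall>x\<in>k. \<sigma> x = \<tau> x) \<and> (\<exists>v\<in>M. \<sigma> v \<noteq> \<tau> v)"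
  shows "\<exists>z\<in>M. \<forall>(\<sigma>, \<tau>)\<in>P. \<sigma> z \<noteq> \<tau> z"
  using P hom
proof (induction P rule: finite_induct)
  case empty
  then show ?case using is_subfield_closed(1)[OF M] by auto
next
  case (insert st P)
  obtain \<sigma>0 \<tau>0 where st: "st = (\<sigma>0, \<tau>0)" by (cases st)
  have "\<exists>z\<in>M. \<forall>(\<sigma>, \<tau>)\<in>P. \<sigma> z \<noteq> \<tau> z"
    by (rule insert.IH, rule insert.prems) simp
  then obtain z where z: "z \<in> M" "\<And>\<sigma> \<tau>. (\<sigma>, \<tau>) \<in> P \<Longrightarrow> \<sigma> z \<noteq> \<tau> z" by blast
  have "\<exists>v\<in>M. \<sigma>0 v \<noteq> \<tau>0 v" using insert.prems[of \<sigma>0 \<tau>0] st by simp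
  then obtain v where v: "v \<in> M" "\<sigma>0 v \<noteq> \<tau>0 v" by blast
  define B where "B st = {c \<in> k. fst st (z + c * v) = snd st (z + c * v)}" for st :: "('a \<Rightarrow> 'b) \<times> ('a \<Rightarrow> 'b)"
  \<comment> \<open>Each pair excludes at most one \<open>c\<close>: two exceptions would make the
    pair agree at \<open>v\<close> and then at \<open>z\<close>, which \<open>z\<close> forbids for
    old pairs and \<open>v\<close> for the new one.\<close>
  have "finite (B (\<sigma>, \<tau>))" if mem: "(\<sigma>, \<tau>) \<in> insert st P" for \<sigma> \<tau>
  proof -
    have h: "hom_on M \<sigma>" "hom_on M \<tau>" "\<And>x. x \<in> k \<Longrightarrow> \<sigma> x = \<tau> x" using insert.prems[OF mem] by auto
    have e: "\<sigma> (z + c * v) = \<sigma> z + \<sigma> c * \<sigma> v" "\<tau> (z + c * v) = \<tau> z + \<sigma> c * \<tau> v" if "c \<in> k" for c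
      using that k(1) z(1) v(1) h(3)[OF that] is_subfield_closed(4)[OF M] hom_on_simps(3,4)[OF M h(1)]
        hom_on_simps(3,4)[OF M h(2)] by (auto simp: subset_iff)
    have "c = c'" if "c \<in> B (\<sigma>, \<tau>)" "c' \<in> B (\<sigma>, \<tau>)" for c c'
    proof -
      have cc: "c \<in> k" "c' \<in> k" and 1: "\<sigma> z + \<sigma> c * \<sigma> v = \<tau> z + \<sigma> c * \<tau> v" 
        "\<sigma> z + \<sigma> c' * \<sigma> v = \<tau> z + \<sigma> c' * \<tau> v"
        using that e by (auto simp: B_def)
      have "\<sigma> c * (\<sigma> v - \<tau> v) = \<tau> z - \<sigma> z" "\<sigma> c' * (\<sigma> v - \<tau> v) = \<tau> z - \<sigma> z"
        using 1 by (simp_all add: algebra_simps)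
      then have "(\<sigma> c - \<sigma> c') * (\<sigma> v - \<tau> v) = 0" by (simp add: left_diff_distrib)
      moreover have "\<sigma> v \<noteq> \<tau> v"
      proof
        assume eq: "\<sigma> v = \<tau> v"
        then have "\<sigma> z = \<tau> z" using 1 by simp
        then have "(\<sigma>, \<tau>) = st" using z(2) mem by blast
        then show False using v(2) st eq by simp
      qed
      ultimately have "\<sigma> c = \<sigma> c'" by simp
      then show "c = c'" using hom_on_simps(12)[OF M h(1)] cc k(1) by (auto dest: inj_onD)
    qed
    then show ?thesis by (intro finite_if_all_eq) blast
  qed
  then have "finite (B p)" if "p \<in> insert st P" for p using that by (cases p) blast
  then have "finite (\<Union>p\<in>insert st P. B p)" using insert.hyps(1) by (intro finite_UN_I) auto
  then obtain c where c: "c \<in> k" "c \<notin> (\<Union>p\<in>insert st P. B p)"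
    using k(2) by (meson finite_subset subsetI)
  have "z + c * v \<in> M" using z(1) v(1) c(1) k(1) is_subfield_closed(3,4)[OF M] by blast
  moreover have "\<sigma> (z + c * v) \<noteq> \<tau> (z + c * v)" if "(\<sigma>, \<tau>) \<in> insert st P" for \<sigma> \<tau>
  proof
    assume "\<sigma> (z + c * v) = \<tau> (z + c * v)"
    then have "c \<in> B (\<sigma>, \<tau>)" using c(1) by (simp add: B_def)
    then show False using c(2) that by blast
  qed
  ultimately show ?case by blast
qed

lemma galois_separating_element:
  assumes G: "galois_extension K L" and fin: "finite (Gal K L)" and inf: "infinite K"
  shows "\<exists>z\<in>L. inj_on (\<lambda>\<sigma>. \<sigma> z) (Gal K L)"
proof -
  have L: "is_subfield L" and KL: "K \<subseteq> L" using G unfolding galois_extension_iff by auto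
  define P where "P = {(\<sigma>, \<tau>). \<sigma> \<in> Gal K L \<and> \<tau> \<in> Gal K L \<and> \<sigma> \<noteq> \<tau>}"
  have "P \<subseteq> Gal K L \<times> Gal K L" by (auto simp: P_def)
  then have "finite P" using fin finite_subset by blast
  then have "\<exists>z\<in>L. \<forall>(\<sigma>, \<tau>)\<in>P. \<sigma> z \<noteq> \<tau> z"
  proof (rule exists_separating_element[OF L KL inf])
    fix \<sigma> \<tau> assume "(\<sigma>, \<tau>) \<in> P"
    then have st: "\<sigma> \<in> Gal K L" "\<tau> \<in> Gal K L" "\<sigma> \<noteq> \<tau>" by (auto simp: P_def)
    then have "\<exists>v\<in>L. \<sigma> v \<noteq> \<tau> v" using Gal_eqI[OF L] by blast
    then show "hom_on L \<sigma> \<and> hom_on L \<tau> \<and> (\<forall>x\<in>K. \<sigma> x = \<tau> x) \<and> (\<exists>v\<in>L. \<sigma> v \<noteq> \<tau> v)"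
      using GalD(3)[OF L st(1)] GalD(3)[OF L st(2)] GalD(4)[OF L st(1)] GalD(4)[OF L st(2)] by simp
  qed
  then obtain z where z: "z \<in> L" "\<And>\<sigma> \<tau>. (\<sigma>, \<tau>) \<in> P \<Longrightarrow> \<sigma> z \<noteq> \<tau> z" by blast
  have "inj_on (\<lambda>\<sigma>. \<sigma> z) (Gal K L)"
    by (rule inj_onI) (use z(2) in \<open>auto simp: P_def\<close>)
  then show ?thesis using z(1) by blast
qed

lemma galois_separating_primitive:
  assumes G: "galois_extension K L" and z: "z \<in> L" "inj_on (\<lambda>\<sigma>. \<sigma> z) (Gal K L)"
  shows "L = adjoin K {z}"
proof (rule galois_primitive_element[OF G z(1)])
  have L: "is_subfield L" and KL: "K \<subseteq> L" using G unfolding galois_extension_iff by auto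
  fix \<sigma> x assume s: "\<sigma> \<in> Gal K L" "\<sigma> z = z" "x \<in> L"
  have "\<sigma> = (\<lambda>x\<in>L. x)"
    using inj_onD[OF z(2), of \<sigma> "\<lambda>x\<in>L. x"] s Gal_id[OF L KL] z(1) by simp
  then show "\<sigma> x = x" using s(3) by simp
qed

text \<open>The orbit is taken as a set, so that a nontrivial stabiliser of \<open>z\<close> does
  not produce multiple roots. A polynomial over \<open>K\<close> vanishing at \<open>z\<close>
  vanishes on the orbit, which bounds its degree from below.\<close>

lemma galois_orbit_poly:
  assumes G: "galois_extension K L" and fin: "finite (Gal K L)" and z: "z \<in> L"
  shows "lin_prod ((\<lambda>\<sigma>. \<sigma> z) ` Gal K L) \<in> polys_over K"
    "is_min_poly K z (lin_prod ((\<lambda>\<sigma>. \<sigma> z) ` Gal K L))"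
proof -
  have K: "is_subfield K" and L: "is_subfield L" and KL: "K \<subseteq> L" using G unfolding galois_extension_iff by auto
  let ?U = "(\<lambda>\<sigma>. \<sigma> z) ` Gal K L"
  have U: "finite ?U" "?U \<subseteq> L" using fin z GalD(5)[OF L] by auto
  show mem: "lin_prod ?U \<in> polys_over K"
  proof (rule invariant_lin_prod[OF L _ U])
    show "\<And>\<tau>. \<tau> \<in> Gal K L \<Longrightarrow> hom_on L \<tau>" by (rule GalD(3)[OF L])
    fix \<tau> assume t: "\<tau> \<in> Gal K L"
    show "\<tau> ` ?U \<subseteq> ?U"
    proof
      fix y assume "y \<in> \<tau> ` ?U"
      then obtain \<sigma> where s: "\<sigma> \<in> Gal K L" "y = \<tau> (\<sigma> z)" by blast
      then have "y = compose L \<tau> \<sigma> z" using z by (simp add: compose_def)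
      then show "y \<in> ?U" using Gal_compose[OF L KL t s(1)] by blast
    qed
  next
    show "\<And>u. u \<in> L \<Longrightarrow> (\<And>\<tau>. \<tau> \<in> Gal K L \<Longrightarrow> \<tau> u = u) \<Longrightarrow> u \<in> K" by (rule galois_fixed_field[OF G])
  qed
  show "is_min_poly K z (lin_prod ?U)"
  proof (rule is_min_polyI[OF K mem])
    show "lead_coeff (lin_prod ?U) = 1" by (rule lead_coeff_lin_prod)
    have "z \<in> ?U" using Gal_id[OF L KL] z by (auto simp: image_iff intro!: bexI[of _ "\<lambda>x\<in>L. x"])
    then show "poly (lin_prod ?U) z = 0" using poly_lin_prod[OF U(1)] by blast
    fix p assume p: "p \<in> polys_over K" "p \<noteq> 0" "poly p z = 0"
    have "?U \<subseteq> {x. poly p x = 0}"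
    proof
      fix y assume "y \<in> ?U"
      then obtain \<sigma> where s: "\<sigma> \<in> Gal K L" "y = \<sigma> z" by blast
      have pL: "p \<in> polys_over L" using p(1) polys_over_mono[OF KL] by blast
      have "map_poly \<sigma> p = p"
        by (rule map_poly_id_on[OF _ p(1) is_subfield_closed(1)[OF K]]) (rule GalD(4)[OF L s(1)])
      then have "poly p y = \<sigma> (poly p z)" using map_poly_hom(2)[OF L GalD(3)[OF L s(1)] pL z] s(2) by simp
      also have "\<dots> = 0" using p(3) hom_on_simps(1)[OF L GalD(3)[OF L s(1)]] by simp
      finally show "y \<in> {x. poly p x = 0}" by simp
    qed
    then have "card ?U \<le> card {x. poly p x = 0}" using poly_roots_finite[OF p(2)] by (intro card_mono) auto
    also have "\<dots> \<le> degree p" by (rule card_poly_roots_bound[OF p(2)])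
    finally show "degree (lin_prod ?U) \<le> degree p" by (simp only: degree_lin_prod)
  qed
qed

text \<open>This is the source of the Galois property of the residue field. An element fixed by all
  endomorphisms is P(s0) with \<open>P\<close> of degree below the number of conjugates;
  \<open>P\<close> has the same value at all of them and is constant. So orbit products have
  coefficients in \<open>K\<close>.\<close>

lemma galois_simple_extension:
  assumes K: "is_subfield K" and S: "finite S" "s0 \<in> S" "lin_prod S \<in> polys_over K"
    and SF: "S \<subseteq> adjoin K {s0}"
  shows "galois_extension K (adjoin K {s0})"
proof -
  let ?F = "adjoin K {s0}"
  have F: "is_subfield ?F" "K \<subseteq> ?F" "s0 \<in> ?F" using adjoin_gens[of "{s0}" K] by (simp_all add: adjoin_is_subfield adjoin_base)
  note se = separable_elementI[OF K S(1,2,3)]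
  note m = min_poly_is_min_poly[OF K se(1)]
  obtain S' where S': "S' \<subseteq> S" "min_poly K s0 = lin_prod S'" using se(3) by blast
  have fin: "finite S'" using S'(1) S(1) finite_subset by blast
  have idK: "hom_on K (\<lambda>x. x)" by (simp add: hom_on_def)
  have mp: "map_poly (\<lambda>x. x) p = p" for p :: "'a poly" by simp
  \<comment> \<open>These are total functions, free outside K(s0), so \<open>G\<close> may be
    infinite. Its orbits are finite: the images of P(s0) are among the values of \<open>P\<close> on
    \<open>S'\<close>.\<close>
  define G where "G = {\<tau>. hom_on ?F \<tau> \<and> \<tau> ` ?F \<subseteq> ?F \<and> (\<forall>x\<in>K. \<tau> x = x)}"
  have val: "\<tau> (poly P s0) = poly P (\<tau> s0)" if t: "\<tau> \<in> G" "P \<in> polys_over K" for \<tau> P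
  proof -
    have h: "hom_on ?F \<tau>" using t by (simp add: G_def)
    have "map_poly \<tau> P = P"
      by (rule map_poly_id_on[OF _ t(2) is_subfield_closed(1)[OF K]]) (use t(1) in \<open>simp add: G_def\<close>)
    moreover have "P \<in> polys_over ?F" using t(2) polys_over_mono[OF F(2)] by blast
    ultimately show ?thesis using map_poly_hom(2)[OF F(1) h _ F(3), of P] by simp
  qed
  have mK: "min_poly K s0 \<in> polys_over K" "poly (min_poly K s0) s0 = 0" using m by (auto simp: is_min_poly_def)
  have root: "\<tau> s0 \<in> S'" if t: "\<tau> \<in> G" for \<tau>
  proof -
    have "poly (min_poly K s0) (\<tau> s0) = \<tau> 0" using val[OF t mK(1)] mK(2) by simp
    also have "\<dots> = 0" using t hom_on_simps(1)[OF F(1), of \<tau>] by (simp add: G_def)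
    finally show ?thesis using S'(2) poly_lin_prod[OF fin] by simp
  qed
  have ex: "\<exists>\<tau>\<in>G. \<tau> s0 = s" if s: "s \<in> S'" for s
  proof -
    have "poly (map_poly (\<lambda>x. x) (min_poly K s0)) s = 0" unfolding mp S'(2) using s poly_lin_prod[OF fin] by blast
    from hom_extend_algebraic[OF K idK m this] obtain h where
      h: "hom_on ?F h" "\<And>P. P \<in> polys_over K \<Longrightarrow> h (poly P s0) = poly (map_poly (\<lambda>x. x) P) s" by blast
    note v = hom_extend_values[OF K idK h(2)]
    have sF: "s \<in> ?F" using s S'(1) SF by blast
    have "h ` ?F \<subseteq> ?F"
    proof
      fix y assume "y \<in> h ` ?F"
      then obtain P where P: "P \<in> polys_over K" "y = h (poly P s0)" unfolding adjoin_algebraic[OF K m] by blast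
      then have "y = poly P s" using h(2)[OF P(1)] by (simp only: mp)
      then show "y \<in> ?F" using poly_mem_subfield[OF F(1) _ sF] P(1) polys_over_mono[OF F(2)] by blast
    qed
    then have "h \<in> G" using h(1) v(1) by (simp add: G_def)
    then show ?thesis using v(2) by blast
  qed
  have comp: "(\<lambda>x. \<tau> (\<sigma> x)) \<in> G" if "\<tau> \<in> G" "\<sigma> \<in> G" for \<tau> \<sigma>
    using that hom_on_compose[of ?F \<sigma> ?F \<tau>] F(2) unfolding G_def by (auto simp: image_subset_iff)
  have fixed: "u \<in> K" if u: "u \<in> ?F" "\<And>\<tau>. \<tau> \<in> G \<Longrightarrow> \<tau> u = u" for u
  proof -
    obtain P where P: "P \<in> polys_over K" "u = poly P s0" "P = 0 \<or> degree P < degree (min_poly K s0)"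
      using u(1) unfolding adjoin_algebraic[OF K m] by blast
    have "poly (P - [:u:]) s = 0" if s: "s \<in> S'" for s
    proof -
      obtain \<tau> where t: "\<tau> \<in> G" "\<tau> s0 = s" using ex[OF s] by blast
      show ?thesis using val[OF t(1) P(1)] u(2)[OF t(1)] t(2) P(2) by simp
    qed
    then have sub: "S' \<subseteq> {s. poly (P - [:u:]) s = 0}" by blast
    have "P - [:u:] = 0"
    proof (rule ccontr)
      assume nz: "P - [:u:] \<noteq> 0"
      have "card S' \<le> card {s. poly (P - [:u:]) s = 0}" by (rule card_mono[OF poly_roots_finite[OF nz] sub])
      also have "\<dots> \<le> degree (P - [:u:])" by (rule card_poly_roots_bound[OF nz])
      also have "\<dots> \<le> degree P" using degree_diff_le[of P "degree P" "[:u:]"] by simp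
      finally have *: "card S' \<le> degree P" .
      have "S' \<noteq> {}" using root[of "\<lambda>x. x"] F(2) by (auto simp: G_def hom_on_def)
      then have "card S' > 0" using fin by auto
      then show False using * P(3) S'(2) degree_lin_prod[of S'] by auto
    qed
    then have "P = [:u:]" by simp
    then show "u \<in> K" using P(1) polys_overD[of P K 0] by simp
  qed
  have "\<exists>U. finite U \<and> U \<subseteq> ?F \<and> u \<in> U \<and> lin_prod U \<in> polys_over K" if u: "u \<in> ?F" for u
  proof (intro exI conjI)
    let ?U = "(\<lambda>\<tau>. \<tau> u) ` G"
    obtain P where P: "P \<in> polys_over K" "u = poly P s0" using u unfolding adjoin_algebraic[OF K m] by blast
    have "?U \<subseteq> poly P ` S'" using val[OF _ P(1)] P(2) root by auto
    then show Ufin: "finite ?U" using fin finite_subset by blast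
    show UF: "?U \<subseteq> ?F" using u by (auto simp: G_def)
    have "(\<lambda>x. x) \<in> G" by (simp add: G_def hom_on_def)
    then show "u \<in> ?U" by (rule rev_image_eqI) simp
    show "lin_prod ?U \<in> polys_over K"
    proof (rule invariant_lin_prod[OF F(1) _ Ufin UF _ fixed])
      show "\<And>\<tau>. \<tau> \<in> G \<Longrightarrow> hom_on ?F \<tau>" by (simp add: G_def)
      show "\<tau> ` ?U \<subseteq> ?U" if "\<tau> \<in> G" for \<tau> using comp[OF that] by auto
    qed
  qed
  then show ?thesis unfolding galois_extension_iff using K F(1,2) by simp
qed

subsection \<open>Transport along embeddings\<close>

lemma hom_on_inv_into:
  assumes L: "is_subfield L" and h: "hom_on L h"
  shows "hom_on (h ` L) (inv_into L h)"
proof -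
  note s = hom_on_simps[OF L h] and c = is_subfield_closed[OF L]
  have i: "inv_into L h (h x) = x" if "x \<in> L" for x using that s(12) by (simp add: inv_into_f_f)
  show ?thesis
    unfolding hom_on_def
  proof (intro conjI ballI)
    show "inv_into L h 1 = 1" using i[OF c(2)] s(2) by simp
    fix x y assume "x \<in> h ` L" "y \<in> h ` L"
    then obtain a b where ab: "x = h a" "y = h b" "a \<in> L" "b \<in> L" by blast
    show "inv_into L h (x + y) = inv_into L h x + inv_into L h y"
      unfolding ab(1,2) s(3)[OF ab(3,4), symmetric] using i[OF ab(3)] i[OF ab(4)] i[OF c(3)[OF ab(3,4)]] by simp
    show "inv_into L h (x * y) = inv_into L h x * inv_into L h y"
      unfolding ab(1,2) s(4)[OF ab(3,4), symmetric] using i[OF ab(3)] i[OF ab(4)] i[OF c(4)[OF ab(3,4)]] by simp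
  qed
qed

lemma galois_extension_image:
  assumes G: "galois_extension K L" and h: "hom_on L h"
  shows "galois_extension (h ` K) (h ` L)"
proof -
  have K: "is_subfield K" and L: "is_subfield L" and KL: "K \<subseteq> L"
    and ex: "\<And>x. x \<in> L \<Longrightarrow> \<exists>S. finite S \<and> S \<subseteq> L \<and> x \<in> S \<and> lin_prod S \<in> polys_over K"
    using G unfolding galois_extension_iff by auto
  have hK: "hom_on K h" by (rule hom_on_mono[OF h KL])
  show ?thesis
    unfolding galois_extension_iff
  proof (intro conjI ballI)
    fix y assume "y \<in> h ` L"
    then obtain x where x: "x \<in> L" "y = h x" by blast
    from ex[OF x(1)] obtain S where S: "finite S" "S \<subseteq> L" "x \<in> S" "lin_prod S \<in> polys_over K" by blast
    have inj: "inj_on h S" using hom_on_simps(12)[OF L h] S(2) inj_on_subset by blast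
    have "lin_prod (h ` S) = map_poly h (lin_prod S)"
      using map_poly_linear_factors[OF L h S(1,2)] prod.reindex[OF inj, of "\<lambda>s. [:- s, 1:]"] by simp
    then have "lin_prod (h ` S) \<in> polys_over (h ` K)" using map_poly_hom(5)[OF K hK S(4)] by simp
    then show "\<exists>S. finite S \<and> S \<subseteq> h ` L \<and> y \<in> S \<and> lin_prod S \<in> polys_over (h ` K)"
      using S(1-3) x(2) by (intro exI[of _ "h ` S"]) auto
  qed (use is_subfield_image[OF K hK] is_subfield_image[OF L h] KL in auto)
qed

text \<open>Conjugation by \<open>h\<close>. It carries the given extension into the universal
  domain, moves the regular realisation, and brings the result back.\<close>

lemma galois_group_image:
  assumes L: "is_subfield L" and KL: "K \<subseteq> L" and h: "hom_on L h"
  shows "galois_group K L \<cong> galois_group (h ` K) (h ` L)"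
proof -
  note s = hom_on_simps[OF L h]
  let ?g = "inv_into L h"
  have L': "is_subfield (h ` L)" by (rule is_subfield_image[OF L h])
  have g: "hom_on (h ` L) ?g" by (rule hom_on_inv_into[OF L h])
  have i: "?g (h x) = x" if "x \<in> L" for x using that s(12) by (simp add: inv_into_f_f)
  define \<phi> where "\<phi> \<sigma> = (\<lambda>y\<in>h ` L. h (\<sigma> (?g y)))" for \<sigma>
  define \<psi> where "\<psi> \<tau> = (\<lambda>x\<in>L. ?g (\<tau> (h x)))" for \<tau>
  have \<phi>h: "\<phi> \<sigma> (h x) = h (\<sigma> x)" if "x \<in> L" for \<sigma> x using that i by (simp add: \<phi>_def)
  have \<phi>: "\<phi> \<sigma> \<in> Gal (h ` K) (h ` L)" if st: "\<sigma> \<in> Gal K L" for \<sigma>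
    unfolding mem_Gal_iff[OF L']
  proof (intro conjI ballI)
    show "\<phi> \<sigma> \<in> extensional (h ` L)" by (simp add: \<phi>_def)
    note t = hom_on_simps[OF L GalD(3)[OF L st]]
    show "hom_on (h ` L) (\<phi> \<sigma>)"
      unfolding hom_on_def
    proof (intro conjI ballI)
      show "\<phi> \<sigma> 1 = 1" using \<phi>h[OF is_subfield_closed(2)[OF L], of \<sigma>] s(2) t(2) by simp
      fix x y assume "x \<in> h ` L" "y \<in> h ` L"
      then obtain a b where ab: "x = h a" "y = h b" "a \<in> L" "b \<in> L" by blast
      have m: "\<sigma> a \<in> L" "\<sigma> b \<in> L" using GalD(5)[OF L st] ab by auto
      show "\<phi> \<sigma> (x + y) = \<phi> \<sigma> x + \<phi> \<sigma> y"
        unfolding ab(1,2) s(3)[OF ab(3,4), symmetric] \<phi>h[OF ab(3)] \<phi>h[OF ab(4)]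
          \<phi>h[OF is_subfield_closed(3)[OF L ab(3,4)]] t(3)[OF ab(3,4)] by (rule s(3)[OF m])
      show "\<phi> \<sigma> (x * y) = \<phi> \<sigma> x * \<phi> \<sigma> y"
        unfolding ab(1,2) s(4)[OF ab(3,4), symmetric] \<phi>h[OF ab(3)] \<phi>h[OF ab(4)]
          \<phi>h[OF is_subfield_closed(4)[OF L ab(3,4)]] t(4)[OF ab(3,4)] by (rule s(4)[OF m])
    qed
    then have "inj_on (\<phi> \<sigma>) (h ` L)" by (rule hom_on_simps(12)[OF L'])
    moreover have "\<phi> \<sigma> ` h ` L = h ` L"
    proof -
      have "\<phi> \<sigma> ` h ` L = h ` \<sigma> ` L" using \<phi>h by (auto simp: image_iff)
      then show ?thesis using GalD(6)[OF L st] by simp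
    qed
    ultimately show "bij_betw (\<phi> \<sigma>) (h ` L) (h ` L)" by (simp add: bij_betw_def)
    fix y assume "y \<in> h ` K"
    then obtain x where x: "x \<in> K" "y = h x" by blast
    then show "\<phi> \<sigma> y = y" using \<phi>h[of x \<sigma>] KL GalD(4)[OF L st x(1)] by auto
  qed
  have "\<phi> \<in> iso (galois_group K L) (galois_group (h ` K) (h ` L))"
    unfolding iso_def mem_Collect_eq
  proof
    show "\<phi> \<in> hom (galois_group K L) (galois_group (h ` K) (h ` L))"
    proof (rule homI)
      fix \<sigma> \<tau> assume st: "\<sigma> \<in> Gal K L" "\<tau> \<in> Gal K L"
      have "\<phi> (compose L \<sigma> \<tau>) = compose (h ` L) (\<phi> \<sigma>) (\<phi> \<tau>)"
      proof
        fix y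
        show "\<phi> (compose L \<sigma> \<tau>) y = compose (h ` L) (\<phi> \<sigma>) (\<phi> \<tau>) y"
        proof (cases "y \<in> h ` L")
          case True
          then obtain x where x: "x \<in> L" "y = h x" by blast
          then show ?thesis using \<phi>h[of x] \<phi>h[of "\<tau> x" \<sigma>] GalD(5)[OF L st(2), of x] by (simp add: compose_def)
        qed (simp add: \<phi>_def compose_def)
      qed
      then show "\<phi> (\<sigma> \<otimes>\<^bsub>galois_group K L\<^esub> \<tau>) = \<phi> \<sigma> \<otimes>\<^bsub>galois_group (h ` K) (h ` L)\<^esub> \<phi> \<tau>"
        by (simp add: Gal_mult[OF L st] Gal_mult[OF L' \<phi>[OF st(1)] \<phi>[OF st(2)]])
    qed (rule \<phi>)
    show "bij_betw \<phi> (Gal K L) (Gal (h ` K) (h ` L))"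
      unfolding bij_betw_def
    proof
      show "inj_on \<phi> (Gal K L)"
      proof (rule inj_onI)
        fix \<sigma> \<tau> assume st: "\<sigma> \<in> Gal K L" "\<tau> \<in> Gal K L" "\<phi> \<sigma> = \<phi> \<tau>"
        have "\<sigma> x = \<tau> x" if x: "x \<in> L" for x
        proof -
          have "h (\<sigma> x) = h (\<tau> x)" using \<phi>h[OF x] st(3) by metis
          then show ?thesis using s(12) GalD(5)[OF L st(1) x] GalD(5)[OF L st(2) x] by (meson inj_onD)
        qed
        then show "\<sigma> = \<tau>" using Gal_eqI[OF L st(1,2)] by blast
      qed
      show "\<phi> ` Gal K L = Gal (h ` K) (h ` L)"
      proof
        show "\<phi> ` Gal K L \<subseteq> Gal (h ` K) (h ` L)" using \<phi> by blast
        show "Gal (h ` K) (h ` L) \<subseteq> \<phi> ` Gal K L"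
        proof
          fix \<tau> assume t: "\<tau> \<in> Gal (h ` K) (h ` L)"
          have tm: "\<tau> (h x) \<in> h ` L" if "x \<in> L" for x using GalD(5)[OF L' t] that by blast
          have hg: "h (?g y) = y" if "y \<in> h ` L" for y using that by (rule f_inv_into_f)
          have gm: "?g (\<tau> (h x)) \<in> L" if "x \<in> L" for x using tm[OF that] by (rule inv_into_into)
          have "hom_on L (\<lambda>x. \<tau> (h x))" by (rule hom_on_compose[OF h _ GalD(3)[OF L' t]]) simp
          then have "hom_on L (\<lambda>x. ?g (\<tau> (h x)))" by (rule hom_on_compose[OF _ _ g]) (use tm in blast)
          then have hom: "hom_on L (\<psi> \<tau>)" using hom_on_cong[OF _ L, of "\<psi> \<tau>" "\<lambda>x. ?g (\<tau> (h x))"] by (simp add: \<psi>_def)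
          have "L \<subseteq> \<psi> \<tau> ` L"
          proof
            fix x assume x: "x \<in> L"
            then obtain y where y: "y \<in> L" "h x = \<tau> (h y)" using GalD(6)[OF L' t] by blast
            then have "x = \<psi> \<tau> y" using i[OF x] by (simp add: \<psi>_def)
            then show "x \<in> \<psi> \<tau> ` L" using y(1) by blast
          qed
          then have "\<psi> \<tau> ` L = L" using gm by (auto simp: \<psi>_def)
          then have "bij_betw (\<psi> \<tau>) L L" using hom_on_simps(12)[OF L hom] by (simp add: bij_betw_def)
          moreover have "\<psi> \<tau> x = x" if x: "x \<in> K" for x
            using x KL GalD(4)[OF L' t, of "h x"] i[of x] by (auto simp: \<psi>_def)
          ultimately have G: "\<psi> \<tau> \<in> Gal K L" unfolding mem_Gal_iff[OF L] using hom by (simp add: \<psi>_def)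
          have "\<phi> (\<psi> \<tau>) = \<tau>"
          proof (rule Gal_eqI[OF L' \<phi>[OF G] t])
            fix y assume "y \<in> h ` L"
            then obtain x where x: "x \<in> L" "y = h x" by blast
            then show "\<phi> (\<psi> \<tau>) y = \<tau> y" using \<phi>h[OF x(1)] hg[OF tm[OF x(1)]] by (simp add: \<psi>_def)
          qed
          then show "\<tau> \<in> \<phi> ` Gal K L" using imageI[OF G, of \<phi>] by simp
        qed
      qed
    qed
  qed
  then show ?thesis by (auto simp: is_iso_def)
qed

lemma hom_image_adjoin:
  assumes A: "is_subfield A" and sub: "K \<subseteq> A" "S \<subseteq> A" and h: "hom_on A h"
  shows "h ` adjoin K S = adjoin (h ` K) (h ` S)"
proof
  have AS: "adjoin K S \<subseteq> A" by (rule adjoin_least[OF A sub])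
  have h': "hom_on (adjoin K S) h" by (rule hom_on_mono[OF h AS])
  note s = hom_on_simps[OF adjoin_is_subfield h']
  note c = is_subfield_closed[OF adjoin_is_subfield]
  show "adjoin (h ` K) (h ` S) \<subseteq> h ` adjoin K S"
    by (rule adjoin_least[OF is_subfield_image[OF adjoin_is_subfield h']]) (intro image_mono adjoin_base adjoin_gens)+
  have "is_subfield {x \<in> adjoin K S. h x \<in> adjoin (h ` K) (h ` S)}"
    by (rule is_subfieldI) (simp_all add: s c)
  then have "adjoin K S \<subseteq> {x \<in> adjoin K S. h x \<in> adjoin (h ` K) (h ` S)}"
  proof (rule adjoin_least)
    show "K \<subseteq> {x \<in> adjoin K S. h x \<in> adjoin (h ` K) (h ` S)}"
      using adjoin_base[of K S] adjoin_base[of "h ` K" "h ` S"] by auto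
    show "S \<subseteq> {x \<in> adjoin K S. h x \<in> adjoin (h ` K) (h ` S)}"
      using adjoin_gens[of S K] adjoin_gens[of "h ` S" "h ` K"] by auto
  qed
  then show "h ` adjoin K S \<subseteq> adjoin (h ` K) (h ` S)" by blast
qed

subsection \<open>Linear independence of families\<close>

text \<open>The index set takes the place of the list in \<open>independent\<close>; thus sums can
  run over pairs, and a family can be extended by a new index.\<close>

definition indep :: "'a::field set \<Rightarrow> 'i set \<Rightarrow> ('i \<Rightarrow> 'a) \<Rightarrow> bool" where
  "indep K I v \<longleftrightarrow> (\<forall>c. (\<forall>i\<in>I. c i \<in> K) \<longrightarrow> (\<Sum>i\<in>I. c i * v i) = 0 \<longrightarrow> (\<forall>i\<in>I. c i = 0))"

lemma indepD:
  "indep K I v \<Longrightarrow> (\<And>i. i \<in> I \<Longrightarrow> c i \<in> K) \<Longrightarrow> (\<Sum>i\<in>I. c i * v i) = 0 \<Longrightarrow> i \<in> I \<Longrightarrow> c i = 0"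
  by (auto simp: indep_def)

lemma combine_eq_sum:
  "length Ks = length us \<Longrightarrow>
   ring.combine (ambient :: 'a::field ring) Ks us = (\<Sum>i<length us. Ks ! i * us ! i)"
proof -
  interpret field "ambient :: 'a ring" by (rule ambient_field)
  show "length Ks = length us \<Longrightarrow> combine Ks us = (\<Sum>i<length us. Ks ! i * us ! i)"
    by (induction Ks us rule: list_induct2) (simp_all add: sum.lessThan_Suc_shift del: sum.lessThan_Suc)
qed

lemma independent_iff_indep:
  assumes K: "is_subfield K"
  shows "ring.independent ambient K us \<longleftrightarrow> indep K {..<length us} (\<lambda>i. us ! i)"
proof -
  interpret field "ambient :: 'a ring" by (rule ambient_field)
  show ?thesis
  proof
    assume ind: "independent K us"
    show "indep K {..<length us} (\<lambda>i. us ! i)"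
      unfolding indep_def
    proof (intro allI impI ballI)
      fix c i assume c: "\<forall>i\<in>{..<length us}. c i \<in> K" "(\<Sum>i<length us. c i * us ! i) = 0" and i: "i \<in> {..<length us}"
      let ?Ks = "map c [0..<length us]"
      have "combine ?Ks us = 0" using combine_eq_sum[of ?Ks us] c(2) by simp
      moreover have "set ?Ks \<subseteq> K" using c(1) by auto
      ultimately have "set (take (length us) ?Ks) \<subseteq> {0}"
        using independent_imp_trivial_combine[OF K ind, of ?Ks] by simp
      moreover have "c i \<in> set ?Ks" using i by auto
      ultimately show "c i = 0" by auto
    qed
  next
    assume ind: "indep K {..<length us} (\<lambda>i. us ! i)"
    show "independent K us"
    proof (rule trivial_combine_imp_independent[OF K])
      fix Ks assume Ks: "set Ks \<subseteq> K" "combine Ks us = \<zero>\<^bsub>ambient\<^esub>"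
      \<comment> \<open>\<open>combine\<close> stops at the shorter of the two lists; surplus
        scalars are cut off and missing ones padded with 0.\<close>
      define c where "c i = (if i < length Ks then Ks ! i else 0)" for i
      let ?Ks = "map c [0..<length us]"
      have "combine ?Ks us = combine Ks us"
      proof (cases "length us \<le> length Ks")
        case True
        then have "?Ks = take (length us) Ks" by (intro nth_equalityI) (auto simp: c_def)
        then show ?thesis using combine_take by simp
      next
        case False
        then have "?Ks = Ks @ replicate (length us - length Ks) 0"
          by (intro nth_equalityI) (auto simp: c_def nth_append)
        then show ?thesis using combine_append_replicate[of us Ks] by simp
      qed
      then have sum0: "(\<Sum>i<length us. c i * us ! i) = 0" using combine_eq_sum[of ?Ks us] Ks(2) by simp
      have cK: "c i \<in> K" for i using Ks(1) is_subfield_closed(1)[OF K] by (auto simp: c_def)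
      have 0: "c i = 0" if "i < length us" for i
        by (rule indepD[OF ind cK sum0]) (simp add: that)
      show "set (take (length us) Ks) \<subseteq> {\<zero>\<^bsub>ambient\<^esub>}"
      proof
        fix y assume "y \<in> set (take (length us) Ks)"
        then obtain i where "i < length us" "i < length Ks" "y = Ks ! i" by (auto simp: in_set_conv_nth)
        then show "y \<in> {\<zero>\<^bsub>ambient\<^esub>}" using 0[of i] by (simp add: c_def)
      qed
    qed simp
  qed
qed

lemma linearly_disjoint_indep:
  assumes K: "is_subfield K" and C: "is_subfield C" and ld: "linearly_disjoint K E C"
    and I: "finite I" "v ` I \<subseteq> E" "indep K I v"
  shows "indep C I v"
proof -
  obtain f where f: "bij_betw f {..<card I} I"
    using ex_bij_betw_nat_finite[OF I(1)] by (metis atLeast0LessThan)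
  have inj: "inj_on f {..<card I}" and im: "f ` {..<card I} = I" using f by (auto simp: bij_betw_def)
  let ?g = "inv_into {..<card I} f"
  have tr: "indep F I v \<longleftrightarrow> indep F {..<card I} (\<lambda>i. v (f i))" for F
  proof
    assume a: "indep F I v"
    show "indep F {..<card I} (\<lambda>i. v (f i))"
      unfolding indep_def
    proof (intro allI impI ballI)
      fix c i assume c: "\<forall>i\<in>{..<card I}. c i \<in> F" "(\<Sum>i<card I. c i * v (f i)) = 0" and i: "i \<in> {..<card I}"
      have gf: "?g (f j) = j" if "j \<in> {..<card I}" for j using inj that by (rule inv_into_f_f)
      have "(\<Sum>j\<in>I. c (?g j) * v j) = (\<Sum>i<card I. c (?g (f i)) * v (f i))"
        using sum.reindex_bij_betw[OF f, of "\<lambda>j. c (?g j) * v j"] by simp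
      also have "\<dots> = (\<Sum>i<card I. c i * v (f i))" using gf by (intro sum.cong) auto
      finally have "(\<Sum>j\<in>I. c (?g j) * v j) = 0" using c(2) by simp
      moreover have "c (?g j) \<in> F" if "j \<in> I" for j using that c(1) im inv_into_into by metis
      ultimately have "c (?g (f i)) = 0" using indepD[OF a, of "\<lambda>j. c (?g j)" "f i"] i im by blast
      then show "c i = 0" using gf[OF i] by simp
    qed
  next
    assume a: "indep F {..<card I} (\<lambda>i. v (f i))"
    show "indep F I v"
      unfolding indep_def
    proof (intro allI impI ballI)
      fix c j assume c: "\<forall>j\<in>I. c j \<in> F" "(\<Sum>j\<in>I. c j * v j) = 0" and j: "j \<in> I"
      have "(\<Sum>i<card I. c (f i) * v (f i)) = 0"
        using sum.reindex_bij_betw[OF f, of "\<lambda>j. c j * v j"] c(2) by simp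
      moreover have "c (f i) \<in> F" if "i \<in> {..<card I}" for i using that c(1) im by blast
      moreover obtain i where "i \<in> {..<card I}" "j = f i" using j im by blast
      ultimately show "c j = 0" using indepD[OF a, of "\<lambda>i. c (f i)" i] by simp
    qed
  qed
  let ?us = "map (\<lambda>i. v (f i)) [0..<card I]"
  have nth: "indep F {..<length ?us} (\<lambda>i. ?us ! i) \<longleftrightarrow> indep F {..<card I} (\<lambda>i. v (f i))" for F
    unfolding indep_def by simp
  have "ring.independent ambient K ?us"
    unfolding independent_iff_indep[OF K] nth using tr I(3) by blast
  moreover have "f i \<in> I" if "i < card I" for i using that im by blast
  then have "set ?us \<subseteq> E" using I(2) by auto
  ultimately have "ring.independent ambient C ?us" using ld unfolding linearly_disjoint_def by blast
  then show ?thesis unfolding independent_iff_indep[OF C] nth tr .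
qed

subsection \<open>Moving a regular realisation to a given transcendental element\<close>

text \<open>Let C0 be the algebraic closure of \<open>K0\<close>. The isomorphism from C0(t) to
  C0(x) over C0 extends to the algebraic closure of C0(t), where \<open>F0\<close> lies. Being the
  identity on C0, it preserves linear disjointness. The index type is that of the monomials x^j z^i
  to which the conclusion will be applied.\<close>

lemma regular_realisation_at:
  fixes K0 :: "'a::alg_closed_field set"
  assumes K0: "is_subfield K0" and reg: "regular_in_domain G0 K0"
    and x: "(ring.transcendental ambient over K0) x"
  shows "\<exists>F. galois_extension (adjoin K0 {x}) F \<and> galois_group (adjoin K0 {x}) F \<cong> G0 \<and>
     (\<forall>(I :: (nat \<times> nat) set) v. finite I \<longrightarrow> v ` I \<subseteq> F \<longrightarrow> indep K0 I v \<longrightarrow>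
        indep (algebraic_closure_of K0) I v)"
proof -
  from reg obtain t F0 where t: "(ring.transcendental ambient over K0) t"
    and G: "galois_extension (adjoin K0 {t}) F0" and iso: "galois_group (adjoin K0 {t}) F0 \<cong> G0"
    and ld: "linearly_disjoint K0 F0 (algebraic_closure_of K0)"
    unfolding regular_in_domain_def regular_extension_def by blast
  let ?C = "algebraic_closure_of K0" let ?k = "adjoin ?C {t}" let ?A = "algebraic_closure_of ?k"
  have C: "is_subfield ?C" and KC: "K0 \<subseteq> ?C"
    using algebraic_closure_is_subfield[OF K0] algebraic_closure_base[OF K0] by auto
  have k: "is_subfield ?k" by (rule adjoin_is_subfield)
  have A: "is_subfield ?A" "?k \<subseteq> ?A"
    using algebraic_closure_is_subfield[OF k] algebraic_closure_base[OF k] by auto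
  have Ck: "?C \<subseteq> ?k" "t \<in> ?k" using adjoin_base[of ?C "{t}"] adjoin_gens[of "{t}" ?C] by auto
  have id: "hom_on ?C (\<lambda>x. x)" by (simp add: hom_on_def)
  have "(ring.transcendental ambient over ((\<lambda>x. x) ` ?C)) x"
    using transcendental_over_closure[OF K0 x] by simp
  from hom_extend_transcendental[OF C id transcendental_over_closure[OF K0 t] this]
  obtain h0 where h0: "hom_on ?k h0" "\<And>P. P \<in> polys_over ?C \<Longrightarrow> h0 (poly P t) = poly (map_poly (\<lambda>x. x) P) x"
    by blast
  note v0 = hom_extend_values[OF C id h0(2)]
  \<comment> \<open>The target is the whole ambient field, where every nonconstant polynomial has a
    root.\<close>
  have "\<exists>h. hom_on ?A h \<and> h ` ?A \<subseteq> UNIV \<and> (\<forall>x\<in>?k. h x = h0 x)"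
  proof (rule hom_extend[OF k A is_subfield_UNIV h0(1)])
    fix v assume "v \<in> ?A"
    then obtain p where p: "p \<in> polys_over ?k" "p \<noteq> 0" "poly p v = 0"
      using algebraic_iff[OF k] by (auto simp: algebraic_closure_of_def)
    then show "\<exists>p\<in>polys_over ?k. p \<noteq> 0 \<and> poly p v = 0 \<and>
      (\<forall>q. q dvd map_poly h0 p \<longrightarrow> 0 < degree q \<longrightarrow> (\<exists>t\<in>UNIV. poly q t = 0))"
      using alg_closed_imp_poly_has_root by (intro bexI[of _ p]) auto
  qed simp
  then obtain h where h: "hom_on ?A h" "\<And>y. y \<in> ?k \<Longrightarrow> h y = h0 y" by blast
  have hC: "h y = y" if "y \<in> ?C" for y using that h(2)[of y] v0(1)[of y] Ck by auto
  have ht: "h t = x" using h(2)[OF Ck(2)] v0(2) by simp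
  have kk: "adjoin K0 {t} \<subseteq> ?k"
    using adjoin_least[OF k, of K0 "{t}"] KC Ck by auto
  have F0: "is_subfield F0" "adjoin K0 {t} \<subseteq> F0" using G unfolding galois_extension_iff by auto
  have F0A: "F0 \<subseteq> ?A"
  proof
    fix y assume "y \<in> F0"
    then obtain S where S: "finite S" "y \<in> S" "lin_prod S \<in> polys_over (adjoin K0 {t})"
      using G unfolding galois_extension_iff by blast
    then have "lin_prod S \<in> polys_over ?k" "poly (lin_prod S) y = 0"
      using polys_over_mono[OF kk] poly_lin_prod[OF S(1)] by auto
    then show "y \<in> ?A" using algebraic_iff[OF k, of y] lin_prod_nz[of S] by (auto simp: algebraic_closure_of_def)
  qed
  have hF: "hom_on F0 h" by (rule hom_on_mono[OF h(1) F0A])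
  have K0A: "K0 \<subseteq> ?A" "{t} \<subseteq> ?A" using KC Ck A by auto
  have imK: "h ` K0 = K0" using hC KC by (force simp: image_iff)
  have im: "h ` adjoin K0 {t} = adjoin K0 {x}"
    using hom_image_adjoin[OF A(1) K0A h(1)] imK ht by simp
  have "galois_extension (adjoin K0 {x}) (h ` F0)"
    using galois_extension_image[OF G hF] im by simp
  moreover have "galois_group (adjoin K0 {x}) (h ` F0) \<cong> G0"
  proof -
    have grp: "group (galois_group (adjoin K0 {t}) F0)" by (rule galois_group_group[OF F0])
    have "galois_group (adjoin K0 {x}) (h ` F0) \<cong> galois_group (adjoin K0 {t}) F0"
      using group.iso_sym[OF grp galois_group_image[OF F0 hF]] im by simp
    then show ?thesis using iso by (rule iso_trans)
  qed
  moreover have "indep ?C I v" if I: "finite I" "v ` I \<subseteq> h ` F0" "indep K0 I v" for I :: "(nat \<times> nat) set" and v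
  proof -
    let ?v = "\<lambda>i. inv_into F0 h (v i)"
    have vm: "?v i \<in> F0" "h (?v i) = v i" if "i \<in> I" for i
      using that I(2) inv_into_into[of "v i" h F0] f_inv_into_f[of "v i" h F0] by auto
    have comb: "h (\<Sum>i\<in>I. c i * ?v i) = (\<Sum>i\<in>I. c i * v i)" "(\<Sum>i\<in>I. c i * ?v i) \<in> ?A"
      if c: "\<And>i. i \<in> I \<Longrightarrow> c i \<in> ?C" for c
    proof -
      have m: "c i \<in> ?A" "?v i \<in> ?A" if "i \<in> I" for i
        using c[OF that] vm(1)[OF that] Ck(1) A(2) F0A by auto
      then have m2: "c i * ?v i \<in> ?A" if "i \<in> I" for i using that is_subfield_closed(4)[OF A(1)] by blast
      have "h (\<Sum>i\<in>I. c i * ?v i) = (\<Sum>i\<in>I. h (c i * ?v i))" by (rule hom_on_simps(10)[OF A(1) h(1) m2])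
      also have "\<dots> = (\<Sum>i\<in>I. c i * v i)"
        by (rule sum.cong) (simp_all add: hom_on_simps(4)[OF A(1) h(1) m] hC c vm)
      finally show "h (\<Sum>i\<in>I. c i * ?v i) = (\<Sum>i\<in>I. c i * v i)" .
      show "(\<Sum>i\<in>I. c i * ?v i) \<in> ?A" by (rule is_subfield_closed(10)[OF A(1) m2])
    qed
    have "indep K0 I ?v"
      unfolding indep_def
    proof (intro allI impI ballI)
      fix c i assume c: "\<forall>i\<in>I. c i \<in> K0" "(\<Sum>i\<in>I. c i * ?v i) = 0" and i: "i \<in> I"
      have cC: "\<And>i. i \<in> I \<Longrightarrow> c i \<in> ?C" using c(1) KC by blast
      have "(\<Sum>i\<in>I. c i * v i) = 0" using comb(1)[of c, OF cC] c(2) hom_on_simps(1)[OF A(1) h(1)] by simp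
      then show "c i = 0" using indepD[OF I(3), of c i] c(1) i by blast
    qed
    then have ind: "indep ?C I ?v"
      using linearly_disjoint_indep[OF K0 C ld I(1)] vm(1) by (metis image_subset_iff)
    show ?thesis
      unfolding indep_def
    proof (intro allI impI ballI)
      fix c i assume c: "\<forall>i\<in>I. c i \<in> ?C" "(\<Sum>i\<in>I. c i * v i) = 0" and i: "i \<in> I"
      have cC: "\<And>i. i \<in> I \<Longrightarrow> c i \<in> ?C" using c(1) by blast
      have "h (\<Sum>i\<in>I. c i * ?v i) = 0" using comb(1)[of c, OF cC] c(2) by simp
      then have "(\<Sum>i\<in>I. c i * ?v i) = 0" using hom_on_simps(13)[OF A(1) h(1) comb(2)[of c, OF cC]] by blast
      then show "c i = 0" using indepD[OF ind, of c i] cC i by blast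
    qed
  qed
  ultimately show ?thesis by blast
qed

section \<open>Absolute irreducibility over larger constant fields\<close>

text \<open>An element of type \<open>poly poly\<close> is read in K[t][X], the inner variable being
  t. A transcendental \<open>x\<close> embeds K[t][X] into K(x)[X]; a constant \<open>x\<close>
  gives the reduction at a place.\<close>

definition specialise :: "'a::comm_ring_1 poly poly \<Rightarrow> 'a \<Rightarrow> 'a poly" where
  "specialise f x = map_poly (\<lambda>p. poly p x) f"

lemma coeff_specialise: "coeff (specialise f x) i = poly (coeff f i) x"
  by (simp add: specialise_def coeff_map_poly)

lemma specialise_mult: "specialise (f * g) x = specialise f x * specialise g x"
  by (rule poly_eqI) (simp add: coeff_specialise coeff_mult poly_sum)

lemma specialise_diff: "specialise (f - g) x = specialise f x - specialise g x"
  by (rule poly_eqI) (simp add: coeff_specialise)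

lemma specialise_smult: "specialise (smult q f) x = smult (poly q x) (specialise f x)"
  by (rule poly_eqI) (simp add: coeff_specialise)

lemma specialise_0: "specialise 0 x = 0"
  by (rule poly_eqI) (simp add: coeff_specialise)

lemma specialise_pCons: "specialise (pCons q f) x = pCons (poly q x) (specialise f x)"
  by (rule poly_eqI) (simp add: coeff_specialise coeff_pCons split: nat.splits)

lemma degree_specialise_le: "degree (specialise f x) \<le> degree f"
  by (rule degree_le) (simp add: coeff_specialise coeff_eq_0)

lemma monic_specialise:
  "lead_coeff f = 1 \<Longrightarrow> degree (specialise f x) = degree f \<and> lead_coeff (specialise f x) = (1 :: 'a::comm_ring_1)"
  using degree_specialise_le[of f x] le_degree[of "specialise f x" "degree f"]
  by (metis coeff_specialise le_antisym poly_1 zero_neq_one)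

abbreviation polys2_over :: "'a::zero set \<Rightarrow> 'a poly poly set" where
  "polys2_over K \<equiv> polys_over (polys_over K)"

lemma polys2_over_closed:
  assumes K: "is_subfield K"
  shows "0 \<in> polys2_over K"
    "f \<in> polys2_over K \<Longrightarrow> g \<in> polys2_over K \<Longrightarrow> f * g \<in> polys2_over K"
    "f \<in> polys2_over K \<Longrightarrow> g \<in> polys2_over K \<Longrightarrow> f - g \<in> polys2_over K"
    "q \<in> polys_over K \<Longrightarrow> f \<in> polys2_over K \<Longrightarrow> smult q f \<in> polys2_over K"
    "q \<in> polys_over K \<Longrightarrow> f \<in> polys2_over K \<Longrightarrow> pCons q f \<in> polys2_over K"
proof -
  note pc = polys_over_closed[OF K]
  show "0 \<in> polys2_over K" by (rule polys_overI) (simp add: pc(1))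
  show "f \<in> polys2_over K \<Longrightarrow> g \<in> polys2_over K \<Longrightarrow> f * g \<in> polys2_over K"
    by (intro polys_overI[of "f * g"]) (auto simp: coeff_mult dest: polys_overD intro!: pc(10,4))
  show "f \<in> polys2_over K \<Longrightarrow> g \<in> polys2_over K \<Longrightarrow> f - g \<in> polys2_over K"
    by (intro polys_overI[of "f - g"]) (auto dest: polys_overD intro!: pc(6))
  show "q \<in> polys_over K \<Longrightarrow> f \<in> polys2_over K \<Longrightarrow> smult q f \<in> polys2_over K"
    by (intro polys_overI[of "smult q f"]) (auto dest: polys_overD intro!: pc(4))
  show "q \<in> polys_over K \<Longrightarrow> f \<in> polys2_over K \<Longrightarrow> pCons q f \<in> polys2_over K"
    by (intro polys_overI[of "pCons q f"]) (auto simp: coeff_pCons dest: polys_overD split: nat.splits)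
qed

lemma specialise_mem:
  "f \<in> polys2_over K \<Longrightarrow> specialise f x \<in> polys_over (adjoin K {x})"
  by (rule polys_overI) (auto simp: coeff_specialise intro: poly_mem_adjoin dest: polys_overD)

lemma specialise_mem_base:
  "is_subfield K \<Longrightarrow> f \<in> polys2_over K \<Longrightarrow> x \<in> K \<Longrightarrow> specialise f x \<in> polys_over K"
  by (rule polys_overI) (auto simp: coeff_specialise intro!: poly_mem_subfield dest: polys_overD)

lemma specialise_transcendental:
  assumes C: "is_subfield C" and x: "(ring.transcendental ambient over C) x" and f: "f \<in> polys2_over C"
  shows "specialise f x = 0 \<longleftrightarrow> f = 0" "degree (specialise f x) = degree f"
    "g \<in> polys2_over C \<Longrightarrow> specialise f x = specialise g x \<Longrightarrow> f = g"
proof -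
  have c: "poly (coeff f i) x = 0 \<longleftrightarrow> coeff f i = 0" if "f \<in> polys2_over C" for f i
    using x polys_overD[OF that, of i] unfolding transcendental_iff[OF C] by auto
  have 0: "specialise f x = 0 \<longleftrightarrow> f = 0" if "f \<in> polys2_over C" for f
    using c[OF that] by (simp add: poly_eq_iff coeff_specialise)
  then show "specialise f x = 0 \<longleftrightarrow> f = 0" using f by blast
  show "degree (specialise f x) = degree f"
  proof (rule antisym[OF degree_specialise_le])
    show "degree f \<le> degree (specialise f x)"
      using c[OF f, of "degree f"] by (cases "f = 0") (auto intro!: le_degree simp: coeff_specialise)
  qed
  show "f = g" if "g \<in> polys2_over C" "specialise f x = specialise g x"
    using 0[OF polys2_over_closed(3)[OF C f that(1)]] that(2) by (simp add: specialise_diff)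
qed

text \<open>Induction on the coefficients; each step multiplies \<open>q\<close> by the denominator
  of one more coefficient.\<close>

lemma clear_denominators:
  assumes C: "is_subfield C" and x: "(ring.transcendental ambient over C) x"
    and p: "p \<in> polys_over (adjoin C {x})"
  shows "\<exists>q\<in>polys_over C. \<exists>P\<in>polys2_over C. q \<noteq> 0 \<and> specialise P x = smult (poly q x) p"
  using p
proof (induction p)
  case 0
  show ?case using polys_over_closed(2)[OF C] polys2_over_closed(1)[OF C]
    by (intro bexI[of _ 1] bexI[of _ 0]) (auto simp: specialise_0)
next
  case (pCons a p)
  note pc = polys_over_closed[OF C] and pc2 = polys2_over_closed[OF C]
  have a: "a \<in> adjoin C {x}" using polys_overD[OF pCons.prems, of 0] by simp
  have "p \<in> polys_over (adjoin C {x})"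
    by (rule polys_overI) (use polys_overD[OF pCons.prems, of "Suc _"] in simp)
  then obtain q P where qP: "q \<in> polys_over C" "P \<in> polys2_over C" "q \<noteq> 0" "specialise P x = smult (poly q x) p"
    using pCons.IH by blast
  obtain A B where AB: "a = poly A x / poly B x" "A \<in> polys_over C" "B \<in> polys_over C" "poly B x \<noteq> 0"
    using a unfolding adjoin_simple_fractions[OF C] by blast
  have "specialise (pCons (A * q) (smult B P)) x = smult (poly (B * q) x) (pCons a p)"
    using AB(1,4) qP(4) by (simp add: specialise_pCons specialise_smult)
  moreover have "B * q \<noteq> 0" using AB(4) qP(3) by auto
  moreover have "B * q \<in> polys_over C" "pCons (A * q) (smult B P) \<in> polys2_over C"
    by (intro pc pc2 AB qP)+
  ultimately show ?case by blast
qed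

text \<open>Gauss's lemma over an algebraically closed field of constants: a root of one of the two denominators
  makes one of the two numerators vanish identically, so it can be cancelled.\<close>

lemma monic_factors_polynomial:
  fixes C :: "'a::field set"
  assumes C: "is_subfield C" and x: "(ring.transcendental ambient over C) x"
    and roots: "\<And>p. p \<in> polys_over C \<Longrightarrow> degree p > 0 \<Longrightarrow> \<exists>\<alpha>\<in>C. poly p \<alpha> = 0"
    and f: "f \<in> polys2_over C" and gh: "g \<in> polys_over (adjoin C {x})" "h \<in> polys_over (adjoin C {x})"
    "lead_coeff g = 1" "lead_coeff h = 1" "specialise f x = g * h"
  shows "\<exists>G\<in>polys2_over C. \<exists>H\<in>polys2_over C. specialise G x = g \<and> specialise H x = h"
proof -
  note pc = polys_over_closed[OF C] and pc2 = polys2_over_closed[OF C]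
  have x0: "\<And>p. p \<in> polys_over C \<Longrightarrow> poly p x = 0 \<longleftrightarrow> p = 0"
    using x unfolding transcendental_iff[OF C] by auto
  define num where "num g q P \<longleftrightarrow> q \<in> polys_over C \<and> P \<in> polys2_over C \<and> q \<noteq> 0 \<and>
     specialise P x = smult (poly q x) g" for g q P
  have cancel: "\<exists>q' P'. num g q' P' \<and> degree q' < degree q"
    if num: "num g q P" and lc: "lead_coeff g = 1" and \<alpha>: "\<alpha> \<in> C" "specialise P \<alpha> = 0" for g q P \<alpha>
  proof -
    have q: "q \<in> polys_over C" "P \<in> polys2_over C" "q \<noteq> 0" "specialise P x = smult (poly q x) g"
      using num by (auto simp: num_def)
    have X: "[:- \<alpha>, 1:] \<in> polys_over C" using \<alpha>(1) is_subfield_closed[OF C] by (intro pc) auto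
    have xa: "poly [:- \<alpha>, 1:] x \<noteq> 0" using x0[OF X] by simp
    have "\<exists>r\<in>polys_over C. coeff P i = [:- \<alpha>, 1:] * r" for i
    proof -
      have "poly (coeff P i) \<alpha> = 0" using arg_cong[OF \<alpha>(2), of "\<lambda>p. coeff p i"] by (simp add: coeff_specialise)
      then obtain r where r: "coeff P i = [:- \<alpha>, 1:] * r" by (metis poly_eq_0_iff_dvd dvdE)
      have "r \<in> polys_over C"
        by (rule polys_over_cancel[OF C X]) (use polys_overD[OF q(2), of i] r in auto)
      then show ?thesis using r by blast
    qed
    then obtain r where r: "\<And>i. r i \<in> polys_over C" "\<And>i. coeff P i = [:- \<alpha>, 1:] * r i" by metis
    define P' where "P' = Abs_poly r"
    have "r i = 0" if "degree P < i" for i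
    proof -
      have "[:- \<alpha>, 1:] * r i = 0" using r(2)[of i] that by (simp add: coeff_eq_0)
      then show ?thesis by (metis mult_eq_0_iff one_neq_zero pCons_eq_0_iff)
    qed
    then have cP': "coeff P' = r" unfolding P'_def by (intro coeff_Abs_poly[of "degree P"])
    have P': "P' \<in> polys2_over C" by (rule polys_overI) (simp add: cP' r(1))
    have PP': "P = smult [:- \<alpha>, 1:] P'"
      by (rule poly_eqI) (simp only: coeff_smult cP' r(2))
    \<comment> \<open>As \<open>g\<close> is monic, \<open>q\<close> is one of the coefficients of
      \<open>P\<close> and has the root \<alpha> as well, so the factor cancels on both
      sides.\<close>
    have "coeff P (degree g) = q"
    proof -
      have "poly (coeff P (degree g)) x = poly q x"
        using arg_cong[OF q(4), of "\<lambda>p. coeff p (degree g)"] lc by (simp add: coeff_specialise)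
      then have "poly (coeff P (degree g) - q) x = 0" by simp
      moreover have "coeff P (degree g) - q \<in> polys_over C" by (intro pc polys_overD[OF q(2)] q(1))
      ultimately have "coeff P (degree g) - q = 0" using x0 by blast
      then show ?thesis by simp
    qed
    then have qr: "q = [:- \<alpha>, 1:] * r (degree g)" using r(2) by simp
    have qx: "poly q x = poly [:- \<alpha>, 1:] x * poly (r (degree g)) x"
      by (subst qr) (simp only: poly_mult)
    have "smult (poly [:- \<alpha>, 1:] x) (specialise P' x) =
        smult (poly [:- \<alpha>, 1:] x) (smult (poly (r (degree g)) x) g)"
      using q(4) unfolding PP' specialise_smult qx smult_smult .
    then have "specialise P' x = smult (poly (r (degree g)) x) g"
      using xa by (metis smult_smult left_inverse smult_1_left)
    moreover have "r (degree g) \<noteq> 0" using qr q(3) by auto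
    ultimately have "num g (r (degree g)) P'" using r(1) P' by (simp add: num_def)
    moreover have "degree (r (degree g)) < degree q"
      using \<open>r (degree g) \<noteq> 0\<close> by (subst qr) (simp add: degree_mult_eq del: mult_pCons_left)
    ultimately show ?thesis by blast
  qed
  \<comment> \<open>The two representations are minimised together, by the sum of the degrees of the
    denominators: a root of \<open>q * q'\<close> does not tell which of the two numerators
    vanishes.\<close>
  define Q where "Q = (\<lambda>(q, P, q', P'). num g q P \<and> num h q' P')"
  obtain q0 P0 q0' P0' where "Q (q0, P0, q0', P0')"
    using clear_denominators[OF C x gh(1)] clear_denominators[OF C x gh(2)] unfolding Q_def num_def by blast
  then obtain t where t: "Q t" "\<And>s. Q s \<Longrightarrow> degree (fst t) + degree (fst (snd (snd t))) \<le> degree (fst s) + degree (fst (snd (snd s)))"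
    using ex_has_least_nat[of Q _ "\<lambda>t. degree (fst t) + degree (fst (snd (snd t)))"] by blast
  obtain q P q' P' where tt: "t = (q, P, q', P')" by (cases t)
  have n: "num g q P" "num h q' P'" using t(1) by (auto simp: Q_def tt)
  have min: "degree q + degree q' \<le> degree r + degree r'" if "num g r R" "num h r' R'" for r R r' R'
    using t(2)[of "(r, R, r', R')"] that by (simp add: Q_def tt)
  have q: "q \<in> polys_over C" "P \<in> polys2_over C" "q \<noteq> 0" "specialise P x = smult (poly q x) g"
    and q': "q' \<in> polys_over C" "P' \<in> polys2_over C" "q' \<noteq> 0" "specialise P' x = smult (poly q' x) h"
    using n by (auto simp: num_def)
  have "degree (q * q') = 0"
  proof (rule ccontr)
    assume "degree (q * q') \<noteq> 0"
    then obtain \<alpha> where \<alpha>: "\<alpha> \<in> C" "poly (q * q') \<alpha> = 0" using roots[OF pc(4)[OF q(1) q'(1)]] by blast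
    have "specialise (P * P') x = specialise (smult (q * q') f) x"
      by (simp add: specialise_mult specialise_smult q(4) q'(4) gh(5) mult.commute)
    then have "P * P' = smult (q * q') f"
      by (rule specialise_transcendental(3)[OF C x, rotated 2]) (intro pc2 pc q q' f)+
    then have "specialise P \<alpha> * specialise P' \<alpha> = smult (poly (q * q') \<alpha>) (specialise f \<alpha>)"
      by (metis specialise_mult specialise_smult)
    then have "specialise P \<alpha> * specialise P' \<alpha> = 0" unfolding \<alpha>(2) by simp
    then have "specialise P \<alpha> = 0 \<or> specialise P' \<alpha> = 0" by simp
    then show False
    proof
      assume "specialise P \<alpha> = 0"
      then obtain r R where "num g r R" "degree r < degree q" using cancel[OF n(1) gh(3) \<alpha>(1)] by blast
      then show False using min[OF _ n(2)] by fastforce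
    next
      assume "specialise P' \<alpha> = 0"
      then obtain r R where "num h r R" "degree r < degree q'" using cancel[OF n(2) gh(4) \<alpha>(1)] by blast
      then show False using min[OF n(1)] by fastforce
    qed
  qed
  then have deg: "degree q = 0" "degree q' = 0" using q(3) q'(3) by (auto simp: degree_mult_eq)
  have fin: "\<exists>G\<in>polys2_over C. specialise G x = g" if num: "num g q P" and deg: "degree q = 0" for g q P
  proof -
    have q: "q \<in> polys_over C" "P \<in> polys2_over C" "q \<noteq> 0" "specialise P x = smult (poly q x) g"
      using num by (auto simp: num_def)
    obtain c where c: "q = [:c:]" using deg by (metis degree_eq_zeroE)
    have c0: "c \<noteq> 0" "c \<in> C" using c q(3) polys_overD[OF q(1), of 0] by auto
    have "specialise (smult [:inverse c:] P) x = g" using q(4) c c0 by (simp add: specialise_smult)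
    moreover have "smult [:inverse c:] P \<in> polys2_over C"
      by (intro pc2 q pc is_subfield_closed(7)[OF C] c0(2))
    ultimately show ?thesis by blast
  qed
  show ?thesis using fin[OF n(1) deg(1)] fin[OF n(2) deg(2)] by blast
qed

lemma monic_poly_over_roots:
  fixes p :: "'a::alg_closed_field poly"
  assumes C: "is_subfield C"
  shows "lead_coeff p = 1 \<Longrightarrow> (\<And>x. poly p x = 0 \<Longrightarrow> x \<in> C) \<Longrightarrow> p \<in> polys_over C"
proof (induction "degree p" arbitrary: p)
  case 0
  then have "p = 1" by (metis degree_eq_zeroE lead_coeff_pCons(2) one_pCons)
  then show ?case using polys_over_closed(2)[OF C] by simp
next
  case (Suc n)
  obtain r where r: "poly p r = 0" using alg_closed_imp_poly_has_root[of p] Suc(2) by auto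
  then obtain p' where p': "p = [:- r, 1:] * p'" by (metis poly_eq_0_iff_dvd dvdE)
  have "p' \<noteq> 0" using p' Suc(2) by auto
  then have "degree p' = n" using Suc(2) unfolding p' by (simp add: degree_mult_eq del: mult_pCons_left)
  moreover have "lead_coeff p' = 1" using Suc.prems(1) unfolding p' lead_coeff_mult by simp
  moreover have "\<And>x. poly p' x = 0 \<Longrightarrow> x \<in> C" using Suc.prems(2) p' by simp
  ultimately have "p' \<in> polys_over C" using Suc(1) by blast
  moreover have "[:- r, 1:] \<in> polys_over C"
    using Suc.prems(2)[OF r] is_subfield_closed[OF C] by (intro polys_over_closed[OF C]) auto
  ultimately show ?case unfolding p' by (intro polys_over_closed(4)[OF C])
qed

text \<open>The difference quotient (p(b) - p(a)) / (b - a) is a polynomial in b of smaller degree,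
  unless \<open>p\<close> is constant, and it takes values in \<open>C\<close> at the remaining
  infinitely many points.\<close>

lemma poly_over_values:
  assumes C: "is_subfield C"
  shows "A \<subseteq> C \<Longrightarrow> infinite A \<Longrightarrow> (\<And>a. a \<in> A \<Longrightarrow> poly p a \<in> C) \<Longrightarrow> p \<in> polys_over C"
proof (induction "degree p" arbitrary: p A rule: less_induct)
  case less
  note c = is_subfield_closed[OF C] and pc = polys_over_closed[OF C]
  obtain a where a: "a \<in> A" using less.prems(2) by fastforce
  have "[:- a, 1:] dvd p - [:poly p a:]" by (simp add: poly_eq_0_iff_dvd[symmetric])
  then obtain p' where p': "p - [:poly p a:] = [:- a, 1:] * p'" by (rule dvdE)
  then have p: "p = [:poly p a:] + [:- a, 1:] * p'" by (metis add.commute diff_add_cancel)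
  have paC: "poly p a \<in> C" using less.prems(3)[OF a] .
  have "p' \<in> polys_over C"
  proof (cases "degree p = 0")
    case True
    then have "[:- a, 1:] * p' = 0" using p' by (metis degree_eq_zeroE diff_self mult_zero_right pCons_0_0 poly_pCons add.right_neutral poly_0)
    then have "p' = 0" by (metis mult_eq_0_iff one_neq_zero pCons_eq_0_iff)
    then show ?thesis using pc(1) by simp
  next
    case False
    have "degree p' < degree p"
    proof (cases "p' = 0")
      case True
      then show ?thesis using False by simp
    next
      case nz: False
      have "Suc (degree p') = degree (p - [:poly p a:])"
        unfolding p' using nz by (simp add: degree_mult_eq del: mult_pCons_left)
      also have "\<dots> \<le> degree p" using degree_diff_le[of p "degree p" "[:poly p a:]"] by simp
      finally show ?thesis by simp
    qed
    then show ?thesis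
    proof (rule less.hyps)
      show "A - {a} \<subseteq> C" "infinite (A - {a})" using less.prems(1,2) by auto
      fix b assume b: "b \<in> A - {a}"
      have "poly p b = poly p a + (b - a) * poly p' b" by (subst p) (simp add: left_diff_distrib)
      then have "poly p' b = (poly p b - poly p a) / (b - a)" using b by simp
      moreover have "poly p b \<in> C" "b \<in> C" "a \<in> C" using less.prems(1) less.prems(3)[of b] b a by auto
      ultimately show "poly p' b \<in> C" using paC c(6,8) by simp
    qed
  qed
  moreover have "[:- a, 1:] \<in> polys_over C" "[:poly p a:] \<in> polys_over C"
    using paC a less.prems(1) c by (auto intro!: pc)
  ultimately show ?case by (subst p) (intro pc(3,4))
qed

text \<open>Were it finite, \<open>lin_prod\<close> of it plus 1 would be a nonconstant polynomial
  over it without a root in it.\<close>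

lemma algebraic_closure_infinite:
  fixes K :: "'a::alg_closed_field set"
  assumes K: "is_subfield K"
  shows "infinite (algebraic_closure_of K)"
proof
  let ?C = "algebraic_closure_of K"
  assume fin: "finite ?C"
  have C: "is_subfield ?C" by (rule algebraic_closure_is_subfield[OF K])
  have "lin_prod ?C + 1 \<in> polys_over ?C"
    by (intro polys_over_closed[OF C] is_subfield_closed[OF C])
  moreover have "degree (lin_prod ?C + 1) > 0"
  proof -
    have "card ?C > 0" using fin is_subfield_closed(1)[OF C] by (auto simp: card_gt_0_iff)
    then show ?thesis by (subst degree_add_eq_left) (auto simp: degree_lin_prod)
  qed
  ultimately obtain x where "x \<in> ?C" "poly (lin_prod ?C + 1) x = 0" using algebraic_closure_root[OF K] by blast
  then show False using poly_lin_prod[OF fin, of x] by simp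
qed

text \<open>A factor of \<open>f\<close> over \<open>C(x)\<close> has coefficients in \<open>C[x]\<close>; specialising \<open>x\<close> to constants in the smaller
  algebraically closed field \<open>C0\<close>, where \<open>f\<close> splits, shows that these coefficients lie in \<open>C0[x]\<close>.\<close>

lemma min_poly_larger_constants:
  fixes K0 K :: "'a::alg_closed_field set"
  defines "C0 \<equiv> algebraic_closure_of K0" and "C \<equiv> algebraic_closure_of K"
  assumes K0: "is_subfield K0" and K: "is_subfield K" and sub: "C0 \<subseteq> C"
    and x: "(ring.transcendental ambient over C) x"
    and f: "f \<in> polys2_over C0" "lead_coeff f = 1"
    and m: "is_min_poly (adjoin C0 {x}) z (specialise f x)"
  shows "is_min_poly (adjoin C {x}) z (specialise f x)"
proof -
  have C0: "is_subfield C0" and C: "is_subfield C"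
    unfolding C0_def C_def by (rule algebraic_closure_is_subfield[OF K0] algebraic_closure_is_subfield[OF K])+
  let ?k = "adjoin C {x}"
  have k: "is_subfield ?k" by (rule adjoin_is_subfield)
  have fC: "f \<in> polys2_over C" using f(1) polys_over_mono[OF polys_over_mono[OF sub]] by blast
  let ?f = "specialise f x"
  have fk: "?f \<in> polys_over ?k" by (rule specialise_mem[OF fC])
  have flc: "lead_coeff ?f = 1" and fz: "poly ?f z = 0" using m by (auto simp: is_min_poly_def)
  have "?f \<noteq> 0" using flc by auto
  then obtain g where g: "is_min_poly ?k z g" using is_min_poly_exists[OF k, of z] fk fz by blast
  have gk: "g \<in> polys_over ?k" "lead_coeff g = 1" "poly g z = 0" using g by (auto simp: is_min_poly_def)
  obtain h where h: "h \<in> polys_over ?k" "?f = g * h" using g fk fz by (auto simp: is_min_poly_def)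
  have hlc: "lead_coeff h = 1" using flc gk(2) unfolding h(2) lead_coeff_mult by simp
  have "\<exists>G\<in>polys2_over C. \<exists>H\<in>polys2_over C. specialise G x = g \<and> specialise H x = h"
    by (rule monic_factors_polynomial[OF C x _ fC gk(1) h(1) gk(2) hlc h(2)])
      (use algebraic_closure_root[OF K] in \<open>simp add: C_def\<close>)
  then obtain G H where G: "G \<in> polys2_over C" "specialise G x = g" and H: "H \<in> polys2_over C" "specialise H x = h" by blast
  have fGH: "f = G * H"
    by (rule specialise_transcendental(3)[OF C x fC polys2_over_closed(2)[OF C G(1) H(1)]])
       (simp add: specialise_mult G(2) H(2) h(2))
  have Glc: "lead_coeff G = 1"
  proof -
    have "degree g = degree G" using specialise_transcendental(2)[OF C x G(1)] G(2) by simp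
    then have "poly (lead_coeff G - 1) x = 0" using gk(2) coeff_specialise[of G x "degree G"] G(2) by simp
    moreover have "lead_coeff G - 1 \<in> polys_over C"
      by (intro polys_over_closed[OF C] polys_overD[OF G(1)])
    ultimately have "lead_coeff G - 1 = 0" using x unfolding transcendental_iff[OF C] by blast
    then show ?thesis by simp
  qed
  have "G \<in> polys2_over C0"
  proof (rule polys_overI)
    fix i
    show "coeff G i \<in> polys_over C0"
    proof (rule poly_over_values[OF C0 order_refl])
      show "infinite C0" unfolding C0_def by (rule algebraic_closure_infinite[OF K0])
      fix a assume a: "a \<in> C0"
      have fa: "specialise f a \<in> polys_over C0" "specialise f a \<noteq> 0"
        using specialise_mem_base[OF C0 f(1) a] monic_specialise[OF f(2), of a] by auto
      have "specialise G a \<in> polys_over C0"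
      proof (rule monic_poly_over_roots[OF C0])
        show "lead_coeff (specialise G a) = 1" using monic_specialise[OF Glc] by blast
        fix y assume "poly (specialise G a) y = 0"
        then have "poly (specialise f a) y = 0" by (simp add: fGH specialise_mult)
        then show "y \<in> C0" using mem_algebraic_closure[OF K0] fa unfolding C0_def by blast
      qed
      then show "poly (coeff G i) a \<in> C0" using polys_overD[of "specialise G a" C0 i] by (simp add: coeff_specialise)
    qed
  qed
  \<comment> \<open>Now \<open>g\<close> is defined over the field where the specialised
    \<open>f\<close> is minimal, so each divides the other and the cofactor \<open>h\<close> is
    1.\<close>
  then have "g \<in> polys_over (adjoin C0 {x})" using specialise_mem G(2) by blast
  then obtain q where q: "g = ?f * q" using m gk(3) by (auto simp: is_min_poly_def)
  have "g * 1 = g * (h * q)" using q h(2) by (metis mult.assoc mult.right_neutral)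
  moreover have "g \<noteq> 0" using gk(2) by auto
  ultimately have "h * q = 1" by (metis mult_left_cancel)
  then have "is_unit h" by (metis dvdI)
  then have "degree h = 0" by (metis is_unit_iff_degree hlc leading_coeff_0_iff zero_neq_one)
  then have "h = 1" using hlc by (metis degree_eq_zeroE lead_coeff_pCons(2) one_pCons)
  then show ?thesis using g h(2) by simp
qed

text \<open>A polynomial over C(x) that kills \<open>z\<close> becomes, after clearing denominators,
  a linear relation over \<open>C\<close> among the monomials x^j z^i. Those with i below the degree
  of \<open>f\<close> are independent over \<open>K\<close>, because \<open>x\<close> is
  transcendental and \<open>f\<close> minimal, hence over \<open>C\<close> by
  \<open>ld\<close>.\<close>

lemma min_poly_linearly_disjoint:
  fixes K C F :: "'a::field set"
  assumes K: "is_subfield K" and C: "is_subfield C" and KC: "K \<subseteq> C" and F: "is_subfield F"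
    and x: "(ring.transcendental ambient over C) x" and xz: "x \<in> F" "z \<in> F"
    and ld: "\<And>(I :: (nat \<times> nat) set) v. finite I \<Longrightarrow> v ` I \<subseteq> F \<Longrightarrow> indep K I v \<Longrightarrow> indep C I v"
    and m: "is_min_poly (adjoin K {x}) z f"
  shows "is_min_poly (adjoin C {x}) z f"
proof (rule is_min_polyI[OF adjoin_is_subfield])
  have kk: "adjoin K {x} \<subseteq> adjoin C {x}"
    using adjoin_least[OF adjoin_is_subfield, of K C "{x}" "{x}"] KC adjoin_base[of C "{x}"] adjoin_gens[of "{x}" C] by auto
  have f: "f \<in> polys_over (adjoin K {x})" "lead_coeff f = 1" "poly f z = 0" using m by (auto simp: is_min_poly_def)
  show "f \<in> polys_over (adjoin C {x})" using f(1) polys_over_mono[OF kk] by blast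
  show "lead_coeff f = 1" "poly f z = 0" by fact+
  have xK: "\<And>p. p \<in> polys_over K \<Longrightarrow> poly p x = 0 \<Longrightarrow> p = 0"
    using x polys_over_mono[OF KC] unfolding transcendental_iff[OF C] by blast
  fix p assume p: "p \<in> polys_over (adjoin C {x})" "p \<noteq> 0" "poly p z = 0"
  show "degree f \<le> degree p"
  proof (rule ccontr)
    assume "\<not> degree f \<le> degree p"
    then have deg: "degree p < degree f" by simp
    obtain q P where qP: "q \<in> polys_over C" "P \<in> polys2_over C" "q \<noteq> 0" "specialise P x = smult (poly q x) p"
      using clear_denominators[OF C x p(1)] by blast
    have qx: "poly q x \<noteq> 0" using qP(1,3) x unfolding transcendental_iff[OF C] by blast
    have degP: "degree P = degree p"
      using specialise_transcendental(2)[OF C x qP(2)] qP(4) qx by simp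
    have P0: "P \<noteq> 0" using specialise_transcendental(1)[OF C x qP(2)] qP(4) qx p(2) by auto
    define N where "N = Max (insert 0 ((\<lambda>i. degree (coeff P i)) ` {..degree p}))"
    have N: "degree (coeff P i) \<le> N" if "i \<le> degree p" for i
      unfolding N_def using that by (intro Max_ge) auto
    define I where "I = {..degree p} \<times> {..N}"
    define v where "v = (\<lambda>(i, j). x ^ j * z ^ i)"
    have comb: "(\<Sum>ij\<in>I. c ij * v ij) = (\<Sum>i\<le>degree p. (\<Sum>j\<le>N. c (i, j) * x ^ j) * z ^ i)" for c
      unfolding I_def v_def sum.cartesian_product' by (simp add: sum_distrib_right sum.Sigma mult.assoc)
    have ind: "indep K I v"
      unfolding indep_def
    proof (intro allI impI ballI)
      fix c ij assume c: "\<forall>ij\<in>I. c ij \<in> K" "(\<Sum>ij\<in>I. c ij * v ij) = 0" and ij: "ij \<in> I"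
      define r where "r i = (\<Sum>j\<le>N. monom (c (i, j)) j)" for i
      have r: "r i \<in> polys_over K" if "i \<le> degree p" for i
        unfolding r_def using that c(1) by (intro polys_over_closed(9,10)[OF K]) (auto simp: I_def)
      have rx: "poly (r i) x = (\<Sum>j\<le>N. c (i, j) * x ^ j)" for i by (simp add: r_def poly_sum poly_monom)
      define s where "s = (\<Sum>i\<le>degree p. monom (poly (r i) x) i)"
      have "s \<in> polys_over (adjoin K {x})"
        unfolding s_def by (intro polys_over_closed(9,10)[OF adjoin_is_subfield] poly_mem_adjoin r) simp
      moreover have "poly s z = 0" using c(2) unfolding comb by (simp add: s_def poly_sum poly_monom rx)
      ultimately obtain q where q: "s = f * q" using m by (auto simp: is_min_poly_def)
      have "degree s \<le> degree p" unfolding s_def by (intro degree_sum_le) (auto intro: order_trans[OF degree_monom_le])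
      moreover have "f \<noteq> 0" using f(2) by auto
      ultimately have "s = 0" using q deg by (cases "q = 0") (auto simp: degree_mult_eq)
      moreover obtain i j where i: "ij = (i, j)" "i \<le> degree p" "j \<le> N" using ij by (auto simp: I_def)
      have "coeff s i = poly (r i) x" using i(2) by (simp add: s_def coeff_sum coeff_monom if_distrib cong: if_cong)
      ultimately have "r i = 0" using xK[OF r[OF i(2)]] by simp
      moreover have "coeff (r i) j = c (i, j)" using i(3) by (simp add: r_def coeff_sum coeff_monom if_distrib cong: if_cong)
      ultimately show "c ij = 0" using i(1) by simp
    qed
    have "v ` I \<subseteq> F" using xz is_subfield_closed[OF F] by (auto simp: v_def)
    then have indC: "indep C I v" by (intro ld ind) (auto simp: I_def)
    have zero: "coeff (coeff P (fst ij)) (snd ij) = 0" if "ij \<in> I" for ij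
    proof (rule indepD[OF indC _ _ that, of "\<lambda>ij. coeff (coeff P (fst ij)) (snd ij)"])
      show "coeff (coeff P (fst i)) (snd i) \<in> C" for i using polys_overD[OF polys_overD[OF qP(2)]] .
      have "(\<Sum>j\<le>N. coeff (coeff P i) j * x ^ j) = poly (coeff P i) x" if "i \<le> degree p" for i
      proof -
        have "poly (coeff P i) x = (\<Sum>j\<le>degree (coeff P i). coeff (coeff P i) j * x ^ j)" by (rule poly_altdef)
        also have "\<dots> = (\<Sum>j\<le>N. coeff (coeff P i) j * x ^ j)"
          using N[OF that] by (intro sum.mono_neutral_left) (auto simp: coeff_eq_0)
        finally show ?thesis by simp
      qed
      then have "(\<Sum>ij\<in>I. coeff (coeff P (fst ij)) (snd ij) * v ij) = (\<Sum>i\<le>degree p. poly (coeff P i) x * z ^ i)"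
        unfolding comb by (intro sum.cong) auto
      also have "\<dots> = poly (specialise P x) z"
        using specialise_transcendental(2)[OF C x qP(2)] degP by (simp add: poly_altdef[of "specialise P x"] coeff_specialise)
      also have "\<dots> = 0" using qP(4) p(3) by simp
      finally show "(\<Sum>ij\<in>I. coeff (coeff P (fst ij)) (snd ij) * v ij) = 0" .
    qed
    have "coeff (lead_coeff P) (degree (lead_coeff P)) = 0"
      using zero[of "(degree P, degree (lead_coeff P))"] N[of "degree P"] degP by (auto simp: I_def)
    then show False using P0 by simp
  qed
qed

section \<open>Points of the variety with a given generic point\<close>

definition monomial_value :: "(nat \<Rightarrow>\<^sub>0 nat) \<Rightarrow> (nat \<Rightarrow> 'a::comm_ring_1) \<Rightarrow> 'a" where
  "monomial_value m x = (\<Prod>i\<in>Poly_Mapping.keys m. x i ^ Poly_Mapping.lookup m i)"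

lemma monomial_value_superset:
  "finite A \<Longrightarrow> Poly_Mapping.keys m \<subseteq> A \<Longrightarrow> monomial_value m x = (\<Prod>i\<in>A. x i ^ Poly_Mapping.lookup m i)"
  unfolding monomial_value_def by (rule prod.mono_neutral_left) (auto simp: in_keys_iff)

lemma monomial_value_add: "monomial_value (m + m') x = monomial_value m x * monomial_value m' x"
proof -
  let ?A = "Poly_Mapping.keys m \<union> Poly_Mapping.keys m'"
  have "finite ?A" by simp
  then show ?thesis
    using monomial_value_superset[of ?A m x] monomial_value_superset[of ?A m' x]
      monomial_value_superset[of ?A "m + m'" x] keys_add[of m m']
    by (simp add: lookup_add power_add prod.distrib)
qed

lemma mpoly_eval_superset:
  "finite A \<Longrightarrow> Poly_Mapping.keys p \<subseteq> A \<Longrightarrow>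
    mpoly_eval p x = (\<Sum>m\<in>A. Poly_Mapping.lookup p m * monomial_value m x)"
  unfolding mpoly_eval_def monomial_value_def by (rule sum.mono_neutral_left) (auto simp: in_keys_iff)

lemma mpoly_eval_add: "mpoly_eval (p + q) x = mpoly_eval p x + mpoly_eval q x"
proof -
  let ?A = "Poly_Mapping.keys p \<union> Poly_Mapping.keys q"
  have "finite ?A" by simp
  then show ?thesis
    using mpoly_eval_superset[of ?A p x] mpoly_eval_superset[of ?A q x]
      mpoly_eval_superset[of ?A "p + q" x] keys_add[of p q]
    by (simp add: lookup_add ring_distribs sum.distrib)
qed

lemma mpoly_eval_single: "mpoly_eval (Poly_Mapping.single m c) x = c * monomial_value m x"
  using mpoly_eval_superset[of "{m}" "Poly_Mapping.single m c" x] by simp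

lemma mpoly_eval_0: "mpoly_eval 0 x = 0"
  by (simp add: mpoly_eval_def)

lemma mpoly_eval_sum: "mpoly_eval (sum f A) x = (\<Sum>i\<in>A. mpoly_eval (f i) x)"
  by (induction A rule: infinite_finite_induct) (simp_all add: mpoly_eval_0 mpoly_eval_add)

lemma mpoly_sum_monomials:
  "p = (\<Sum>m\<in>Poly_Mapping.keys p. Poly_Mapping.single m (Poly_Mapping.lookup p m))"
proof (rule poly_mapping_eqI)
  fix k
  have "(\<Sum>m\<in>Poly_Mapping.keys p. Poly_Mapping.lookup (Poly_Mapping.single m (Poly_Mapping.lookup p m)) k) =
      (\<Sum>m\<in>Poly_Mapping.keys p. if m = k then Poly_Mapping.lookup p m else 0)"
    by (intro sum.cong) (auto simp: lookup_single when_def)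
  also have "\<dots> = Poly_Mapping.lookup p k" by (auto simp: in_keys_iff)
  finally show "Poly_Mapping.lookup p k =
      Poly_Mapping.lookup (\<Sum>m\<in>Poly_Mapping.keys p. Poly_Mapping.single m (Poly_Mapping.lookup p m)) k"
    by (simp add: lookup_sum)
qed

lemma mpoly_mult_monomials:
  "p * q = (\<Sum>m\<in>Poly_Mapping.keys p. \<Sum>m'\<in>Poly_Mapping.keys q.
     Poly_Mapping.single (m + m') (Poly_Mapping.lookup p m * Poly_Mapping.lookup q m'))"
proof -
  have "p * q = (\<Sum>m\<in>Poly_Mapping.keys p. Poly_Mapping.single m (Poly_Mapping.lookup p m)) *
      (\<Sum>m\<in>Poly_Mapping.keys q. Poly_Mapping.single m (Poly_Mapping.lookup q m))"
    using mpoly_sum_monomials[of p] mpoly_sum_monomials[of q] by simp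
  then show ?thesis by (simp only: sum_product mult_single)
qed

lemma mpoly_eval_mult: "mpoly_eval (p * q) x = mpoly_eval p x * mpoly_eval q x"
proof -
  have "mpoly_eval (p * q) x = (\<Sum>m\<in>Poly_Mapping.keys p. \<Sum>m'\<in>Poly_Mapping.keys q.
      (Poly_Mapping.lookup p m * monomial_value m x) * (Poly_Mapping.lookup q m' * monomial_value m' x))"
    unfolding mpoly_mult_monomials[of p q] mpoly_eval_sum mpoly_eval_single monomial_value_add
    by (simp add: algebra_simps)
  also have "\<dots> = mpoly_eval p x * mpoly_eval q x"
    unfolding sum_product[symmetric] by (simp add: mpoly_eval_def monomial_value_def)
  finally show ?thesis .
qed

lemma mpoly_eval_uminus: "mpoly_eval (- p) x = - mpoly_eval p x"
  using mpoly_eval_add[of p "- p" x] by (simp add: mpoly_eval_0 eq_neg_iff_add_eq_0 add.commute)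

lemma mpoly_eval_diff: "mpoly_eval (p - q) x = mpoly_eval p x - mpoly_eval q x"
  using mpoly_eval_add[of p "- q" x] by (simp add: mpoly_eval_uminus)

abbreviation mpoly_const :: "'a::comm_ring_1 \<Rightarrow> 'a mpoly" where
  "mpoly_const c \<equiv> Poly_Mapping.single 0 c"

abbreviation mpoly_var :: "nat \<Rightarrow> 'a::comm_ring_1 mpoly" where
  "mpoly_var i \<equiv> Poly_Mapping.single (Poly_Mapping.single i 1) 1"

lemma mpoly_eval_const: "mpoly_eval (mpoly_const c) x = c"
  by (simp add: mpoly_eval_single monomial_value_def)

lemma mpoly_eval_var: "mpoly_eval (mpoly_var i) x = x i"
  by (simp add: mpoly_eval_single monomial_value_def)

lemma mpolys_mono: "F \<subseteq> F' \<Longrightarrow> mpolys F n \<subseteq> mpolys F' n"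
  by (auto simp: mpolys_def)

lemma mpolys_closed:
  assumes F: "is_subfield F"
  shows "0 \<in> mpolys F n" "p \<in> mpolys F n \<Longrightarrow> q \<in> mpolys F n \<Longrightarrow> p + q \<in> mpolys F n"
    "p \<in> mpolys F n \<Longrightarrow> - p \<in> mpolys F n" "p \<in> mpolys F n \<Longrightarrow> q \<in> mpolys F n \<Longrightarrow> p - q \<in> mpolys F n"
    "c \<in> F \<Longrightarrow> Poly_Mapping.keys m \<subseteq> {..<n} \<Longrightarrow> Poly_Mapping.single m c \<in> mpolys F n"
    "(\<And>i. i \<in> A \<Longrightarrow> f i \<in> mpolys F n) \<Longrightarrow> sum f A \<in> mpolys F n"
    "p \<in> mpolys F n \<Longrightarrow> q \<in> mpolys F n \<Longrightarrow> p * q \<in> mpolys F n"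
    "c \<in> F \<Longrightarrow> mpoly_const c \<in> mpolys F n" "i < n \<Longrightarrow> mpoly_var i \<in> mpolys F n"
proof -
  note c = is_subfield_closed[OF F]
  show 0: "0 \<in> mpolys F n" by (simp add: mpolys_def c)
  have add: "p + q \<in> mpolys F n" if "p \<in> mpolys F n" "q \<in> mpolys F n" for p q
    unfolding mpolys_def
  proof (intro CollectI conjI allI ballI)
    fix m
    show "Poly_Mapping.lookup (p + q) m \<in> F" using that by (simp add: mpolys_def lookup_add c(3))
    assume "m \<in> Poly_Mapping.keys (p + q)"
    then have "m \<in> Poly_Mapping.keys p \<or> m \<in> Poly_Mapping.keys q" using keys_add[of p q] by blast
    then show "Poly_Mapping.keys m \<subseteq> {..<n}" using that unfolding mpolys_def by blast
  qed
  then show "p \<in> mpolys F n \<Longrightarrow> q \<in> mpolys F n \<Longrightarrow> p + q \<in> mpolys F n" by blast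
  have neg: "- p \<in> mpolys F n" if "p \<in> mpolys F n" for p using that by (simp add: mpolys_def c(5))
  then show "p \<in> mpolys F n \<Longrightarrow> - p \<in> mpolys F n" by blast
  show "p \<in> mpolys F n \<Longrightarrow> q \<in> mpolys F n \<Longrightarrow> p - q \<in> mpolys F n" using add[of p "- q"] neg[of q] by simp
  have single: "Poly_Mapping.single m c \<in> mpolys F n" if "c \<in> F" "Poly_Mapping.keys m \<subseteq> {..<n}" for m c
    using that by (auto simp: mpolys_def lookup_single when_def c(1) split: if_splits)
  then show "c \<in> F \<Longrightarrow> Poly_Mapping.keys m \<subseteq> {..<n} \<Longrightarrow> Poly_Mapping.single m c \<in> mpolys F n" by blast
  have sum: "sum f A \<in> mpolys F n" if "\<And>i. i \<in> A \<Longrightarrow> f i \<in> mpolys F n" for A :: "'x set" and f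
    using that by (induction A rule: infinite_finite_induct) (auto intro: 0 add)
  then show "(\<And>i. i \<in> A \<Longrightarrow> f i \<in> mpolys F n) \<Longrightarrow> sum f A \<in> mpolys F n" by blast
  have sum': "sum f A \<in> mpolys F n" if "\<And>i. i \<in> A \<Longrightarrow> f i \<in> mpolys F n" for A :: "(nat \<Rightarrow>\<^sub>0 nat) set" and f
    using that by (induction A rule: infinite_finite_induct) (auto intro: 0 add)
  show "p * q \<in> mpolys F n" if pq: "p \<in> mpolys F n" "q \<in> mpolys F n"
    unfolding mpoly_mult_monomials[of p q]
  proof (intro sum' single)
    fix m m' assume m: "m \<in> Poly_Mapping.keys p" "m' \<in> Poly_Mapping.keys q"
    show "Poly_Mapping.lookup p m * Poly_Mapping.lookup q m' \<in> F" using pq by (auto simp: mpolys_def intro: c(4))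
    have "Poly_Mapping.keys m \<subseteq> {..<n}" "Poly_Mapping.keys m' \<subseteq> {..<n}" using m pq by (auto simp: mpolys_def)
    then show "Poly_Mapping.keys (m + m') \<subseteq> {..<n}" using keys_add[of m m'] by blast
  qed
  show "c \<in> F \<Longrightarrow> mpoly_const c \<in> mpolys F n" by (rule single) auto
  show "i < n \<Longrightarrow> mpoly_var i \<in> mpolys F n" by (rule single) (auto simp: c(2))
qed

text \<open>With one variable a monomial is determined by its exponent at index 0, so the relation
  is a univariate polynomial equation for \<open>t\<close>.\<close>

lemma algebraically_independent_single:
  assumes C: "is_subfield C" and t: "(ring.transcendental ambient over C) t" and b: "b 0 = t"
  shows "algebraically_independent C 1 b"
  unfolding algebraically_independent_def
proof (intro ballI impI)
  fix p assume p: "p \<in> mpolys C 1" "mpoly_eval p b = 0"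
  have keys: "Poly_Mapping.keys m \<subseteq> {0}" if "m \<in> Poly_Mapping.keys p" for m using p(1) that by (auto simp: mpolys_def)
  have mono: "monomial_value m b = t ^ Poly_Mapping.lookup m 0" if "m \<in> Poly_Mapping.keys p" for m
    using monomial_value_superset[OF _ keys[OF that], of b] b by simp
  have meq: "m = m'" if "m \<in> Poly_Mapping.keys p" "m' \<in> Poly_Mapping.keys p"
    "Poly_Mapping.lookup m 0 = Poly_Mapping.lookup m' 0" for m m'
  proof (rule poly_mapping_eqI)
    fix k
    show "Poly_Mapping.lookup m k = Poly_Mapping.lookup m' k"
      using that(3) keys[OF that(1)] keys[OF that(2)] by (cases "k = 0") (simp, metis in_keys_iff singletonD subsetD)
  qed
  define q where "q = (\<Sum>m\<in>Poly_Mapping.keys p. monom (Poly_Mapping.lookup p m) (Poly_Mapping.lookup m 0))"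
  have "q \<in> polys_over C"
    unfolding q_def using p(1) by (intro polys_over_closed(9,10)[OF C]) (auto simp: mpolys_def)
  moreover have "poly q t = 0"
    using p(2) mpoly_eval_superset[of "Poly_Mapping.keys p" p b] mono by (simp add: q_def poly_sum poly_monom)
  ultimately have q0: "q = 0" using t unfolding transcendental_iff[OF C] by blast
  have "Poly_Mapping.lookup p m = 0" if m: "m \<in> Poly_Mapping.keys p" for m
  proof -
    have "coeff q (Poly_Mapping.lookup m 0) = (\<Sum>m'\<in>Poly_Mapping.keys p. if m' = m then Poly_Mapping.lookup p m' else 0)"
      unfolding q_def coeff_sum by (intro sum.cong) (auto simp: coeff_monom dest: meq[OF _ m])
    also have "\<dots> = Poly_Mapping.lookup p m" using m by simp
    finally show ?thesis using q0 by simp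
  qed
  then have "m \<notin> Poly_Mapping.keys p" for m using in_keys_iff[of m p] by blast
  then show "p = 0" by (metis equals0I keys_eq_empty)
qed

text \<open>An independent subfamily with the same span is grown one element at a time. The indices
  are natural numbers, so that a fresh one is always at hand and the result fits the form in which
  linear disjointness is stated.\<close>

lemma finite_family_basis:
  assumes K: "is_subfield K" and A: "finite A"
  shows "\<exists>(J :: nat set) e \<mu>. finite J \<and> indep K J e \<and> (\<forall>a\<in>A. \<forall>l\<in>J. \<mu> a l \<in> K) \<and>
     (\<forall>a\<in>A. c a = (\<Sum>l\<in>J. \<mu> a l * e l)) \<and> e ` J \<subseteq> c ` A"
  using A
proof (induction A rule: finite_induct)
  case empty
  show ?case by (rule exI[of _ "{}"]) (simp add: indep_def)
next
  case (insert a A)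
  note cl = is_subfield_closed[OF K]
  from insert.IH obtain J :: "nat set" and e \<mu> where J0: "finite J \<and> indep K J e \<and> (\<forall>a\<in>A. \<forall>l\<in>J. \<mu> a l \<in> K) \<and>
     (\<forall>a\<in>A. c a = (\<Sum>l\<in>J. \<mu> a l * e l)) \<and> e ` J \<subseteq> c ` A" by (elim exE)
  then have J: "finite J" "indep K J e" "\<And>a l. a \<in> A \<Longrightarrow> l \<in> J \<Longrightarrow> \<mu> a l \<in> K"
    "\<And>a. a \<in> A \<Longrightarrow> c a = (\<Sum>l\<in>J. \<mu> a l * e l)" "e ` J \<subseteq> c ` A" by blast+
  show ?case
  proof (cases "\<exists>d. (\<forall>l\<in>J. d l \<in> K) \<and> c a = (\<Sum>l\<in>J. d l * e l)")
    case True
    then obtain d where d: "\<forall>l\<in>J. d l \<in> K" "c a = (\<Sum>l\<in>J. d l * e l)" by blast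
    let ?\<mu> = "\<mu>(a := d)"
    have "\<forall>b\<in>insert a A. \<forall>l\<in>J. ?\<mu> b l \<in> K" using d(1) J(3) by auto
    moreover have "\<forall>b\<in>insert a A. c b = (\<Sum>l\<in>J. ?\<mu> b l * e l)" using d(2) J(4) insert.hyps(2) by auto
    moreover have "e ` J \<subseteq> c ` insert a A" using J(5) by blast
    ultimately show ?thesis using J(1,2) by (intro exI[of _ J] exI[of _ e] exI[of _ ?\<mu>] conjI)
  next
    case False
    obtain n where n: "n \<notin> J" using J(1) ex_new_if_finite infinite_UNIV_nat by blast
    let ?e = "e(n := c a)" and ?J = "insert n J"
    let ?\<mu> = "\<lambda>b l. if b = a then (if l = n then 1 else 0) else if l = n then 0 else \<mu> b l"
    have sumJ: "(\<Sum>l\<in>?J. d l * ?e l) = d n * c a + (\<Sum>l\<in>J. d l * e l)" for d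
    proof -
      have "(\<Sum>l\<in>J. d l * ?e l) = (\<Sum>l\<in>J. d l * e l)" using n by (intro sum.cong) auto
      then show ?thesis using J(1) n by simp
    qed
    have ind: "indep K ?J ?e"
      unfolding indep_def
    proof (intro allI impI)
      fix d assume d: "\<forall>l\<in>?J. d l \<in> K" "(\<Sum>l\<in>?J. d l * ?e l) = 0"
      have e0: "d n * c a + (\<Sum>l\<in>J. d l * e l) = 0" using d(2) sumJ by simp
      have dn: "d n = 0"
      proof (rule ccontr)
        assume dn: "d n \<noteq> 0"
        have "d n * c a = - (\<Sum>l\<in>J. d l * e l)" using e0 by (simp add: eq_neg_iff_add_eq_0)
        then have "c a = inverse (d n) * - (\<Sum>l\<in>J. d l * e l)" using dn by (metis left_inverse mult.assoc mult_1)
        also have "\<dots> = (\<Sum>l\<in>J. (- (inverse (d n) * d l)) * e l)"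
          by (simp add: sum_distrib_left sum_negf mult.assoc)
        finally have "c a = (\<Sum>l\<in>J. (- (inverse (d n) * d l)) * e l)" .
        moreover have "\<forall>l\<in>J. - (inverse (d n) * d l) \<in> K" using d(1) cl(4,5,7) by simp
        ultimately have "\<exists>d. (\<forall>l\<in>J. d l \<in> K) \<and> c a = (\<Sum>l\<in>J. d l * e l)"
          by (intro exI[of _ "\<lambda>l. - (inverse (d n) * d l)"] conjI)
        then show False using False by contradiction
      qed
      then have "(\<Sum>l\<in>J. d l * e l) = 0" using e0 by simp
      then have "d l = 0" if "l \<in> J" for l using indepD[OF J(2), of d l] d(1) that by blast
      then show "\<forall>l\<in>?J. d l = 0" using dn by blast
    qed
    have "\<forall>b\<in>insert a A. \<forall>l\<in>?J. ?\<mu> b l \<in> K" using J(3) cl(1,2) by auto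
    moreover have "\<forall>b\<in>insert a A. c b = (\<Sum>l\<in>?J. ?\<mu> b l * ?e l)"
    proof
      fix b assume b: "b \<in> insert a A"
      show "c b = (\<Sum>l\<in>?J. ?\<mu> b l * ?e l)"
      proof (cases "b = a")
        case True
        have "(\<Sum>l\<in>J. ?\<mu> b l * e l) = 0" using n True by (intro sum.neutral) auto
        then show ?thesis unfolding sumJ using True by simp
      next
        case ba: False
        have "(\<Sum>l\<in>J. ?\<mu> b l * e l) = (\<Sum>l\<in>J. \<mu> b l * e l)" using n ba by (intro sum.cong) auto
        then show ?thesis unfolding sumJ using ba b J(4)[of b] by simp
      qed
    qed
    moreover have "?e ` ?J \<subseteq> c ` insert a A" using J(5) n by auto
    moreover have "finite ?J" using J(1) by simp
    ultimately show ?thesis using ind by (intro exI[of _ ?J] exI[of _ ?e] exI[of _ ?\<mu>] conjI)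
  qed
qed

text \<open>The locus over \<open>C\<close> of the point with coordinates \<open>t\<close> and the
  elements of \<open>Y\<close> is a curve, to which PAC applies with the projection to the first
  coordinate. A point \<open>a\<close> of the curve amounts to the homomorphism p(x) -> p(a) on
  C[x], and this is \<open>\<phi>\<close>. The hypothesis \<open>ld\<close> is what makes the curve
  defined over \<open>K\<close>.\<close>

lemma pac_specialisation:
  fixes K0 K E :: "'a::alg_closed_field set"
  defines "C \<equiv> algebraic_closure_of K"
  assumes pac: "pac_in_domain K0 K" and K: "is_subfield K" and E: "is_subfield E" "K \<subseteq> E"
    and t: "(ring.transcendental ambient over K) t" and tE: "t \<in> E"
    and Y: "finite Y" "Y \<subseteq> E"
    and sep: "\<And>u. u \<in> E \<Longrightarrow> \<exists>S. finite S \<and> u \<in> S \<and> lin_prod S \<in> polys_over (adjoin K {t})"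
    and ld: "\<And>(J :: nat set) e v. finite J \<Longrightarrow> e ` J \<subseteq> C \<Longrightarrow> indep K J e \<Longrightarrow> v ` J \<subseteq> E \<Longrightarrow>
       (\<Sum>j\<in>J. e j * v j) = 0 \<Longrightarrow> \<forall>j\<in>J. v j = 0"
  shows "\<exists>R \<phi>. C \<subseteq> R \<and> t \<in> R \<and> Y \<subseteq> R \<and>
     (\<forall>a\<in>R. \<forall>b\<in>R. a + b \<in> R \<and> a * b \<in> R \<and> \<phi> (a + b) = \<phi> a + \<phi> b \<and> \<phi> (a * b) = \<phi> a * \<phi> b) \<and>
     (\<forall>c\<in>C. \<phi> c = c) \<and> \<phi> ` Y \<subseteq> K \<and> \<phi> t \<in> K0"
proof -
  have C: "is_subfield C" and KC: "K \<subseteq> C"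
    unfolding C_def by (rule algebraic_closure_is_subfield[OF K] algebraic_closure_base[OF K])+
  have tC: "(ring.transcendental ambient over C) t" unfolding C_def by (rule transcendental_over_closure[OF K t])

  \<comment> \<open>The generic point and its locus\<close>
  obtain ys where ys: "set ys = Y" using finite_list[OF Y(1)] by blast
  define xs where "xs = t # ys"
  define n where "n = length xs"
  define x where "x = (\<lambda>i\<in>{..<n}. xs ! i)"
  have n1: "n \<ge> 1" by (simp add: n_def xs_def)
  have x0: "x 0 = t" using n1 by (simp add: x_def xs_def)
  have xim: "x ` {..<n} = set xs" by (force simp: x_def n_def set_conv_nth)
  have xY: "set xs = insert t Y" by (simp add: xs_def ys)
  have xaff: "x \<in> affine_space UNIV n" by (simp add: affine_space_def x_def)
  \<comment> \<open>Every closed set over \<open>C\<close> that contains \<open>x\<close> contains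
    \<open>V\<close>. Irreducibility follows, and the ideal of \<open>V\<close> consists of the
    relations satisfied by \<open>x\<close>.\<close>
  define V where "V = {y \<in> affine_space UNIV n. \<forall>p\<in>{p \<in> mpolys C n. mpoly_eval p x = 0}. mpoly_eval p y = 0}"
  have xV: "x \<in> V" using xaff by (simp add: V_def)
  have VD: "mpoly_eval p y = 0" if "y \<in> V" "p \<in> mpolys C n" "mpoly_eval p x = 0" for y p
    using that by (auto simp: V_def)
  have closed: "zariski_closed C n V"
    unfolding zariski_closed_def V_def by (rule exI[of _ "{p \<in> mpolys C n. mpoly_eval p x = 0}"]) blast
  have irr: "zariski_irreducible C n V"
    unfolding zariski_irreducible_def
  proof (intro conjI allI impI)
    show "V \<noteq> {}" using xV by blast
    fix V1 V2 assume a: "zariski_closed C n V1 \<and> zariski_closed C n V2 \<and> V \<subseteq> V1 \<union> V2"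
    have "V \<subseteq> W" if W: "zariski_closed C n W" "x \<in> W" for W
    proof -
      obtain S where S: "S \<subseteq> mpolys C n" "W = {x \<in> affine_space UNIV n. \<forall>p\<in>S. mpoly_eval p x = 0}"
        using W(1) unfolding zariski_closed_def by blast
      show ?thesis
      proof
        fix y assume y: "y \<in> V"
        have "mpoly_eval p y = 0" if "p \<in> S" for p
        proof (rule VD[OF y])
          show "p \<in> mpolys C n" using that S(1) by blast
          show "mpoly_eval p x = 0" using that W(2) unfolding S(2) by simp
        qed
        moreover have "y \<in> affine_space UNIV n" using y by (simp add: V_def)
        ultimately show "y \<in> W" unfolding S(2) by simp
      qed
    qed
    moreover have "x \<in> V1 \<or> x \<in> V2" using a xV by auto
    ultimately show "V \<subseteq> V1 \<or> V \<subseteq> V2" using a by metis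
  qed
  have vanC: "vanishing_ideal C n V = {p \<in> mpolys C n. mpoly_eval p x = 0}"
    unfolding vanishing_ideal_def using xV VD by (intro Collect_cong) metis
  have vanK: "vanishing_ideal K n V = {p \<in> mpolys K n. mpoly_eval p x = 0}"
    unfolding vanishing_ideal_def using xV VD subsetD[OF mpolys_mono[OF KC]] by (intro Collect_cong) metis
  have evE: "mpoly_eval p x \<in> E" if p: "p \<in> mpolys K n" for p
    unfolding mpoly_eval_def
  proof (intro is_subfield_closed(10,4,11,9)[OF E(1)])
    fix m assume m: "m \<in> Poly_Mapping.keys p"
    show "Poly_Mapping.lookup p m \<in> E" using p E(2) by (auto simp: mpolys_def)
    fix i assume "i \<in> Poly_Mapping.keys m"
    then have "i < n" using p m by (auto simp: mpolys_def)
    then have "x i \<in> insert t Y" unfolding xY[symmetric] xim[symmetric] by simp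
    then show "x i \<in> E" using tE Y(2) by auto
  qed

  \<comment> \<open>The ideal of the locus is generated over K\<close>
  have gen: "vanishing_ideal C n V = mpoly_ideal_generated C n (vanishing_ideal K n V)"
  proof
    show "mpoly_ideal_generated C n (vanishing_ideal K n V) \<subseteq> vanishing_ideal C n V"
    proof
      fix p assume "p \<in> mpoly_ideal_generated C n (vanishing_ideal K n V)"
      then obtain T q where T: "finite T" "T \<subseteq> vanishing_ideal K n V" "\<forall>p\<in>T. q p \<in> mpolys C n" "p = (\<Sum>p\<in>T. q p * p)"
        unfolding mpoly_ideal_generated_def by blast
      have Tm: "r \<in> mpolys C n" "mpoly_eval r x = 0" if "r \<in> T" for r
        using subsetD[OF T(2) that] subsetD[OF mpolys_mono[OF KC]] unfolding vanK by simp_all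
      have "p \<in> mpolys C n" unfolding T(4) using T(3) Tm(1) by (intro mpolys_closed(6,7)[OF C]) auto
      moreover have "mpoly_eval p x = 0"
        unfolding T(4) mpoly_eval_sum mpoly_eval_mult using Tm(2) by (intro sum.neutral) simp
      ultimately show "p \<in> vanishing_ideal C n V" unfolding vanC by blast
    qed
    show "vanishing_ideal C n V \<subseteq> mpoly_ideal_generated C n (vanishing_ideal K n V)"
    proof
      fix p assume "p \<in> vanishing_ideal C n V"
      then have p: "p \<in> mpolys C n" "mpoly_eval p x = 0" unfolding vanC by auto
      let ?M = "Poly_Mapping.keys p"
      \<comment> \<open>Writing the coefficients of \<open>p\<close> in a basis \<open>e\<close> of
        their span over \<open>K\<close> decomposes p into the sum of the e_l P_l with P_l over
        \<open>K\<close>. At \<open>x\<close> this is a relation between the independent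
        \<open>e l\<close> with coefficients P_l(x) in \<open>E\<close>, all of which vanish by
        \<open>ld\<close>.\<close>
      obtain J :: "nat set" and e \<mu> where "finite J \<and> indep K J e \<and> (\<forall>m\<in>?M. \<forall>l\<in>J. \<mu> m l \<in> K) \<and>
          (\<forall>m\<in>?M. Poly_Mapping.lookup p m = (\<Sum>l\<in>J. \<mu> m l * e l)) \<and> e ` J \<subseteq> Poly_Mapping.lookup p ` ?M"
        using finite_family_basis[OF K finite_keys[of p], of "Poly_Mapping.lookup p"] by (elim exE)
      then have J: "finite J" "indep K J e" "\<And>m l. m \<in> ?M \<Longrightarrow> l \<in> J \<Longrightarrow> \<mu> m l \<in> K"
        "\<And>m. m \<in> ?M \<Longrightarrow> Poly_Mapping.lookup p m = (\<Sum>l\<in>J. \<mu> m l * e l)" "e ` J \<subseteq> Poly_Mapping.lookup p ` ?M"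
        by blast+
      have eC: "e ` J \<subseteq> C" using J(5) p(1) by (auto simp: mpolys_def)
      define P where "P l = (\<Sum>m\<in>?M. Poly_Mapping.single m (\<mu> m l))" for l
      have PK: "P l \<in> mpolys K n" if "l \<in> J" for l
        unfolding P_def using that J(3) p(1) by (intro mpolys_closed(5,6)[OF K]) (auto simp: mpolys_def)
      have pP: "p = (\<Sum>l\<in>J. mpoly_const (e l) * P l)"
      proof -
        have "(\<Sum>l\<in>J. mpoly_const (e l) * P l) = (\<Sum>l\<in>J. \<Sum>m\<in>?M. Poly_Mapping.single m (\<mu> m l * e l))"
          by (simp add: P_def sum_distrib_left mult_single mult.commute)
        also have "\<dots> = (\<Sum>m\<in>?M. \<Sum>l\<in>J. Poly_Mapping.single m (\<mu> m l * e l))" by (rule sum.swap)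
        also have "\<dots> = (\<Sum>m\<in>?M. Poly_Mapping.single m (Poly_Mapping.lookup p m))"
        proof (rule sum.cong[OF refl])
          fix m assume m: "m \<in> ?M"
          have "(\<Sum>l\<in>J. Poly_Mapping.single m (\<mu> m l * e l)) = Poly_Mapping.single m (\<Sum>l\<in>J. \<mu> m l * e l)"
            using J(1) by (induction J rule: finite_induct) (simp_all add: single_add)
          then show "(\<Sum>l\<in>J. Poly_Mapping.single m (\<mu> m l * e l)) = Poly_Mapping.single m (Poly_Mapping.lookup p m)"
            using J(4)[OF m] by simp
        qed
        finally show ?thesis using mpoly_sum_monomials[of p] by simp
      qed
      have "(\<Sum>l\<in>J. e l * mpoly_eval (P l) x) = mpoly_eval p x"
        by (subst pP) (simp add: mpoly_eval_sum mpoly_eval_mult mpoly_eval_const)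
      then have "(\<Sum>l\<in>J. e l * mpoly_eval (P l) x) = 0" using p(2) by simp
      moreover have "(\<lambda>l. mpoly_eval (P l) x) ` J \<subseteq> E" using evE[OF PK] by blast
      ultimately have "\<forall>l\<in>J. mpoly_eval (P l) x = 0"
        using ld[OF J(1) eC J(2), of "\<lambda>l. mpoly_eval (P l) x"] by blast
      then have Pv: "P ` J \<subseteq> vanishing_ideal K n V" unfolding vanK using PK by blast
      \<comment> \<open>Several indices may share the same \<open>P l\<close>, while a generated
        ideal has one multiplier per generator; the multipliers of equal generators are added
        up.\<close>
      define q where "q r = (\<Sum>l\<in>{l \<in> J. P l = r}. mpoly_const (e l))" for r
      have "p = (\<Sum>r\<in>P ` J. \<Sum>l\<in>{l \<in> J. P l = r}. mpoly_const (e l) * P l)"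
        using sum.image_gen[OF J(1), of "\<lambda>l. mpoly_const (e l) * P l" P] pP by simp
      also have "\<dots> = (\<Sum>r\<in>P ` J. q r * r)"
        unfolding q_def sum_distrib_right by (intro sum.cong) auto
      finally have "p = (\<Sum>r\<in>P ` J. q r * r)" .
      moreover have "\<forall>r\<in>P ` J. q r \<in> mpolys C n"
        unfolding q_def using eC by (auto intro!: mpolys_closed(6,8)[OF C])
      ultimately show "p \<in> mpoly_ideal_generated C n (vanishing_ideal K n V)"
        unfolding mpoly_ideal_generated_def using J(1) Pv
        by (intro CollectI exI[of _ "P ` J"] exI[of _ q] conjI) simp_all
    qed
  qed
  have abs_irr: "absolutely_irreducible_variety K n V"
    unfolding absolutely_irreducible_variety_def Let_def using closed irr gen by (simp add: C_def)
  have generic: "generic_point K n V x" unfolding generic_point_def vanK using xV by blast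

  \<comment> \<open>The coordinate t as a separable dominating map\<close>
  define \<nu> where "\<nu> = (\<lambda>i\<in>{..<1::nat}. t)"
  have \<nu>0: "\<nu> 0 = t" and \<nu>im: "\<nu> ` {..<1} = {t}" by (auto simp: \<nu>_def image_iff)
  have ff: "function_field K n x = adjoin K (insert t Y)" unfolding function_field_def xim xY ..
  let ?F = "adjoin K (insert t Y)"
  have F: "is_subfield ?F" "?F \<subseteq> E" "t \<in> ?F"
    using adjoin_is_subfield adjoin_least[OF E, of "insert t Y"] tE Y(2) adjoin_gens[of "insert t Y" K] by auto
  have kt: "is_subfield (adjoin K {t})" "adjoin K {t} \<subseteq> ?F"
    using adjoin_is_subfield[of K "{t}"] adjoin_least[OF F(1) adjoin_base, of "{t}"] F(3) by auto
  have alg: "algebraic_extension (adjoin K {t}) ?F"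
    unfolding algebraic_extension_def field_extension_def
  proof (intro conjI ballI)
    fix u assume "u \<in> ?F"
    then obtain S where "finite S" "u \<in> S" "lin_prod S \<in> polys_over (adjoin K {t})" using sep F(2) by blast
    then show "(ring.algebraic ambient over adjoin K {t}) u" using separable_elementI(1)[OF kt(1)] by blast
  qed (use kt F in auto)
  have sepm: "separable_map K n x 1 \<nu>"
    unfolding separable_map_def \<nu>im ff separable_extension_def
  proof (intro conjI ballI)
    fix u assume "u \<in> ?F"
    then obtain S where "finite S" "u \<in> S" "lin_prod S \<in> polys_over (adjoin K {t})" using sep F(2) by blast
    then show "coprime (min_poly (adjoin K {t}) u) (pderiv (min_poly (adjoin K {t}) u))"
      using separable_elementI(2)[OF kt(1)] by blast
  qed (rule alg)
  have ratmap: "rational_map K n x 1 \<nu>"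
    unfolding rational_map_def ff affine_space_def using F(3) by (auto simp: \<nu>_def)
  have dim: "has_dimension K n V 1"
    unfolding has_dimension_def has_transcendence_degree_def
  proof (intro exI[of _ x] conjI bexI[of _ \<nu>])
    show "generic_point K n V x" by (rule generic)
    show "algebraically_independent K 1 \<nu>" by (rule algebraically_independent_single[of K t \<nu>, OF K t \<nu>0])
    show "algebraic_extension (adjoin K (\<nu> ` {..<1})) (function_field K n x)" unfolding \<nu>im ff by (rule alg)
    show "\<nu> \<in> affine_space (function_field K n x) 1" using ratmap unfolding rational_map_def .
  qed
  have dom: "dominating K n V x 1 \<nu>"
    unfolding dominating_def
  proof (intro allI impI)
    fix W assume W: "zariski_closed (algebraic_closure_of K) 1 W \<and>
      {b. \<exists>a\<in>V. rational_map_value K n x 1 \<nu> a b} \<subseteq> W"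
    \<comment> \<open>The image contains the value at the generic point, which is transcendental
      over \<open>C\<close>; no proper closed subset of the line defined over \<open>C\<close>
      contains it.\<close>
    have "rational_map_value K n x 1 \<nu> x \<nu>"
      unfolding rational_map_value_def
    proof (intro conjI allI impI)
      show "\<nu> \<in> affine_space UNIV 1" by (simp add: affine_space_def \<nu>_def)
      fix i :: nat assume "i < 1"
      then have i: "i = 0" by simp
      show "\<exists>f\<in>mpolys K n. \<exists>g\<in>mpolys K n. mpoly_eval g x \<noteq> 0 \<and> mpoly_eval g x \<noteq> 0 \<and>
          \<nu> i = mpoly_eval f x / mpoly_eval g x \<and> \<nu> i = mpoly_eval f x / mpoly_eval g x"
        using n1 mpolys_closed(9)[OF K, of 0 n] mpolys_closed(8)[OF K is_subfield_closed(2)[OF K], of n]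
        by (intro bexI[of _ "mpoly_var 0"] bexI[of _ "mpoly_const 1"])
           (simp_all only: mpoly_eval_var mpoly_eval_const i \<nu>0 x0, simp_all)
    qed
    then have \<nu>W: "\<nu> \<in> W" using W xV by blast
    obtain S where S: "S \<subseteq> mpolys C 1" "W = {x \<in> affine_space UNIV 1. \<forall>p\<in>S. mpoly_eval p x = 0}"
      using W unfolding zariski_closed_def C_def by blast
    have "p = 0" if "p \<in> S" for p
      using algebraically_independent_single[of C t \<nu>, OF C tC \<nu>0] \<nu>W S that
      unfolding algebraically_independent_def by blast
    then show "W = affine_space UNIV 1" unfolding S(2) using mpoly_eval_0 by auto
  qed

  \<comment> \<open>The rational point and its specialisation\<close>
  have "\<exists>a\<in>V \<inter> affine_space K n. \<exists>b\<in>affine_space K0 1. rational_map_value K n x 1 \<nu> a b"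
    using pac[unfolded pac_in_domain_def, rule_format, of 1 n V x \<nu>] abs_irr dim generic ratmap dom sepm by simp
  then obtain a b where a: "a \<in> V" "a \<in> affine_space K n" and b: "b \<in> affine_space K0 1"
    and val: "rational_map_value K n x 1 \<nu> a b" by blast
  obtain f g where fg: "f \<in> mpolys K n" "g \<in> mpolys K n" "mpoly_eval g x \<noteq> 0" "mpoly_eval g a \<noteq> 0"
    "\<nu> 0 = mpoly_eval f x / mpoly_eval g x" "b 0 = mpoly_eval f a / mpoly_eval g a"
    using val unfolding rational_map_value_def by auto
  \<comment> \<open>The value is computed from some fraction f/g representing \<open>t\<close>.
    Since f - X_0 g vanishes at \<open>x\<close>, it vanishes at \<open>a\<close>, so the value is
    the first coordinate of \<open>a\<close>.\<close>
  have "a 0 = b 0"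
  proof -
    let ?p = "f - mpoly_var 0 * g"
    have "?p \<in> mpolys C n"
      using fg(1,2) mpolys_mono[OF KC] n1 by (intro mpolys_closed[OF C]) auto
    moreover have e: "mpoly_eval ?p y = mpoly_eval f y - y 0 * mpoly_eval g y" for y
      by (simp only: mpoly_eval_diff mpoly_eval_mult mpoly_eval_var)
    have "mpoly_eval ?p x = 0" unfolding e x0 using fg(3,5) \<nu>0 by (simp add: field_simps)
    ultimately have "mpoly_eval ?p a = 0" by (rule VD[OF a(1)])
    then show ?thesis unfolding e using fg(4,6) by (simp add: field_simps)
  qed
  then have a0: "a 0 \<in> K0" using b by (auto simp: affine_space_def)
  \<comment> \<open>The choice does not matter: two polynomials with the same value at
    \<open>x\<close> differ by an element of the ideal of \<open>V\<close>, which vanishes at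
    \<open>a\<close>.\<close>
  define \<phi> where "\<phi> u = mpoly_eval (SOME p. p \<in> mpolys C n \<and> mpoly_eval p x = u) a" for u
  have \<phi>: "\<phi> (mpoly_eval p x) = mpoly_eval p a" if p: "p \<in> mpolys C n" for p
  proof -
    let ?q = "SOME q. q \<in> mpolys C n \<and> mpoly_eval q x = mpoly_eval p x"
    have q: "?q \<in> mpolys C n \<and> mpoly_eval ?q x = mpoly_eval p x" by (rule someI[of _ p]) (simp add: p)
    then have "mpoly_eval (?q - p) a = 0"
      using VD[OF a(1) mpolys_closed(4)[OF C _ p], of ?q] by (simp add: mpoly_eval_diff)
    then show ?thesis by (simp add: \<phi>_def mpoly_eval_diff)
  qed
  define R where "R = (\<lambda>p. mpoly_eval p x) ` mpolys C n"
  have var: "x i \<in> R" "\<phi> (x i) = a i" if "i < n" for i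
    using mpolys_closed(9)[OF C that] \<phi>[of "mpoly_var i"] mpoly_eval_var[of i x] mpoly_eval_var[of i a]
    unfolding R_def by (metis imageI, simp)
  have const: "c \<in> R" "\<phi> c = c" if "c \<in> C" for c
    using mpolys_closed(8)[OF C that, of n] \<phi>[of "mpoly_const c"] mpoly_eval_const[of c x] mpoly_eval_const[of c a]
    unfolding R_def by (metis imageI, simp)
  have ring: "u + v \<in> R \<and> u * v \<in> R \<and> \<phi> (u + v) = \<phi> u + \<phi> v \<and> \<phi> (u * v) = \<phi> u * \<phi> v" if uv: "u \<in> R" "v \<in> R" for u v
  proof -
    obtain p q where pq: "p \<in> mpolys C n" "q \<in> mpolys C n" "u = mpoly_eval p x" "v = mpoly_eval q x"
      using uv unfolding R_def by blast
    have s: "p + q \<in> mpolys C n" "p * q \<in> mpolys C n" by (intro mpolys_closed(2,7)[OF C] pq(1,2))+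
    have "u + v = mpoly_eval (p + q) x" "u * v = mpoly_eval (p * q) x"
      by (simp_all add: pq mpoly_eval_add mpoly_eval_mult)
    then show ?thesis
      using imageI[OF s(1), of "\<lambda>p. mpoly_eval p x"] imageI[OF s(2), of "\<lambda>p. mpoly_eval p x"]
        \<phi>[OF s(1)] \<phi>[OF s(2)] \<phi>[OF pq(1)] \<phi>[OF pq(2)]
      unfolding R_def pq(3,4) by (simp only: mpoly_eval_add mpoly_eval_mult)
  qed
  have xin: "\<exists>i<n. y = x i" if "y \<in> insert t Y" for y
    using that unfolding xY[symmetric] xim[symmetric] by auto
  have "t \<in> R" "\<phi> t \<in> K0" using var[of 0] n1 x0 a0 by auto
  moreover have "y \<in> R \<and> \<phi> y \<in> K" if y: "y \<in> Y" for y
  proof -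
    obtain i where i: "i < n" "y = x i" using xin y by blast
    then have "a i \<in> K" using a(2) by (auto simp: affine_space_def)
    then show ?thesis using var[OF i(1)] i(2) by simp
  qed
  then have "Y \<subseteq> R" "\<phi> ` Y \<subseteq> K" by auto
  moreover have "C \<subseteq> R" using const(1) by (rule subsetI)
  ultimately show ?thesis using const(2) ring by (intro exI[of _ R] exI[of _ \<phi>] conjI ballI) simp_all
qed

section \<open>Linear disjointness\<close>

text \<open>Here elements of \<open>C\<close> keep their independence over \<open>E\<close>, whereas
  \<open>linearly_disjoint\<close> lets elements of the extension keep theirs over the constants.
  The present side is the one that passes to simple extensions and descends ideals;
  \<open>disjoint_over_indep\<close> and \<open>disjoint_over_from_indep\<close> change
  sides.\<close>

definition disjoint_over :: "'a::field set \<Rightarrow> 'a set \<Rightarrow> 'a set \<Rightarrow> bool" where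
  "disjoint_over K C E \<longleftrightarrow> (\<forall>(J :: nat set) e v. finite J \<longrightarrow> e ` J \<subseteq> C \<longrightarrow> indep K J e \<longrightarrow> v ` J \<subseteq> E \<longrightarrow>
     (\<Sum>j\<in>J. e j * v j) = 0 \<longrightarrow> (\<forall>j\<in>J. v j = 0))"

lemma disjoint_overI:
  assumes "\<And>(J :: nat set) e v j. finite J \<Longrightarrow> (\<And>i. i \<in> J \<Longrightarrow> e i \<in> C) \<Longrightarrow> indep K J e \<Longrightarrow>
     (\<And>i. i \<in> J \<Longrightarrow> v i \<in> E) \<Longrightarrow> (\<Sum>j\<in>J. e j * v j) = 0 \<Longrightarrow> j \<in> J \<Longrightarrow> v j = 0"
  shows "disjoint_over K C E"
  unfolding disjoint_over_def
proof (intro allI impI ballI)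
  fix J :: "nat set" and e v j
  assume a: "finite J" "e ` J \<subseteq> C" "indep K J e" "v ` J \<subseteq> E" "(\<Sum>j\<in>J. e j * v j) = 0" "j \<in> J"
  show "v j = 0" by (rule assms[OF a(1) _ a(3) _ a(5,6)]) (use a(2,4) in auto)
qed

lemma disjoint_overD:
  assumes "disjoint_over K C E" "finite (J :: nat set)" "\<And>i. i \<in> J \<Longrightarrow> e i \<in> C" "indep K J e"
    "\<And>i. i \<in> J \<Longrightarrow> v i \<in> E" "(\<Sum>j\<in>J. e j * v j) = 0" "j \<in> J"
  shows "v j = 0"
proof -
  have "e ` J \<subseteq> C" "v ` J \<subseteq> E" using assms(3,5) by auto
  then show ?thesis using assms(1,2,4,6,7) unfolding disjoint_over_def by blast
qed

text \<open>After clearing denominators the relation is a polynomial identity in \<open>t\<close>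
  over \<open>C\<close>; its coefficients are relations among the \<open>e j\<close> with scalars in
  \<open>L\<close>.\<close>

lemma disjoint_over_rational:
  assumes L: "is_subfield L" and C: "is_subfield C" and LC: "L \<subseteq> C"
    and t: "(ring.transcendental ambient over C) t"
  shows "disjoint_over L C (adjoin L {t})"
proof (rule disjoint_overI)
  fix J :: "nat set" and e v l
  assume J: "finite J" "\<And>i. i \<in> J \<Longrightarrow> e i \<in> C" "indep L J e" "\<And>i. i \<in> J \<Longrightarrow> v i \<in> adjoin L {t}"
    "(\<Sum>j\<in>J. e j * v j) = 0" "l \<in> J"
  have tL: "(ring.transcendental ambient over L) t"
    using t polys_over_mono[OF LC] unfolding transcendental_iff[OF C] transcendental_iff[OF L] by blast
  \<comment> \<open>Collecting the \<open>v j\<close> as coefficients of one polynomial yields a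
    common denominator for all of them.\<close>
  define p where "p = (\<Sum>j\<in>J. monom (v j) j)"
  have cp: "coeff p j = v j" if "j \<in> J" for j
    using that J(1) by (simp add: p_def coeff_sum coeff_monom if_distrib cong: if_cong)
  have "p \<in> polys_over (adjoin L {t})"
    unfolding p_def by (intro polys_over_closed(9,10)[OF adjoin_is_subfield] J(4))
  then obtain q P where q: "q \<in> polys_over L" "P \<in> polys2_over L" "q \<noteq> 0" "specialise P t = smult (poly q t) p"
    using clear_denominators[OF L tL] by blast
  have qt: "poly q t \<noteq> 0" using q(1,3) tL unfolding transcendental_iff[OF L] by blast
  have Pt: "poly (coeff P j) t = poly q t * v j" if "j \<in> J" for j
    using arg_cong[OF q(4), of "\<lambda>r. coeff r j"] cp[OF that] by (simp add: coeff_specialise)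
  define r where "r = (\<Sum>j\<in>J. smult (e j) (coeff P j))"
  have PC: "coeff P j \<in> polys_over C" for j using polys_overD[OF q(2)] polys_over_mono[OF LC] by blast
  have rC: "r \<in> polys_over C" unfolding r_def by (intro polys_over_closed(7,10)[OF C] J(2) PC)
  have "poly r t = (\<Sum>j\<in>J. poly q t * (e j * v j))"
    unfolding r_def poly_sum poly_smult by (intro sum.cong) (simp_all add: Pt)
  also have "\<dots> = 0" using J(5) by (simp add: sum_distrib_left[symmetric])
  finally have r0: "r = 0" using t rC unfolding transcendental_iff[OF C] by blast
  have "coeff (coeff P l) i = 0" for i
  proof (rule indepD[OF J(3) _ _ J(6), of "\<lambda>j. coeff (coeff P j) i"])
    show "coeff (coeff P j) i \<in> L" for j using polys_overD[OF polys_overD[OF q(2)]] .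
    have "(\<Sum>j\<in>J. coeff (coeff P j) i * e j) = coeff r i"
      by (simp add: r_def coeff_sum mult.commute)
    then show "(\<Sum>j\<in>J. coeff (coeff P j) i * e j) = 0" using r0 by simp
  qed
  then have "coeff P l = 0" by (intro poly_eqI) simp
  then show "v l = 0" using Pt[OF J(6)] qt by simp
qed

text \<open>Elements of k(z) are polynomials in \<open>z\<close> of degree below that of
  \<open>m\<close>. Because \<open>m\<close> is still minimal over k', which contains
  \<open>C\<close>, a relation between them with coefficients in \<open>C\<close> holds coefficient
  by coefficient, and there \<open>d\<close> applies.\<close>

lemma disjoint_over_simple:
  assumes k: "is_subfield k" "k \<subseteq> k'" and k': "is_subfield k'" and C: "C \<subseteq> k'"
    and m: "is_min_poly k z m" "is_min_poly k' z m" and d: "disjoint_over L C k"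
  shows "disjoint_over L C (adjoin k {z})"
proof (rule disjoint_overI)
  fix J :: "nat set" and e v l
  assume J: "finite J" "\<And>i. i \<in> J \<Longrightarrow> e i \<in> C" "indep L J e" "\<And>i. i \<in> J \<Longrightarrow> v i \<in> adjoin k {z}"
    "(\<Sum>j\<in>J. e j * v j) = 0" "l \<in> J"
  have "\<exists>P. P \<in> polys_over k \<and> (P = 0 \<or> degree P < degree m) \<and> v j = poly P z" if "j \<in> J" for j
    using J(4)[OF that] unfolding adjoin_algebraic[OF k(1) m(1)] by blast
  then obtain P where P: "\<And>j. j \<in> J \<Longrightarrow> P j \<in> polys_over k \<and> (P j = 0 \<or> degree (P j) < degree m) \<and> v j = poly (P j) z"
    by metis
  define q where "q = (\<Sum>j\<in>J. smult (e j) (P j))"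
  have "q \<in> polys_over k'"
    unfolding q_def using P J(2) C polys_over_mono[OF k(2)] by (intro polys_over_closed(7,10)[OF k']) auto
  moreover have "poly q z = (\<Sum>j\<in>J. e j * v j)" unfolding q_def poly_sum poly_smult using P by (intro sum.cong) auto
  ultimately obtain s where s: "q = m * s" using m(2) J(5) by (auto simp: is_min_poly_def)
  have lm: "lead_coeff m = 1" using m(1) by (simp add: is_min_poly_def)
  have cm: "coeff q i = 0" if i: "i \<ge> degree m" for i
    unfolding q_def coeff_sum
  proof (rule sum.neutral, rule ballI)
    fix j assume "j \<in> J"
    then have "coeff (P j) i = 0" using P[of j] i by (auto intro: coeff_eq_0)
    then show "coeff (smult (e j) (P j)) i = 0" by simp
  qed
  have q0: "q = 0"
  proof (rule ccontr)
    assume "q \<noteq> 0"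
    then have "degree m \<le> degree q" using s lm by (auto simp: degree_mult_eq)
    then show False using cm[of "degree q"] \<open>q \<noteq> 0\<close> by simp
  qed
  have "coeff (P l) i = 0" for i
  proof (rule disjoint_overD[OF d J(1) J(2) J(3) _ _ J(6), of "\<lambda>j. coeff (P j) i"])
    show "coeff (P j) i \<in> k" if "j \<in> J" for j using P[OF that] polys_overD by blast
    show "(\<Sum>j\<in>J. e j * coeff (P j) i) = 0" using arg_cong[OF q0, of "\<lambda>r. coeff r i"] by (simp add: q_def coeff_sum)
  qed
  then have "P l = 0" by (intro poly_eqI) simp
  then show "v l = 0" using P[OF J(6)] by simp
qed

text \<open>Expanding the coefficients \<open>c\<close> in a basis \<open>e\<close> of their span
  over \<open>L\<close> gives a relation among the \<open>e l\<close> with coefficients in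
  \<open>M\<close>. These vanish by disjointness, and each is a combination of the
  \<open>b i\<close> over \<open>L\<close>.\<close>

lemma disjoint_over_indep:
  assumes L: "is_subfield L" and M: "is_subfield M" "L \<subseteq> M" and d: "disjoint_over L C M"
    and I: "finite (I :: 'i set)" "b ` I \<subseteq> M" "indep L I b"
  shows "indep C I b"
  unfolding indep_def
proof (intro allI impI ballI)
  fix c i assume c: "\<forall>i\<in>I. c i \<in> C" "(\<Sum>i\<in>I. c i * b i) = 0" and i: "i \<in> I"
  obtain J :: "nat set" and e \<mu> where "finite J \<and> indep L J e \<and> (\<forall>a\<in>I. \<forall>l\<in>J. \<mu> a l \<in> L) \<and>
     (\<forall>a\<in>I. c a = (\<Sum>l\<in>J. \<mu> a l * e l)) \<and> e ` J \<subseteq> c ` I"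
    using finite_family_basis[OF L I(1), of c] by (elim exE)
  then have J: "finite J" "indep L J e" "\<And>a l. a \<in> I \<Longrightarrow> l \<in> J \<Longrightarrow> \<mu> a l \<in> L"
    "\<And>a. a \<in> I \<Longrightarrow> c a = (\<Sum>l\<in>J. \<mu> a l * e l)" "\<And>l. l \<in> J \<Longrightarrow> e l \<in> c ` I" by blast+
  define B where "B l = (\<Sum>i\<in>I. \<mu> i l * b i)" for l
  have "(\<Sum>l\<in>J. e l * B l) = (\<Sum>l\<in>J. \<Sum>i\<in>I. \<mu> i l * e l * b i)"
    unfolding B_def sum_distrib_left by (simp add: mult.assoc mult.left_commute)
  also have "\<dots> = (\<Sum>i\<in>I. \<Sum>l\<in>J. \<mu> i l * e l * b i)" by (rule sum.swap)
  also have "\<dots> = (\<Sum>i\<in>I. c i * b i)" by (intro sum.cong) (simp_all add: J(4) sum_distrib_right)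
  finally have sum0: "(\<Sum>l\<in>J. e l * B l) = 0" using c(2) by simp
  have eC: "e l \<in> C" if "l \<in> J" for l using J(5)[OF that] c(1) by auto
  have BM: "B l \<in> M" if "l \<in> J" for l
    unfolding B_def using J(3)[OF _ that] I(2) M(2) by (intro is_subfield_closed(10,4)[OF M(1)]) auto
  have "\<mu> i l = 0" if l: "l \<in> J" for l
  proof (rule indepD[OF I(3) _ _ i, of "\<lambda>i. \<mu> i l"])
    show "\<mu> i l \<in> L" if "i \<in> I" for i using J(3)[OF that l] .
    show "(\<Sum>i\<in>I. \<mu> i l * b i) = 0" using disjoint_overD[OF d J(1) eC J(2) BM sum0 l] by (simp add: B_def)
  qed
  then show "c i = 0" using J(4)[OF i] by simp
qed

text \<open>The reverse change of sides, by expanding the \<open>v j\<close> in a basis of their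
  span over \<open>K\<close>.\<close>

lemma disjoint_over_from_indep:
  assumes K: "is_subfield K" and C: "is_subfield C" "K \<subseteq> C"
    and ind: "\<And>(I :: nat set) b. finite I \<Longrightarrow> b ` I \<subseteq> E \<Longrightarrow> indep K I b \<Longrightarrow> indep C I b"
  shows "disjoint_over K C E"
proof (rule disjoint_overI)
  fix J :: "nat set" and e v l
  assume J: "finite J" "\<And>i. i \<in> J \<Longrightarrow> e i \<in> C" "indep K J e" "\<And>i. i \<in> J \<Longrightarrow> v i \<in> E"
    "(\<Sum>j\<in>J. e j * v j) = 0" "l \<in> J"
  obtain I :: "nat set" and b \<kappa> where "finite I \<and> indep K I b \<and> (\<forall>j\<in>J. \<forall>a\<in>I. \<kappa> j a \<in> K) \<and>
     (\<forall>j\<in>J. v j = (\<Sum>a\<in>I. \<kappa> j a * b a)) \<and> b ` I \<subseteq> v ` J"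
    using finite_family_basis[OF K J(1), of v] by (elim exE)
  then have I: "finite I" "indep K I b" "\<And>j a. j \<in> J \<Longrightarrow> a \<in> I \<Longrightarrow> \<kappa> j a \<in> K"
    "\<And>j. j \<in> J \<Longrightarrow> v j = (\<Sum>a\<in>I. \<kappa> j a * b a)" "\<And>a. a \<in> I \<Longrightarrow> b a \<in> v ` J" by blast+
  have "b ` I \<subseteq> E" using I(5) J(4) by fastforce
  then have indC: "indep C I b" by (rule ind[OF I(1) _ I(2)])
  define c where "c a = (\<Sum>j\<in>J. \<kappa> j a * e j)" for a
  have "(\<Sum>a\<in>I. c a * b a) = (\<Sum>a\<in>I. \<Sum>j\<in>J. e j * (\<kappa> j a * b a))"
    unfolding c_def sum_distrib_right by (simp add: mult.assoc mult.left_commute)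
  also have "\<dots> = (\<Sum>j\<in>J. \<Sum>a\<in>I. e j * (\<kappa> j a * b a))" by (rule sum.swap)
  also have "\<dots> = (\<Sum>j\<in>J. e j * v j)" by (intro sum.cong) (simp_all add: I(4) sum_distrib_left)
  finally have sum0: "(\<Sum>a\<in>I. c a * b a) = 0" using J(5) by simp
  have cC: "c a \<in> C" if "a \<in> I" for a
    unfolding c_def using I(3)[OF _ that] J(2) C(2) by (intro is_subfield_closed(10,4)[OF C(1)]) auto
  have "\<kappa> l a = 0" if a: "a \<in> I" for a
  proof (rule indepD[OF J(3) _ _ J(6), of "\<lambda>j. \<kappa> j a"])
    show "\<kappa> j a \<in> K" if "j \<in> J" for j using I(3)[OF that a] .
    show "(\<Sum>j\<in>J. \<kappa> j a * e j) = 0" using indepD[OF indC cC sum0 a] by (simp add: c_def)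
  qed
  then show "v l = 0" using I(4)[OF J(6)] by simp
qed

lemma indep_subset:
  assumes "indep K I b" "J \<subseteq> I" "finite I" "0 \<in> K"
  shows "indep K J b"
  unfolding indep_def
proof (intro allI impI ballI)
  fix c i assume c: "\<forall>i\<in>J. c i \<in> K" "(\<Sum>i\<in>J. c i * b i) = 0" and i: "i \<in> J"
  let ?c = "\<lambda>i. if i \<in> J then c i else 0"
  have "(\<Sum>i\<in>I. ?c i * b i) = (\<Sum>i\<in>J. ?c i * b i)"
    using assms(2,3) by (intro sum.mono_neutral_right) auto
  also have "\<dots> = 0" using c(2) by simp
  finally have "?c i = 0" using indepD[OF assms(1), of ?c i] c(1) i assms(2,4) by auto
  then show "c i = 0" using i by simp
qed

text \<open>Artin's argument: apply the automorphisms to a relation with one coefficient equal to 1 and subtract.\<close>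

lemma indep_descent:
  assumes G: "galois_extension K L" and M: "is_subfield M" "L \<subseteq> M"
    and \<delta>: "\<And>g. g \<in> Gal K L \<Longrightarrow> hom_on M (\<delta> g)" "\<And>g x. g \<in> Gal K L \<Longrightarrow> x \<in> L \<Longrightarrow> \<delta> g x = g x"
    and I: "finite I" "\<And>i. i \<in> I \<Longrightarrow> b i \<in> M" "\<And>i g. i \<in> I \<Longrightarrow> g \<in> Gal K L \<Longrightarrow> \<delta> g (b i) = b i"
      "indep K I b"
  shows "indep L I b"
  using I
proof (induction I rule: finite_induct)
  case empty
  show ?case by (simp add: indep_def)
next
  case (insert a I)
  have K: "is_subfield K" and L: "is_subfield L" and KL: "K \<subseteq> L" using G unfolding galois_extension_iff by auto
  note cL = is_subfield_closed[OF L]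
  have "indep K I b"
    by (rule indep_subset[OF insert.prems(3)]) (use insert.hyps is_subfield_closed(1)[OF K] in auto)
  then have IH: "indep L I b" using insert.IH insert.prems(1,2) by blast
  show ?case
    unfolding indep_def
  proof (intro allI impI)
    fix c assume c: "\<forall>i\<in>insert a I. c i \<in> L" "(\<Sum>i\<in>insert a I. c i * b i) = 0"
    have ca: "c a = 0"
    proof (rule ccontr)
      assume ca: "c a \<noteq> 0"
      define d where "d i = c i / c a" for i
      have dL: "d i \<in> L" if "i \<in> insert a I" for i unfolding d_def using c(1) that by (intro cL(8)) auto
      have da: "d a = 1" using ca by (simp add: d_def)
      have "(\<Sum>i\<in>insert a I. d i * b i) = inverse (c a) * (\<Sum>i\<in>insert a I. c i * b i)"
        unfolding sum_distrib_left by (intro sum.cong) (simp_all add: d_def divide_inverse algebra_simps)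
      then have d0: "(\<Sum>i\<in>insert a I. d i * b i) = 0" using c(2) by simp
      have "d i \<in> K" if i: "i \<in> I" for i
      proof (rule galois_fixed_field[OF G dL])
        show "i \<in> insert a I" using i by simp
        fix g assume g: "g \<in> Gal K L"
        have mem: "d i * b i \<in> M" "d i \<in> M" if "i \<in> insert a I" for i
          using dL[OF that] insert.prems(1)[OF that] M is_subfield_closed(4)[OF M(1)] by auto
        have gL: "g (d i) \<in> L" if "i \<in> insert a I" for i using GalD(5)[OF L g dL[OF that]] .
        have "\<delta> g (\<Sum>i\<in>insert a I. d i * b i) = (\<Sum>i\<in>insert a I. \<delta> g (d i * b i))"
          by (rule hom_on_simps(10)[OF M(1) \<delta>(1)[OF g] mem(1)])
        also have "\<dots> = (\<Sum>i\<in>insert a I. g (d i) * b i)"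
        proof (rule sum.cong[OF refl])
          fix i assume i: "i \<in> insert a I"
          show "\<delta> g (d i * b i) = g (d i) * b i"
            using hom_on_simps(4)[OF M(1) \<delta>(1)[OF g] mem(2)[OF i] insert.prems(1)[OF i]]
              \<delta>(2)[OF g dL[OF i]] insert.prems(2)[OF i g] by simp
        qed
        finally have g0: "(\<Sum>i\<in>insert a I. g (d i) * b i) = 0"
          using d0 hom_on_simps(1)[OF M(1) \<delta>(1)[OF g]] by simp
        have "(\<Sum>i\<in>insert a I. (g (d i) - d i) * b i) = 0"
          using g0 d0 by (simp only: left_diff_distrib sum_subtractf) simp
        moreover have "g (d a) - d a = 0" using da hom_on_simps(2)[OF L GalD(3)[OF L g]] by simp
        ultimately have s0: "(\<Sum>i\<in>I. (g (d i) - d i) * b i) = 0" using insert.hyps by simp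
        have "g (d i) - d i = 0"
          by (rule indepD[OF IH _ s0 i]) (use gL dL cL(6) in auto)
        then show "g (d i) = d i" by simp
      qed
      then have "d i \<in> K" if "i \<in> insert a I" for i using that da is_subfield_closed(2)[OF K] by auto
      then have "d a = 0" using indepD[OF insert.prems(3) _ d0] by blast
      then show False using da by simp
    qed
    then have "(\<Sum>i\<in>I. c i * b i) = 0" using c(2) insert.hyps by simp
    then have "c i = 0" if "i \<in> I" for i using indepD[OF IH, of c i] c(1) that by blast
    then show "\<forall>i\<in>insert a I. c i = 0" using ca by blast
  qed
qed

section \<open>The compositum and its automorphisms\<close>

text \<open>The equaliser of two homomorphisms is a subfield.\<close>

lemma hom_eq_adjoin:
  assumes A: "is_subfield A" and sub: "K \<subseteq> A" "S \<subseteq> A" and h: "hom_on A h" and h': "hom_on A h'"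
    and eq: "\<And>x. x \<in> K \<Longrightarrow> h x = h' x" "\<And>x. x \<in> S \<Longrightarrow> h x = h' x"
  shows "x \<in> adjoin K S \<Longrightarrow> h x = h' x"
proof -
  note c = is_subfield_closed[OF A] and s = hom_on_simps[OF A h] and s' = hom_on_simps[OF A h']
  have "is_subfield {x \<in> A. h x = h' x}"
    by (rule is_subfieldI) (simp_all add: c s s')
  then have "adjoin K S \<subseteq> {x \<in> A. h x = h' x}"
    by (rule adjoin_least) (use sub eq in auto)
  then show "x \<in> adjoin K S \<Longrightarrow> h x = h' x" by blast
qed

lemma adjoin_mono:
  assumes "K \<subseteq> K'" "S \<subseteq> S'"
  shows "adjoin K S \<subseteq> adjoin K' S'"
  using assms adjoin_base[of K' S'] adjoin_gens[of S' K'] by (intro adjoin_least adjoin_is_subfield) auto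

lemma hom_on_id: "hom_on A (\<lambda>x. x)"
  by (simp add: hom_on_def)

lemma constant_poly_of_values:
  fixes P :: "'a::idom poly"
  assumes "finite U" "U \<noteq> {}" "\<And>s. s \<in> U \<Longrightarrow> poly P s = u" "P = 0 \<or> degree P < card U"
  shows "P = [:u:]"
proof (rule ccontr)
  assume "P \<noteq> [:u:]"
  then have nz: "P - [:u:] \<noteq> 0" by simp
  have "U \<subseteq> {s. poly (P - [:u:]) s = 0}" using assms(3) by auto
  then have "card U \<le> card {s. poly (P - [:u:]) s = 0}" by (intro card_mono poly_roots_finite[OF nz])
  also have "\<dots> \<le> degree (P - [:u:])" by (rule card_poly_roots_bound[OF nz])
  also have "\<dots> \<le> degree P" using degree_diff_le[of P "degree P" "[:u:]"] by simp
  finally have "card U \<le> degree P" .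
  moreover have "card U > 0" using assms(1,2) by auto
  ultimately show False using assms(4) by auto
qed

text \<open>\<open>min_C\<close> is the form in which regularity enters: adjoining the constants
  \<open>C\<close> does not lower the degree of \<open>z\<close>. This is what lets automorphisms of
  the compositum be prescribed on \<open>F\<close> and on \<open>L\<close> separately.\<close>

locale twisting =
  fixes K0 K L F :: "'a::alg_closed_field set" and t z :: 'a
  assumes K0: "is_subfield K0" and K: "is_subfield K" and K0K: "K0 \<subseteq> K"
    and GL: "galois_extension K L" and finL: "finite (Gal K L)"
    and t: "(ring.transcendental ambient over K) t"
    and GF: "galois_extension (adjoin K0 {t}) F" and finF: "finite (Gal (adjoin K0 {t}) F)"
    and z: "z \<in> F" "inj_on (\<lambda>\<sigma>. \<sigma> z) (Gal (adjoin K0 {t}) F)"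
    and min_C: "is_min_poly (adjoin (algebraic_closure_of K) {t}) z
       (lin_prod ((\<lambda>\<sigma>. \<sigma> z) ` Gal (adjoin K0 {t}) F))"
begin

abbreviation "k0 \<equiv> adjoin K0 {t}"
abbreviation "C \<equiv> algebraic_closure_of K"
abbreviation "G \<equiv> Gal k0 F"
abbreviation "H \<equiv> Gal K L"
abbreviation "f \<equiv> lin_prod ((\<lambda>\<sigma>. \<sigma> z) ` G)"

definition "M = adjoin L F"

lemma L: "is_subfield L" and KL: "K \<subseteq> L" using GL unfolding galois_extension_iff by auto
lemma F: "is_subfield F" and k0F: "k0 \<subseteq> F" using GF unfolding galois_extension_iff by auto
lemma C: "is_subfield C" by (rule algebraic_closure_is_subfield[OF K])
lemma M: "is_subfield M" unfolding M_def by (rule adjoin_is_subfield)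
lemma LM: "L \<subseteq> M" and FM: "F \<subseteq> M" unfolding M_def by (rule adjoin_base adjoin_gens)+
lemma tF: "t \<in> F" using k0F adjoin_gens[of "{t}" K0] by auto
lemma tC: "(ring.transcendental ambient over C) t" by (rule transcendental_over_closure[OF K t])

lemma LC: "L \<subseteq> C"
proof
  fix x assume "x \<in> L"
  then obtain S where S: "finite S" "x \<in> S" "lin_prod S \<in> polys_over K"
    using GL unfolding galois_extension_iff by blast
  then show "x \<in> C" using separable_elementI(1)[OF K] by (simp add: algebraic_closure_of_def)
qed

lemma tL: "(ring.transcendental ambient over L) t"
  using tC polys_over_mono[OF LC] unfolding transcendental_iff[OF C] transcendental_iff[OF L] by blast

lemma Lt: "is_subfield (adjoin L {t})" "L \<subseteq> adjoin L {t}" "t \<in> adjoin L {t}" "k0 \<subseteq> adjoin L {t}"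
  "adjoin L {t} \<subseteq> M" "adjoin L {t} \<subseteq> adjoin C {t}" "adjoin K {t} \<subseteq> adjoin L {t}"
proof -
  show "is_subfield (adjoin L {t})" "L \<subseteq> adjoin L {t}" by (rule adjoin_is_subfield adjoin_base)+
  show "t \<in> adjoin L {t}" using adjoin_gens[of "{t}" L] by simp
  have "K0 \<subseteq> L" using K0K KL by (rule order_trans)
  from adjoin_mono[OF this order_refl] adjoin_mono[OF KL order_refl]
  show "k0 \<subseteq> adjoin L {t}" "adjoin K {t} \<subseteq> adjoin L {t}" .
  show "adjoin L {t} \<subseteq> adjoin C {t}" using LC by (intro adjoin_mono) auto
  show "adjoin L {t} \<subseteq> M" using tF unfolding M_def by (intro adjoin_mono) auto
qed

lemma F_simple: "F = adjoin k0 {z}" by (rule galois_separating_primitive[OF GF z])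

lemma M_simple: "M = adjoin (adjoin L {t}) {z}"
proof
  show "M \<subseteq> adjoin (adjoin L {t}) {z}"
    unfolding M_def
  proof (rule adjoin_least[OF adjoin_is_subfield])
    show "L \<subseteq> adjoin (adjoin L {t}) {z}" using Lt(2) adjoin_base[of "adjoin L {t}" "{z}"] by simp
    show "F \<subseteq> adjoin (adjoin L {t}) {z}" unfolding F_simple by (rule adjoin_mono[OF Lt(4) order_refl])
  qed
  show "adjoin (adjoin L {t}) {z} \<subseteq> M" using z(1) FM by (intro adjoin_least[OF M Lt(5)]) auto
qed

lemma f_k0: "f \<in> polys_over k0" by (rule galois_orbit_poly(1)[OF GF finF z(1)])

text \<open>L(t) lies between \<open>k0\<close>, which contains the coefficients of
  \<open>f\<close>, and C(t), over which \<open>f\<close> is minimal.\<close>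

lemma min_L: "is_min_poly (adjoin L {t}) z f"
proof (rule is_min_polyI[OF Lt(1)])
  show "f \<in> polys_over (adjoin L {t})" using f_k0 polys_over_mono[OF Lt(4)] by blast
  show "lead_coeff f = 1" "poly f z = 0" using min_C by (auto simp: is_min_poly_def)
  fix p assume p: "p \<in> polys_over (adjoin L {t})" "p \<noteq> 0" "poly p z = 0"
  then obtain q where q: "p = f * q" using min_C polys_over_mono[OF Lt(6)] unfolding is_min_poly_def by blast
  then show "degree f \<le> degree p" using p(2) by (simp add: degree_mult_eq)
qed

lemma degree_f: "degree f = card G"
  using degree_lin_prod[of "(\<lambda>\<sigma>. \<sigma> z) ` G"] card_image[OF z(2)] by simp

text \<open>Extend \<open>g\<close> to L(t) by fixing \<open>t\<close>. This leaves the coefficients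
  of \<open>f\<close> alone, and \<open>f\<close> is still minimal for \<open>z\<close> over L(t),
  so \<open>z\<close> may be sent to any of its roots.\<close>

lemma lift_exists:
  assumes s: "\<sigma> \<in> G" and g: "g \<in> H"
  shows "\<exists>\<tau>. hom_on M \<tau> \<and> (\<forall>x\<in>F. \<tau> x = \<sigma> x) \<and> (\<forall>x\<in>L. \<tau> x = g x)"
proof -
  have gh: "hom_on L g" "g ` L = L" using GalD(3,6)[OF L g] by auto
  have "(ring.transcendental ambient over g ` L) t" using tL gh(2) by simp
  from hom_extend_transcendental[OF L gh(1) tL this] obtain g1 where
    g1: "hom_on (adjoin L {t}) g1" "\<And>P. P \<in> polys_over L \<Longrightarrow> g1 (poly P t) = poly (map_poly g P) t" by blast
  have v1: "\<And>x. x \<in> L \<Longrightarrow> g1 x = g x" "g1 t = t" using hom_extend_values[OF L gh(1) g1(2)] by auto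
  have K0L: "K0 \<subseteq> L" using K0K KL by blast
  have g1K0: "g1 x = x" if "x \<in> K0" for x
    using v1(1)[OF subsetD[OF K0L that]] GalD(4)[OF L g subsetD[OF K0K that]] by simp
  have g1k0: "g1 x = x" if "x \<in> k0" for x
    by (rule hom_eq_adjoin[OF Lt(1) _ _ g1(1) hom_on_id _ _ that]) (use K0L Lt(2,3) g1K0 v1(2) in auto)
  have "map_poly g1 f = f"
    by (rule map_poly_id_on[OF g1k0 f_k0 is_subfield_closed(1)[OF adjoin_is_subfield]])
  then have "poly (map_poly g1 f) (\<sigma> z) = 0"
    using poly_lin_prod[of "(\<lambda>\<sigma>. \<sigma> z) ` G" "\<sigma> z"] finF s by simp
  from hom_extend_algebraic[OF Lt(1) g1(1) min_L this] obtain \<tau> where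
    \<tau>: "hom_on M \<tau>" "\<And>P. P \<in> polys_over (adjoin L {t}) \<Longrightarrow> \<tau> (poly P z) = poly (map_poly g1 P) (\<sigma> z)"
    unfolding M_simple[symmetric] by blast
  have v2: "\<And>x. x \<in> adjoin L {t} \<Longrightarrow> \<tau> x = g1 x" "\<tau> z = \<sigma> z"
    using hom_extend_values[OF Lt(1) g1(1) \<tau>(2)] by auto
  have 1: "\<tau> x = g x" if "x \<in> L" for x using v2(1)[of x] v1(1)[OF that] that Lt(2) by auto
  have \<tau>k0: "\<tau> x = \<sigma> x" if "x \<in> k0" for x
    using v2(1)[of x] g1k0[OF that] that Lt(4) GalD(4)[OF F s that] by auto
  have "\<tau> x = \<sigma> x" if "x \<in> F" for x
  proof (rule hom_eq_adjoin[OF F k0F _ _ GalD(3)[OF F s] \<tau>k0])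
    show "{z} \<subseteq> F" using z(1) by simp
    show "hom_on F \<tau>" by (rule hom_on_mono[OF \<tau>(1) FM])
    show "\<tau> y = \<sigma> y" if "y \<in> {z}" for y using that v2(2) by simp
    show "x \<in> adjoin k0 {z}" using that F_simple by simp
  qed
  then show ?thesis using \<tau>(1) 1 by blast
qed

text \<open>The lifts of all pairs in G \<times> H; restricted to \<open>M\<close> they form the
  Galois group of M over K(t). As total functions they are free outside \<open>M\<close>.\<close>

definition "\<Gamma> = {\<tau>. hom_on M \<tau> \<and> (\<exists>\<sigma>\<in>G. \<forall>x\<in>F. \<tau> x = \<sigma> x) \<and> (\<exists>g\<in>H. \<forall>x\<in>L. \<tau> x = g x)}"

lemma \<Gamma>_hom: "\<tau> \<in> \<Gamma> \<Longrightarrow> hom_on M \<tau>" by (simp add: \<Gamma>_def)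

lemma \<Gamma>_image:
  assumes "\<tau> \<in> \<Gamma>" shows "\<tau> ` M = M"
proof -
  obtain \<sigma> g where s: "\<sigma> \<in> G" "\<And>x. x \<in> F \<Longrightarrow> \<tau> x = \<sigma> x" and g: "g \<in> H" "\<And>x. x \<in> L \<Longrightarrow> \<tau> x = g x"
    using assms unfolding \<Gamma>_def by blast
  have "\<tau> ` F = F" "\<tau> ` L = L" using s(2) g(2) GalD(6)[OF F s(1)] GalD(6)[OF L g(1)] by (simp_all cong: image_cong)
  then show ?thesis using hom_image_adjoin[OF M LM FM \<Gamma>_hom[OF assms]] unfolding M_def by simp
qed

lemma \<Gamma>_compose:
  assumes "\<tau> \<in> \<Gamma>" "\<tau>' \<in> \<Gamma>" shows "(\<lambda>x. \<tau> (\<tau>' x)) \<in> \<Gamma>"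
proof -
  obtain \<sigma> g where s: "\<sigma> \<in> G" "\<And>x. x \<in> F \<Longrightarrow> \<tau> x = \<sigma> x" and g: "g \<in> H" "\<And>x. x \<in> L \<Longrightarrow> \<tau> x = g x"
    using assms(1) unfolding \<Gamma>_def by blast
  obtain \<sigma>' g' where s': "\<sigma>' \<in> G" "\<And>x. x \<in> F \<Longrightarrow> \<tau>' x = \<sigma>' x" and g': "g' \<in> H" "\<And>x. x \<in> L \<Longrightarrow> \<tau>' x = g' x"
    using assms(2) unfolding \<Gamma>_def by blast
  have "hom_on M (\<lambda>x. \<tau> (\<tau>' x))"
    by (rule hom_on_compose[OF \<Gamma>_hom[OF assms(2)] _ \<Gamma>_hom[OF assms(1)]]) (simp add: \<Gamma>_image[OF assms(2)])
  moreover have "\<forall>x\<in>F. \<tau> (\<tau>' x) = compose F \<sigma> \<sigma>' x"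
    using s(2) s'(2) GalD(5)[OF F s'(1)] by (simp add: compose_def)
  moreover have "\<forall>x\<in>L. \<tau> (\<tau>' x) = compose L g g' x"
    using g(2) g'(2) GalD(5)[OF L g'(1)] by (simp add: compose_def)
  ultimately show ?thesis
    unfolding \<Gamma>_def using Gal_compose[OF F k0F s(1) s'(1)] Gal_compose[OF L KL g(1) g'(1)] by blast
qed

lemma \<Gamma>_eq:
  assumes "hom_on M \<tau>" "hom_on M \<tau>'" "\<And>x. x \<in> F \<Longrightarrow> \<tau> x = \<tau>' x" "\<And>x. x \<in> L \<Longrightarrow> \<tau> x = \<tau>' x" "u \<in> M"
  shows "\<tau> u = \<tau>' u"
  using hom_eq_adjoin[OF M LM FM assms(1,2,4,3)] assms(5) unfolding M_def by blast

text \<open>A lift is determined on \<open>M\<close> by its pair, so the orbit is covered by one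
  chosen lift for each of the finitely many pairs.\<close>

lemma \<Gamma>_orbit_finite:
  assumes u: "u \<in> M" shows "finite ((\<lambda>\<tau>. \<tau> u) ` \<Gamma>)"
proof -
  define T :: "('a \<Rightarrow> 'a) \<times> ('a \<Rightarrow> 'a) \<Rightarrow> 'a \<Rightarrow> 'a" where "T = (\<lambda>(\<sigma>, g). SOME \<tau>. hom_on M \<tau> \<and> (\<forall>x\<in>F. \<tau> x = \<sigma> x) \<and> (\<forall>x\<in>L. \<tau> x = g x))"
  have T: "hom_on M (T (\<sigma>, g)) \<and> (\<forall>x\<in>F. T (\<sigma>, g) x = \<sigma> x) \<and> (\<forall>x\<in>L. T (\<sigma>, g) x = g x)"
    if "\<sigma> \<in> G" "g \<in> H" for \<sigma> g
    unfolding T_def prod.case using someI_ex[OF lift_exists[OF that]] .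
  have "(\<lambda>\<tau>. \<tau> u) ` \<Gamma> \<subseteq> (\<lambda>p. T p u) ` (G \<times> H)"
  proof
    fix y assume "y \<in> (\<lambda>\<tau>. \<tau> u) ` \<Gamma>"
    then obtain \<tau> where \<tau>: "\<tau> \<in> \<Gamma>" "y = \<tau> u" by blast
    obtain \<sigma> g where s: "\<sigma> \<in> G" "\<And>x. x \<in> F \<Longrightarrow> \<tau> x = \<sigma> x" and g: "g \<in> H" "\<And>x. x \<in> L \<Longrightarrow> \<tau> x = g x"
      using \<tau>(1) unfolding \<Gamma>_def by blast
    have "\<tau> u = T (\<sigma>, g) u"
      by (rule \<Gamma>_eq[OF \<Gamma>_hom[OF \<tau>(1)] _ _ _ u]) (use T[OF s(1) g(1)] s(2) g(2) in auto)
    then show "y \<in> (\<lambda>p. T p u) ` (G \<times> H)" using \<tau>(2) s(1) g(1) by auto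
  qed
  then show ?thesis using finF finL finite_subset by blast
qed

text \<open>Lifts of (\<sigma>, id) fix L(t) and move \<open>z\<close> over all roots of
  \<open>f\<close>, which forces \<open>u\<close> into L(t): a polynomial of small degree with one
  value at all conjugates is constant. Lifts of (id, g) then force \<open>u\<close> into K(t) in the
  same way, with a primitive element of \<open>L\<close> over \<open>K\<close>, which an infinite
  \<open>K\<close> provides.\<close>

lemma \<Gamma>_fixed:
  assumes inf: "infinite K" and u: "u \<in> M" "\<And>\<tau>. \<tau> \<in> \<Gamma> \<Longrightarrow> \<tau> u = u"
  shows "u \<in> adjoin K {t}"
proof -
  have idG: "(\<lambda>x\<in>F. x) \<in> G" and idH: "(\<lambda>x\<in>L. x) \<in> H" by (rule Gal_id[OF F k0F] Gal_id[OF L KL])+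
  have "u \<in> adjoin L {t}"
  proof -
    obtain P where P: "P \<in> polys_over (adjoin L {t})" "P = 0 \<or> degree P < degree f" "u = poly P z"
      using u(1) unfolding M_simple adjoin_algebraic[OF Lt(1) min_L] by blast
    have "P = [:u:]"
    proof (rule constant_poly_of_values[of "(\<lambda>\<sigma>. \<sigma> z) ` G"])
      show "finite ((\<lambda>\<sigma>. \<sigma> z) ` G)" using finF by simp
      show "(\<lambda>\<sigma>. \<sigma> z) ` G \<noteq> {}" using idG by blast
      show "P = 0 \<or> degree P < card ((\<lambda>\<sigma>. \<sigma> z) ` G)" using P(2) degree_lin_prod[of "(\<lambda>\<sigma>. \<sigma> z) ` G"] by simp
      fix y assume "y \<in> (\<lambda>\<sigma>. \<sigma> z) ` G"
      then obtain \<sigma> where s: "\<sigma> \<in> G" "y = \<sigma> z" by blast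
      obtain \<tau> where \<tau>: "hom_on M \<tau>" "\<And>x. x \<in> F \<Longrightarrow> \<tau> x = \<sigma> x" "\<And>x. x \<in> L \<Longrightarrow> \<tau> x = x"
        using lift_exists[OF s(1) idH] by auto
      have "\<exists>g\<in>H. \<forall>x\<in>L. \<tau> x = g x" using idH \<tau>(3) by (intro bexI[of _ "\<lambda>x\<in>L. x"]) auto
      then have \<tau>\<Gamma>: "\<tau> \<in> \<Gamma>" unfolding \<Gamma>_def using \<tau>(1,2) s(1) by blast
      have tt: "\<tau> t = t" using \<tau>(2)[OF tF] GalD(4)[OF F s(1), of t] adjoin_gens[of "{t}" K0] by auto
      have "\<tau> x = x" if "x \<in> adjoin L {t}" for x
        by (rule hom_eq_adjoin[OF M LM _ \<tau>(1) hom_on_id \<tau>(3) _ that]) (use tF FM tt in auto)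
      then have "map_poly \<tau> P = P" by (rule map_poly_id_on[OF _ P(1) is_subfield_closed(1)[OF Lt(1)]])
      moreover have "P \<in> polys_over M" using P(1) polys_over_mono[OF Lt(5)] by blast
      ultimately have "poly P (\<tau> z) = \<tau> u" using map_poly_hom(2)[OF M \<tau>(1) _, of P z] z(1) FM P(3) by auto
      then show "poly P y = u" using u(2)[OF \<tau>\<Gamma>] \<tau>(2)[OF z(1)] s(2) by simp
    qed
    then show ?thesis using polys_overD[OF P(1), of 0] by simp
  qed
  obtain w where w: "w \<in> L" "inj_on (\<lambda>\<sigma>. \<sigma> w) H" using galois_separating_element[OF GL finL inf] by blast
  have Lw: "L = adjoin K {w}" by (rule galois_separating_primitive[OF GL w])
  let ?k = "adjoin K {t}" and ?U = "(\<lambda>\<sigma>. \<sigma> w) ` H"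
  have k: "is_subfield ?k" "K \<subseteq> ?k" "t \<in> ?k"
    using adjoin_gens[of "{t}" K] by (simp_all add: adjoin_is_subfield adjoin_base)
  have "adjoin L {t} \<subseteq> adjoin ?k {w}"
  proof (rule adjoin_least[OF adjoin_is_subfield])
    show "L \<subseteq> adjoin ?k {w}" by (subst Lw) (intro adjoin_mono k order_refl)
    show "{t} \<subseteq> adjoin ?k {w}" using k(3) adjoin_base[of ?k "{w}"] by blast
  qed
  then have uw: "u \<in> adjoin ?k {w}" using \<open>u \<in> adjoin L {t}\<close> by blast
  have mem: "lin_prod ?U \<in> polys_over ?k"
    using galois_orbit_poly(1)[OF GL finL w(1)] polys_over_mono[OF k(2)] by blast
  have wU: "w \<in> ?U" using idH w(1) by (intro rev_image_eqI[of "\<lambda>x\<in>L. x"]) auto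
  have Ufin: "finite ?U" using finL by simp
  have root: "poly (lin_prod ?U) w = 0" using poly_lin_prod[OF Ufin] wU by blast
  obtain m where m: "is_min_poly ?k w m" using is_min_poly_exists[OF k(1), of w] mem root lin_prod_nz by blast
  have "degree m \<le> card ?U"
  proof -
    obtain q where q: "lin_prod ?U = m * q" using m mem root unfolding is_min_poly_def by blast
    then show ?thesis using lin_prod_nz[of ?U] degree_lin_prod[of ?U] by (auto simp: degree_mult_eq)
  qed
  then obtain Q where Q: "Q \<in> polys_over ?k" "Q = 0 \<or> degree Q < card ?U" "u = poly Q w"
    using uw unfolding adjoin_algebraic[OF k(1) m] by fastforce
  have kM: "?k \<subseteq> M" using Lt(5,7) by blast
  have "Q = [:u:]"
  proof (rule constant_poly_of_values[of ?U])
    show "finite ?U" "?U \<noteq> {}" using Ufin wU by auto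
    show "Q = 0 \<or> degree Q < card ?U" by (rule Q(2))
    fix y assume "y \<in> ?U"
    then obtain g where g: "g \<in> H" "y = g w" by blast
    obtain \<tau> where \<tau>: "hom_on M \<tau>" "\<And>x. x \<in> F \<Longrightarrow> \<tau> x = x" "\<And>x. x \<in> L \<Longrightarrow> \<tau> x = g x"
      using lift_exists[OF idG g(1)] by auto
    have "\<exists>\<sigma>\<in>G. \<forall>x\<in>F. \<tau> x = \<sigma> x" using idG \<tau>(2) by (intro bexI[of _ "\<lambda>x\<in>F. x"]) auto
    then have \<tau>\<Gamma>: "\<tau> \<in> \<Gamma>" unfolding \<Gamma>_def using \<tau>(1,3) g(1) by blast
    have \<tau>K: "\<tau> x = x" if "x \<in> K" for x using \<tau>(3)[of x] KL that GalD(4)[OF L g(1) that] by auto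
    have KM: "K \<subseteq> M" using KL LM by blast
    have "\<tau> x = x" if "x \<in> ?k" for x
      by (rule hom_eq_adjoin[OF M KM _ \<tau>(1) hom_on_id \<tau>K _ that]) (use tF FM \<tau>(2)[OF tF] in auto)
    then have "map_poly \<tau> Q = Q" by (rule map_poly_id_on[OF _ Q(1) is_subfield_closed(1)[OF k(1)]])
    moreover have "Q \<in> polys_over M" using Q(1) polys_over_mono[OF kM] by blast
    ultimately have "poly Q (\<tau> w) = \<tau> u" using map_poly_hom(2)[OF M \<tau>(1) _, of Q w] w(1) LM Q(3) by auto
    then show "poly Q y = u" using u(2)[OF \<tau>\<Gamma>] \<tau>(3)[OF w(1)] g(2) by simp
  qed
  then show ?thesis using polys_overD[OF Q(1), of 0] by simp
qed

text \<open>The orbit of \<open>u\<close> is invariant under \<open>\<Gamma>\<close>, so the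
  coefficients of its product lie in the fixed field K(t).\<close>

lemma M_separable:
  assumes inf: "infinite K" and u: "u \<in> M"
  shows "\<exists>S. finite S \<and> u \<in> S \<and> lin_prod S \<in> polys_over (adjoin K {t})"
proof (intro exI conjI)
  let ?U = "(\<lambda>\<tau>. \<tau> u) ` \<Gamma>"
  show "finite ?U" by (rule \<Gamma>_orbit_finite[OF u])
  have "(\<lambda>x. x) \<in> \<Gamma>"
    unfolding \<Gamma>_def
  proof (intro CollectI conjI hom_on_id)
    show "\<exists>\<sigma>\<in>G. \<forall>x\<in>F. x = \<sigma> x" by (rule bexI[OF _ Gal_id[OF F k0F]]) simp
    show "\<exists>g\<in>H. \<forall>x\<in>L. x = g x" by (rule bexI[OF _ Gal_id[OF L KL]]) simp
  qed
  then show "u \<in> ?U" by (rule rev_image_eqI) simp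
  show "lin_prod ?U \<in> polys_over (adjoin K {t})"
  proof (rule invariant_lin_prod[OF M \<Gamma>_hom _ _ _ \<Gamma>_fixed[OF inf]])
    show "finite ?U" by (rule \<Gamma>_orbit_finite[OF u])
    show "?U \<subseteq> M" using \<Gamma>_image u by blast
    fix \<tau> assume \<tau>: "\<tau> \<in> \<Gamma>"
    show "\<tau> ` ?U \<subseteq> ?U"
    proof
      fix y assume "y \<in> \<tau> ` ?U"
      then obtain \<tau>' where "\<tau>' \<in> \<Gamma>" "y = \<tau> (\<tau>' u)" by blast
      then show "y \<in> ?U" using \<Gamma>_compose[OF \<tau>, of \<tau>'] by (intro rev_image_eqI[of "\<lambda>x. \<tau> (\<tau>' x)"]) auto
    qed
  qed
qed

text \<open>Disjointness from \<open>C\<close> is obtained over L(t) and then passed to the simple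
  extension by \<open>z\<close>, where \<open>min_C\<close> is used.\<close>

lemma M_disjoint: "disjoint_over L C M"
  unfolding M_simple
proof (rule disjoint_over_simple[OF Lt(1,6) adjoin_is_subfield _ min_L min_C])
  show "C \<subseteq> adjoin C {t}" by (rule adjoin_base)
  show "disjoint_over L C (adjoin L {t})" by (rule disjoint_over_rational[OF L C LC tC])
qed

end

section \<open>Specialisation\<close>

text \<open>\<open>R\<close> is a ring and not assumed to be a field, for on a field
  \<open>\<phi>\<close> would be injective. An inverse specialises to the inverse only if it belongs
  to \<open>R\<close>, so the inverses that matter are made available through the coordinates.
  Negation comes from -1 in \<open>C\<close>.\<close>

locale specialisation =
  fixes C R :: "'a::field set" and \<phi> :: "'a \<Rightarrow> 'a"
  assumes C: "is_subfield C" and CR: "C \<subseteq> R" and \<phi>C: "c \<in> C \<Longrightarrow> \<phi> c = c"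
    and add: "a \<in> R \<Longrightarrow> b \<in> R \<Longrightarrow> a + b \<in> R" "a \<in> R \<Longrightarrow> b \<in> R \<Longrightarrow> \<phi> (a + b) = \<phi> a + \<phi> b"
    and mult: "a \<in> R \<Longrightarrow> b \<in> R \<Longrightarrow> a * b \<in> R" "a \<in> R \<Longrightarrow> b \<in> R \<Longrightarrow> \<phi> (a * b) = \<phi> a * \<phi> b"
begin

lemma zero: "0 \<in> R" "\<phi> 0 = 0" and one: "1 \<in> R" "\<phi> 1 = 1"
  using CR \<phi>C is_subfield_closed(1,2)[OF C] by auto

lemma sum_closed: "(\<And>i. i \<in> A \<Longrightarrow> u i \<in> R) \<Longrightarrow> sum u A \<in> R \<and> \<phi> (sum u A) = (\<Sum>i\<in>A. \<phi> (u i))"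
  by (induction A rule: infinite_finite_induct) (simp_all add: zero add)

lemma poly_closed:
  assumes "p \<in> polys_over C" "a \<in> R"
  shows "poly p a \<in> R \<and> \<phi> (poly p a) = poly p (\<phi> a)"
  using assms(1)
proof (induction p)
  case 0
  then show ?case by (simp add: zero)
next
  case (pCons c p)
  have c: "c \<in> C" using polys_overD[OF pCons.prems, of 0] by simp
  have "p \<in> polys_over C"
    by (rule polys_overI) (use polys_overD[OF pCons.prems, of "Suc _"] in simp)
  then have "poly p a \<in> R \<and> \<phi> (poly p a) = poly p (\<phi> a)" by (rule pCons.IH)
  then show ?case using c CR assms(2) \<phi>C[OF c] by (auto simp: add mult)
qed

lemma poly2_closed:
  assumes "Q \<in> polys2_over C" "t \<in> R" "v \<in> R"
  shows "poly (specialise Q t) v \<in> R \<and> \<phi> (poly (specialise Q t) v) = poly (specialise Q (\<phi> t)) (\<phi> v)"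
  using assms(1)
proof (induction Q)
  case 0
  then show ?case by (simp add: zero specialise_0)
next
  case (pCons q Q)
  have "q \<in> polys_over C" using polys_overD[OF pCons.prems, of 0] by simp
  then have q: "poly q t \<in> R \<and> \<phi> (poly q t) = poly q (\<phi> t)" by (rule poly_closed[OF _ assms(2)])
  have "Q \<in> polys2_over C"
    by (rule polys_overI) (use polys_overD[OF pCons.prems, of "Suc _"] in simp)
  then have "poly (specialise Q t) v \<in> R \<and> \<phi> (poly (specialise Q t) v) = poly (specialise Q (\<phi> t)) (\<phi> v)"
    by (rule pCons.IH)
  then show ?case using q assms(3) by (simp add: specialise_pCons add mult)
qed

lemma inverse_value:
  assumes "a \<in> R" "inverse a \<in> R" "a \<noteq> 0"
  shows "\<phi> a \<noteq> 0" "\<phi> (inverse a) = inverse (\<phi> a)"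
proof -
  have "\<phi> a * \<phi> (inverse a) = 1" using mult(2)[OF assms(1,2)] assms(3) one by simp
  then show "\<phi> a \<noteq> 0" "\<phi> (inverse a) = inverse (\<phi> a)" by (auto simp: inverse_unique)
qed

end

lemma pac_specialisation_exists:
  fixes K0 K E :: "'a::alg_closed_field set"
  assumes pac: "pac_in_domain K0 K" and K: "is_subfield K" and E: "is_subfield E" "K \<subseteq> E"
    and t: "(ring.transcendental ambient over K) t" "t \<in> E"
    and Y: "finite Y" "Y \<subseteq> E"
    and sep: "\<And>u. u \<in> E \<Longrightarrow> \<exists>S. finite S \<and> u \<in> S \<and> lin_prod S \<in> polys_over (adjoin K {t})"
    and ld: "disjoint_over K (algebraic_closure_of K) E"
  shows "\<exists>R \<phi>. specialisation (algebraic_closure_of K) R \<phi> \<and> t \<in> R \<and> Y \<subseteq> R \<and> \<phi> ` Y \<subseteq> K \<and> \<phi> t \<in> K0"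
proof -
  let ?C = "algebraic_closure_of K"
  have "\<exists>R \<phi>. ?C \<subseteq> R \<and> t \<in> R \<and> Y \<subseteq> R \<and>
     (\<forall>a\<in>R. \<forall>b\<in>R. a + b \<in> R \<and> a * b \<in> R \<and> \<phi> (a + b) = \<phi> a + \<phi> b \<and> \<phi> (a * b) = \<phi> a * \<phi> b) \<and>
     (\<forall>c\<in>?C. \<phi> c = c) \<and> \<phi> ` Y \<subseteq> K \<and> \<phi> t \<in> K0"
  proof (rule pac_specialisation[OF pac K E t Y sep])
    fix J :: "nat set" and e v
    assume "finite J" "e ` J \<subseteq> ?C" "indep K J e" "v ` J \<subseteq> E" "(\<Sum>j\<in>J. e j * v j) = 0"
    then show "\<forall>j\<in>J. v j = 0" using ld unfolding disjoint_over_def by (elim allE impE) assumption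
  qed
  then obtain R \<phi> where *: "?C \<subseteq> R \<and> t \<in> R \<and> Y \<subseteq> R \<and>
     (\<forall>a\<in>R. \<forall>b\<in>R. a + b \<in> R \<and> a * b \<in> R \<and> \<phi> (a + b) = \<phi> a + \<phi> b \<and> \<phi> (a * b) = \<phi> a * \<phi> b) \<and>
     (\<forall>c\<in>?C. \<phi> c = c) \<and> \<phi> ` Y \<subseteq> K \<and> \<phi> t \<in> K0" by (elim exE)
  have "specialisation ?C R \<phi>"
    by (rule specialisation.intro[OF algebraic_closure_is_subfield[OF K]]) (use * in blast)+
  then show ?thesis using * by blast
qed

text \<open>If \<open>K\<close> were finite, PAC for K(t) with the coordinates \<open>t\<close> and
  the inverse of the product of all t - c would give a point whose \<open>t\<close>-coordinate lies
  in \<open>K0\<close> but differs from every element of \<open>K\<close>.\<close>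

lemma pac_infinite:
  fixes K0 K :: "'a::alg_closed_field set"
  assumes pac: "pac_in_domain K0 K" and K: "is_subfield K" and K0K: "K0 \<subseteq> K"
    and t: "(ring.transcendental ambient over K) t"
  shows "infinite K"
proof
  assume fin: "finite K"
  let ?C = "algebraic_closure_of K" and ?E = "adjoin K {t}" and ?y = "inverse (poly (lin_prod K) t)"
  have C: "is_subfield ?C" "K \<subseteq> ?C"
    by (rule algebraic_closure_is_subfield[OF K] algebraic_closure_base[OF K])+
  have tC: "(ring.transcendental ambient over ?C) t" by (rule transcendental_over_closure[OF K t])
  have lp: "lin_prod K \<in> polys_over K" by (intro polys_over_closed[OF K] is_subfield_closed[OF K])
  have E: "is_subfield ?E" "K \<subseteq> ?E" "t \<in> ?E"
    using adjoin_gens[of "{t}" K] by (simp_all add: adjoin_is_subfield adjoin_base)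
  have yE: "{?y} \<subseteq> ?E" using is_subfield_closed(7)[OF E(1) poly_mem_adjoin[OF lp]] by simp
  have sep: "\<exists>S. finite S \<and> u \<in> S \<and> lin_prod S \<in> polys_over ?E" if "u \<in> ?E" for u
    using that polys_over_closed(1,8)[OF E(1)] is_subfield_closed(2,5)[OF E(1)]
    by (intro exI[of _ "{u}"]) simp
  obtain R \<phi> where sp: "specialisation ?C R \<phi>" and R: "t \<in> R" "{?y} \<subseteq> R" "\<phi> t \<in> K0"
    using pac_specialisation_exists[OF pac K E(1,2) t E(3) _ yE sep disjoint_over_rational[OF K C tC]] by auto
  interpret sp: specialisation ?C R \<phi> by (rule sp)
  have lpC: "lin_prod K \<in> polys_over ?C" using lp polys_over_mono[OF C(2)] by blast
  have "poly (lin_prod K) t \<noteq> 0" using tC lpC lin_prod_nz[of K] unfolding transcendental_iff[OF C(1)] by blast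
  then have "\<phi> (poly (lin_prod K) t) \<noteq> 0"
    using sp.inverse_value(1)[of "poly (lin_prod K) t"] sp.poly_closed[OF lpC R(1)] R(2) by auto
  moreover have "\<phi> (poly (lin_prod K) t) = poly (lin_prod K) (\<phi> t)" using sp.poly_closed[OF lpC R(1)] by blast
  moreover have "poly (lin_prod K) (\<phi> t) = 0" using poly_lin_prod[OF fin, of "\<phi> t"] R(3) K0K by blast
  ultimately show False by simp
qed

lemma monic_eq_lin_prod:
  fixes p :: "'a::idom poly"
  assumes "finite S" "lead_coeff p = 1" "degree p = card S" "\<And>s. s \<in> S \<Longrightarrow> poly p s = 0"
  shows "p = lin_prod S"
proof (rule ccontr)
  assume "p \<noteq> lin_prod S"
  then have nz: "p - lin_prod S \<noteq> 0" by simp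
  have S0: "card S > 0"
  proof (rule ccontr)
    assume "\<not> card S > 0"
    then have "S = {}" using assms(1) by simp
    moreover have "p = 1" using assms(2,3) \<open>\<not> card S > 0\<close> by (metis degree_eq_zeroE lead_coeff_pCons(2) one_pCons gr0I)
    ultimately show False using nz by simp
  qed
  have "S \<subseteq> {s. poly (p - lin_prod S) s = 0}" using assms(1,4) poly_lin_prod[OF assms(1)] by auto
  then have "card S \<le> card {s. poly (p - lin_prod S) s = 0}" by (intro card_mono poly_roots_finite[OF nz])
  also have "\<dots> \<le> degree (p - lin_prod S)" by (rule card_poly_roots_bound[OF nz])
  finally have 1: "card S \<le> degree (p - lin_prod S)" .
  have "degree (p - lin_prod S) \<le> card S"
    using degree_diff_le[of p "card S" "lin_prod S"] assms(3) degree_lin_prod[of S] by simp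
  then have "coeff (p - lin_prod S) (card S) \<noteq> 0" using 1 nz by (metis leading_coeff_0_iff le_antisym)
  moreover have "coeff (p - lin_prod S) (card S) = 0"
    using assms(2,3) lead_coeff_lin_prod[of S] degree_lin_prod[of S] by simp
  ultimately show False by simp
qed

text \<open>The coordinates of the generic point are \<open>t\<close>, the twisted traces \<open>y j\<close> and the inverse of a polynomial
  \<open>D\<close> in \<open>t\<close> that avoids the places where \<open>z\<close> has a bad reduction.\<close>

lemma (in twisting) descent:
  assumes pac: "pac_in_domain K0 K"
    and \<psi>: "\<psi> \<in> hom (galois_group K L) (galois_group k0 F)" "inj_on \<psi> H"
    and f0: "f0 \<in> polys2_over K0" "lead_coeff f0 = 1" "specialise f0 t = f"
  shows "\<exists>L0 \<chi>. galois_extension K0 L0 \<and> L0 \<subseteq> L \<and> L = adjoin L0 K \<and>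
     \<chi> \<in> hom (galois_group K0 L0) (galois_group k0 F) \<and> inj_on \<chi> (Gal K0 L0)"
proof -

  \<comment> \<open>The action of Gal(L/K) on M twisted by \<psi>\<close>
  have inf: "infinite K" by (rule pac_infinite[OF pac K K0K t])
  have k0: "is_subfield k0" "K0 \<subseteq> k0" "t \<in> k0"
    using adjoin_gens[of "{t}" K0] by (simp_all add: adjoin_is_subfield adjoin_base)
  interpret GrH: group "galois_group K L" by (rule galois_group_group[OF L KL])
  interpret GrG: group "galois_group k0 F" by (rule galois_group_group[OF F k0F])
  have \<psi>G: "\<psi> h \<in> G" if "h \<in> H" for h using \<psi>(1) that by (auto simp: hom_def)
  have \<psi>mult: "\<psi> (compose L h g) x = \<psi> h (\<psi> g x)" if "h \<in> H" "g \<in> H" "x \<in> F" for h g x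
  proof -
    have "\<psi> (h \<otimes>\<^bsub>galois_group K L\<^esub> g) = \<psi> h \<otimes>\<^bsub>galois_group k0 F\<^esub> \<psi> g"
      using \<psi>(1) that(1,2) by (simp add: hom_def)
    then have "\<psi> (compose L h g) = compose F (\<psi> h) (\<psi> g)"
      using Gal_mult[OF L that(1,2)] Gal_mult[OF F \<psi>G[OF that(1)] \<psi>G[OF that(2)]] by simp
    then show ?thesis using that(3) by (simp add: compose_def)
  qed
  have idH: "(\<lambda>x\<in>L. x) \<in> H" and idG: "(\<lambda>x\<in>F. x) \<in> G" by (rule Gal_id[OF L KL] Gal_id[OF F k0F])+
  have \<psi>id: "\<psi> (\<lambda>x\<in>L. x) = (\<lambda>x\<in>F. x)"
    using hom_one[OF \<psi>(1) GrH.is_group GrG.is_group] by (simp add: Gal_one)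
  have "\<forall>h\<in>H. \<exists>\<tau>. hom_on M \<tau> \<and> (\<forall>x\<in>F. \<tau> x = \<psi> h x) \<and> (\<forall>x\<in>L. \<tau> x = h x)"
    using lift_exists[OF \<psi>G] by blast
  then obtain \<delta> where \<delta>0: "\<forall>h\<in>H. hom_on M (\<delta> h) \<and> (\<forall>x\<in>F. \<delta> h x = \<psi> h x) \<and> (\<forall>x\<in>L. \<delta> h x = h x)"
    using bchoice[of H "\<lambda>h \<tau>. hom_on M \<tau> \<and> (\<forall>x\<in>F. \<tau> x = \<psi> h x) \<and> (\<forall>x\<in>L. \<tau> x = h x)"] by blast
  have \<delta>: "hom_on M (\<delta> h)" and \<delta>F: "\<And>x. x \<in> F \<Longrightarrow> \<delta> h x = \<psi> h x" and \<delta>L: "\<And>x. x \<in> L \<Longrightarrow> \<delta> h x = h x"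
    if "h \<in> H" for h using \<delta>0 that by auto

  \<comment> \<open>The fixed field of the twisted action\<close>
  define E where "E = {u \<in> M. \<forall>h\<in>H. \<delta> h u = u}"
  note cM = is_subfield_closed[OF M]
  have E: "is_subfield E"
    by (rule is_subfieldI) (simp_all add: E_def cM hom_on_simps[OF M \<delta>])
  have KE: "K \<subseteq> E" using KL LM \<delta>L GalD(4)[OF L] by (auto simp: E_def)
  have tE: "t \<in> E" using tF FM \<delta>F \<psi>G GalD(4)[OF F _ k0(3)] by (auto simp: E_def)
  have sep: "\<exists>S. finite S \<and> u \<in> S \<and> lin_prod S \<in> polys_over (adjoin K {t})" if "u \<in> E" for u
    using M_separable[OF inf] that by (simp add: E_def)
  \<comment> \<open>For elements of \<open>E\<close>, independence passes from \<open>K\<close> to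
    \<open>L\<close> by their invariance under the lifts \<open>\<delta> h\<close>, and from
    \<open>L\<close> to \<open>C\<close> by the disjointness of \<open>C\<close> and
    \<open>M\<close> over \<open>L\<close>.\<close>
  have ld: "disjoint_over K C E"
  proof (rule disjoint_over_from_indep[OF K C])
    show "K \<subseteq> C" using KL LC by blast
    fix I :: "nat set" and b assume I: "finite I" "b ` I \<subseteq> E" "indep K I b"
    have bE: "b i \<in> M" "\<And>h. h \<in> H \<Longrightarrow> \<delta> h (b i) = b i" if "i \<in> I" for i using I(2) that by (auto simp: E_def)
    have "indep L I b" by (rule indep_descent[OF GL M LM \<delta> \<delta>L I(1) bE I(3)])
    then show "indep C I b"
      using disjoint_over_indep[OF L M LM M_disjoint I(1)] bE(1) by (simp add: image_subset_iff)
  qed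

  \<comment> \<open>Twisted traces and interpolation\<close>
  obtain w where w: "w \<in> L" "inj_on (\<lambda>\<sigma>. \<sigma> w) H" using galois_separating_element[OF GL finL inf] by blast
  define n where "n = card H"
  \<comment> \<open>This is the sum over g of \<open>\<delta> g\<close> applied to z w^j. The
    exponents below n, the degree of \<open>L\<close> over \<open>K\<close>, are enough to recover
    \<open>z\<close>.\<close>
  define y where "y j = (\<Sum>g\<in>H. \<psi> g z * g w ^ j)" for j :: nat
  have \<psi>z: "\<psi> g z \<in> F" if "g \<in> H" for g using GalD(5)[OF F \<psi>G[OF that] z(1)] .
  have gw: "g w \<in> L" if "g \<in> H" for g using GalD(5)[OF L that w(1)] .
  have ymem: "y j \<in> E" for j
  proof -
    have mem: "\<psi> g z \<in> M" "g w \<in> M" "g w ^ j \<in> M" "\<psi> g z * g w ^ j \<in> M" if "g \<in> H" for g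
    proof -
      show 1: "\<psi> g z \<in> M" "g w \<in> M" using \<psi>z[OF that] gw[OF that] LM FM by auto
      show 2: "g w ^ j \<in> M" by (rule cM(9)[OF 1(2)])
      show "\<psi> g z * g w ^ j \<in> M" by (rule cM(4)[OF 1(1) 2])
    qed
    have "\<delta> h (y j) = y j" if h: "h \<in> H" for h
    proof -
      note s = hom_on_simps[OF M \<delta>[OF h]]
      have "\<delta> h (y j) = (\<Sum>g\<in>H. \<delta> h (\<psi> g z * g w ^ j))" unfolding y_def by (rule s(10)[OF mem(4)])
      also have "\<dots> = (\<Sum>g\<in>H. \<psi> (compose L h g) z * compose L h g w ^ j)"
      proof (rule sum.cong[OF refl])
        fix g assume g: "g \<in> H"
        show "\<delta> h (\<psi> g z * g w ^ j) = \<psi> (compose L h g) z * compose L h g w ^ j"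
          using s(4)[OF mem(1,3)[OF g]] s(9)[OF mem(2)[OF g], of j] \<delta>F[OF h \<psi>z[OF g]] \<delta>L[OF h gw[OF g]]
            \<psi>mult[OF h g z(1)] w(1) by (simp add: compose_def)
      qed
      also have "\<dots> = (\<Sum>g\<in>(\<lambda>g. compose L h g) ` H. \<psi> g z * g w ^ j)"
      proof (rule sum.reindex_cong[symmetric, OF _ refl refl])
        show "inj_on (compose L h) H"
          using GrH.inj_on_cmult[OF h] Gal_mult[OF L h] by (simp add: inj_on_def)
      qed
      also have "(\<lambda>g. compose L h g) ` H = H"
        using GrH.surj_const_mult[OF h] Gal_mult[OF L h] by (simp cong: image_cong)
      finally show ?thesis by (simp add: y_def)
    qed
    moreover have "y j \<in> M" unfolding y_def by (rule cM(10)[OF mem(4)])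
    ultimately show ?thesis by (simp add: E_def)
  qed
  define H' where "H' = H - {\<lambda>x\<in>L. x}"
  \<comment> \<open>The Lagrange polynomial with value 1 at \<open>w\<close> and 0 at its other
    conjugates.\<close>
  define \<l> where "\<l> = (\<Prod>g\<in>H'. smult (inverse (w - g w)) [:- g w, 1:])"
  have \<l>L: "\<l> \<in> polys_over L"
    unfolding \<l>_def using gw w(1) is_subfield_closed(2,5,6,7)[OF L]
    by (intro polys_over_closed(1,7,8,11)[OF L]) (auto simp: H'_def)
  have val: "poly \<l> (g w) = (if g = (\<lambda>x\<in>L. x) then 1 else 0)" if g: "g \<in> H" for g
  proof (cases "g = (\<lambda>x\<in>L. x)")
    case True
    have ne: "w - g' w \<noteq> 0" if "g' \<in> H'" for g'
    proof
      assume "w - g' w = 0"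
      then have "(\<lambda>x\<in>L. x) w = g' w" using w(1) by simp
      then show False using inj_onD[OF w(2) _ idH, of g'] that by (auto simp: H'_def)
    qed
    have "poly \<l> w = (\<Prod>g'\<in>H'. inverse (w - g' w) * (w - g' w))" by (simp add: \<l>_def poly_prod algebra_simps)
    also have "\<dots> = 1" using ne by (intro prod.neutral) simp
    finally show ?thesis using True w(1) by simp
  next
    case False
    then have "g \<in> H'" using g by (simp add: H'_def)
    then show ?thesis using False finL by (auto simp: \<l>_def poly_prod H'_def intro!: prod_zero)
  qed
  have deg\<l>: "degree \<l> < n"
  proof -
    have "degree \<l> \<le> (\<Sum>g\<in>H'. degree (smult (inverse (w - g w)) [:- g w, 1:]))"
      unfolding \<l>_def using degree_prod_sum_le[of H' "\<lambda>g. smult (inverse (w - g w)) [:- g w, 1:]"] finL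
      by (simp add: H'_def o_def del: degree_smult_eq)
    also have "\<dots> \<le> (\<Sum>g\<in>H'. 1)" by (intro sum_mono) (auto intro: order_trans[OF degree_smult_le])
    also have "\<dots> < n" using card_Diff1_less[OF finL idH] by (simp add: H'_def n_def)
    finally show ?thesis .
  qed
  \<comment> \<open>Interchanging the sums turns the right side into the sum of \<psi>(g)(z) times
    the value of the Lagrange polynomial at g(w); only the identity survives.\<close>
  have z_sum: "z = (\<Sum>j<n. coeff \<l> j * y j)"
  proof -
    have "(\<Sum>j<n. coeff \<l> j * y j) = (\<Sum>j<n. \<Sum>g\<in>H. \<psi> g z * (coeff \<l> j * g w ^ j))"
      unfolding y_def sum_distrib_left by (simp add: mult.left_commute)
    also have "\<dots> = (\<Sum>g\<in>H. \<Sum>j<n. \<psi> g z * (coeff \<l> j * g w ^ j))" by (rule sum.swap)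
    also have "\<dots> = (\<Sum>g\<in>H. \<psi> g z * poly \<l> (g w))"
    proof (rule sum.cong[OF refl])
      fix g assume "g \<in> H"
      have "poly \<l> (g w) = (\<Sum>j<n. coeff \<l> j * g w ^ j)"
        unfolding poly_altdef using deg\<l> by (intro sum.mono_neutral_left) (auto simp: coeff_eq_0)
      then show "(\<Sum>j<n. \<psi> g z * (coeff \<l> j * g w ^ j)) = \<psi> g z * poly \<l> (g w)" by (simp add: sum_distrib_left)
    qed
    also have "\<dots> = (\<Sum>g\<in>H. if g = (\<lambda>x\<in>L. x) then z else 0)"
      using val \<psi>id z(1) by (intro sum.cong) auto
    also have "\<dots> = z" using idH finL by simp
    finally show ?thesis by simp
  qed

  \<comment> \<open>A common denominator for conjugates and inverse differences\<close>
  define T where "T = (\<lambda>\<sigma>. \<sigma> z) ` G \<union> (\<lambda>(\<sigma>, \<sigma>'). inverse (\<sigma> z - \<sigma>' z)) ` (G \<times> G)"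
  have \<sigma>z: "\<sigma> z \<in> F" if "\<sigma> \<in> G" for \<sigma> using GalD(5)[OF F that z(1)] .
  have T: "finite T" "T \<subseteq> F"
    unfolding T_def using finF \<sigma>z is_subfield_closed(6,7)[OF F] by auto
  have minF: "is_min_poly k0 z f" by (rule galois_orbit_poly(2)[OF GF finF z(1)])
  have tK0: "(ring.transcendental ambient over K0) t"
    using t polys_over_mono[OF K0K] unfolding transcendental_iff[OF K] transcendental_iff[OF K0] by blast
  have tne: "poly q t \<noteq> 0" if "q \<in> polys_over K0" "q \<noteq> 0" for q
    using tK0 that unfolding transcendental_iff[OF K0] by blast
  \<comment> \<open>An element of F = k0(z) is a polynomial in \<open>z\<close> over K0[t] divided
    by a polynomial in \<open>t\<close> alone, and the denominators are multiplied up. The inverse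
    differences in \<open>T\<close> will keep distinct conjugates of \<open>z\<close> distinct under
    specialisation.\<close>
  have "\<exists>D\<in>polys_over K0. D \<noteq> 0 \<and> (\<forall>u\<in>T. \<exists>Q\<in>polys2_over K0. u = poly (specialise Q t) z * inverse (poly D t))"
    using T
  proof (induction T rule: finite_induct)
    case empty
    show ?case using polys_over_closed(2)[OF K0] by (intro bexI[of _ 1]) auto
  next
    case (insert u T)
    have u: "u \<in> F" and TF: "T \<subseteq> F" using insert.prems by auto
    obtain D where D: "D \<in> polys_over K0" "D \<noteq> 0"
      "\<And>u. u \<in> T \<Longrightarrow> \<exists>Q\<in>polys2_over K0. u = poly (specialise Q t) z * inverse (poly D t)"
      using insert.IH[OF TF] by blast
    have "u \<in> adjoin k0 {z}" using u F_simple by (rule subst[rotated])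
    then obtain P where P: "P \<in> polys_over k0" "u = poly P z"
      unfolding adjoin_algebraic[OF k0(1) minF] by blast
    obtain q Q where q: "q \<in> polys_over K0" "Q \<in> polys2_over K0" "q \<noteq> 0" "specialise Q t = smult (poly q t) P"
      using clear_denominators[OF K0 tK0 P(1)] by blast
    have Dq: "D * q \<in> polys_over K0" "D * q \<noteq> 0" using D q polys_over_closed(4)[OF K0] by auto
    have ne: "poly D t \<noteq> 0" "poly q t \<noteq> 0" using tne D q by auto
    have "\<exists>Q\<in>polys2_over K0. v = poly (specialise Q t) z * inverse (poly (D * q) t)" if v: "v \<in> insert u T" for v
    proof (cases "v = u")
      case True
      have "poly (specialise (smult D Q) t) z * inverse (poly (D * q) t) = u"
        using ne by (simp add: specialise_smult q(4) P(2) field_simps)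
      then show ?thesis using polys2_over_closed(4)[OF K0 D(1) q(2)] True by metis
    next
      case False
      then obtain Q' where Q': "Q' \<in> polys2_over K0" "v = poly (specialise Q' t) z * inverse (poly D t)"
        using v D(3) by blast
      have "poly (specialise (smult q Q') t) z * inverse (poly (D * q) t) = v"
        using ne by (simp add: specialise_smult Q'(2) field_simps)
      then show ?thesis using polys2_over_closed(4)[OF K0 q(1) Q'(1)] by metis
    qed
    then show ?case using Dq by blast
  qed
  then obtain D where D: "D \<in> polys_over K0" "D \<noteq> 0"
    "\<And>u. u \<in> T \<Longrightarrow> \<exists>Q\<in>polys2_over K0. u = poly (specialise Q t) z * inverse (poly D t)" by blast

  \<comment> \<open>The specialised conjugates of z\<close>
  define i where "i = inverse (poly D t)"
  have ik0: "i \<in> k0" unfolding i_def by (rule is_subfield_closed(7)[OF k0(1) poly_mem_adjoin[OF D(1)]])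
  have k0E: "k0 \<subseteq> E" using K0K KE tE by (intro adjoin_least[OF E]) auto
  \<comment> \<open>\<open>t\<close> is not listed: \<open>pac_specialisation\<close> puts it in
    front.\<close>
  define Y where "Y = insert i (y ` {..<n})"
  have Y: "finite Y" "Y \<subseteq> E" unfolding Y_def using ymem ik0 k0E by auto
  obtain R \<phi> where sp: "specialisation C R \<phi>" and R: "t \<in> R" "Y \<subseteq> R" "\<phi> ` Y \<subseteq> K" "\<phi> t \<in> K0"
    using pac_specialisation_exists[OF pac K E KE t tE Y sep ld] by blast
  interpret sp: specialisation C R \<phi> by (rule sp)
  define a where "a = \<phi> t"
  have aK0: "a \<in> K0" using R(4) by (simp add: a_def)
  have K0C: "K0 \<subseteq> C" using K0K KL LC by blast
  have yR: "y j \<in> R" "\<phi> (y j) \<in> K" if "j < n" for j using R(2,3) that by (auto simp: Y_def)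
  have iR: "i \<in> R" using R(2) by (simp add: Y_def)
  have DC: "D \<in> polys_over C" using D(1) polys_over_mono[OF K0C] by blast
  have "\<phi> i = inverse (\<phi> (poly D t))"
    using sp.inverse_value(2)[of "poly D t"] sp.poly_closed[OF DC R(1)] iR tne[OF D(1,2)] by (simp add: i_def)
  then have "\<phi> i = inverse (poly D a)" using sp.poly_closed[OF DC R(1)] by (simp add: a_def)
  then have \<phi>iK0: "\<phi> i \<in> K0"
    using is_subfield_closed(7)[OF K0 poly_mem_subfield[OF K0 D(1) aK0]] by simp
  have \<l>C: "coeff \<l> j \<in> C" "coeff \<l> j \<in> R" for j using polys_overD[OF \<l>L, of j] LC sp.CR by auto
  have combR: "(\<Sum>j<n. c j * y j) \<in> R \<and> \<phi> (\<Sum>j<n. c j * y j) = (\<Sum>j<n. c j * \<phi> (y j))"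
    if c: "\<And>j. c j \<in> C" for c
  proof -
    have m: "c j * y j \<in> R" "\<phi> (c j * y j) = c j * \<phi> (y j)" if "j < n" for j
      using sp.mult[of "c j" "y j"] sp.CR c[of j] yR(1)[OF that] sp.\<phi>C[OF c[of j]] by auto
    then show ?thesis using sp.sum_closed[of "{..<n}" "\<lambda>j. c j * y j"] by simp
  qed
  define \<beta> where "\<beta> = \<phi> z"
  have zR: "z \<in> R" and \<beta>_sum: "\<beta> = (\<Sum>j<n. coeff \<l> j * \<phi> (y j))"
    using combR[of "coeff \<l>", OF \<l>C(1)] unfolding \<beta>_def z_sum[symmetric] by auto
  have \<beta>L: "\<beta> \<in> L"
    unfolding \<beta>_sum using polys_overD[OF \<l>L] yR(2) KL by (intro is_subfield_closed(4,10)[OF L]) auto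
  have K0C2: "Q \<in> polys2_over C" if "Q \<in> polys2_over K0" for Q
    using that polys_over_mono[OF polys_over_mono[OF K0C]] by blast
  have ev: "poly (specialise Q t) v \<in> R" "\<phi> (poly (specialise Q t) v) = poly (specialise Q a) (\<phi> v)"
    if "Q \<in> polys2_over K0" "v \<in> R" for Q v
    using sp.poly2_closed[OF K0C2[OF that(1)] R(1) that(2)] by (auto simp: a_def)
  have rep: "\<exists>Q\<in>polys2_over K0. u = poly (specialise Q t) z * i" if "u \<in> T" for u using D(3)[OF that] by (simp add: i_def)
  have TR: "u \<in> R" if "u \<in> T" for u
    using rep[OF that] ev(1)[OF _ zR] iR sp.mult(1) by blast
  have GT: "\<sigma> z \<in> T" if "\<sigma> \<in> G" for \<sigma> using that by (simp add: T_def)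
  have \<sigma>zR: "\<sigma> z \<in> R" if "\<sigma> \<in> G" for \<sigma> by (rule TR[OF GT[OF that]])
  \<comment> \<open>The equation j (\<sigma>(z) - \<sigma>'(z)) = 1 between elements of
    \<open>R\<close> would specialise to 0 = 1.\<close>
  have \<phi>inj: "\<sigma> = \<sigma>'" if s: "\<sigma> \<in> G" "\<sigma>' \<in> G" and eq: "\<phi> (\<sigma> z) = \<phi> (\<sigma>' z)" for \<sigma> \<sigma>'
  proof (rule ccontr)
    assume "\<sigma> \<noteq> \<sigma>'"
    then have ne: "\<sigma> z - \<sigma>' z \<noteq> 0" using inj_onD[OF z(2) _ s] by auto
    define j where "j = inverse (\<sigma> z - \<sigma>' z)"
    have "j \<in> T" using s by (auto simp: T_def j_def)
    then have jR: "j \<in> R" by (rule TR)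
    have "j * \<sigma> z = 1 + j * \<sigma>' z" using ne by (simp add: j_def field_simps)
    then have "\<phi> j * \<phi> (\<sigma> z) = 1 + \<phi> j * \<phi> (\<sigma>' z)"
      using sp.mult[OF jR \<sigma>zR[OF s(1)]] sp.mult[OF jR \<sigma>zR[OF s(2)]] sp.add(2)[OF sp.one(1)] sp.one(2) by metis
    then show False using eq by simp
  qed
  define S where "S = (\<lambda>\<sigma>. \<phi> (\<sigma> z)) ` G"
  have "inj_on (\<lambda>\<sigma>. \<phi> (\<sigma> z)) G" by (rule inj_onI) (rule \<phi>inj)
  then have S: "finite S" "card S = card G" unfolding S_def using finF by (auto simp: card_image)
  \<comment> \<open>The images of the conjugates of \<open>z\<close> are as many distinct roots of
    the reduced polynomial as its degree.\<close>
  have fa: "specialise f0 a = lin_prod S"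
  proof (rule monic_eq_lin_prod[OF S(1)])
    show "lead_coeff (specialise f0 a) = 1" using monic_specialise[OF f0(2)] by blast
    have "degree (specialise f0 a) = degree f0" "degree f = degree f0"
      using monic_specialise[OF f0(2), of a] monic_specialise[OF f0(2), of t] f0(3) by auto
    then show "degree (specialise f0 a) = card S" using degree_f S(2) by simp
    fix s assume "s \<in> S"
    then obtain \<sigma> where s: "\<sigma> \<in> G" "s = \<phi> (\<sigma> z)" by (auto simp: S_def)
    have "poly f (\<sigma> z) = 0" using poly_lin_prod[of "(\<lambda>\<sigma>. \<sigma> z) ` G" "\<sigma> z"] finF s(1) by simp
    then show "poly (specialise f0 a) s = 0"
      using ev(2)[OF f0(1) \<sigma>zR[OF s(1)]] s(2) f0(3) sp.zero(2) by simp
  qed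

  \<comment> \<open>The residue field L0\<close>
  define L0 where "L0 = adjoin K0 {\<beta>}"
  have L0: "is_subfield L0" "K0 \<subseteq> L0" "\<beta> \<in> L0"
    using adjoin_gens[of "{\<beta>}" K0] by (simp_all add: L0_def adjoin_is_subfield adjoin_base)
  have \<phi>T: "\<phi> (poly (specialise Q t) v * i) = poly (specialise Q a) (\<phi> v) * \<phi> i"
    if "Q \<in> polys2_over K0" "v \<in> R" for Q v
    using sp.mult(2)[OF ev(1)[OF that] iR] ev(2)[OF that] by simp
  \<comment> \<open>Each conjugate of \<open>z\<close> is Q(t, z) / D(t) with \<open>Q\<close> over
    \<open>K0\<close>, so its image is Q(a, \<beta>) / D(a).\<close>
  have SL0: "S \<subseteq> L0"
  proof
    fix s assume "s \<in> S"
    then obtain \<sigma> where s: "\<sigma> \<in> G" "s = \<phi> (\<sigma> z)" by (auto simp: S_def)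
    obtain Q where Q: "Q \<in> polys2_over K0" "\<sigma> z = poly (specialise Q t) z * i" using rep[OF GT[OF s(1)]] by blast
    have "s = poly (specialise Q a) \<beta> * \<phi> i" unfolding s(2) Q(2) \<phi>T[OF Q(1) zR] \<beta>_def ..
    moreover have "poly (specialise Q a) \<beta> \<in> L0"
      unfolding L0_def by (rule poly_mem_adjoin[OF specialise_mem_base[OF K0 Q(1) aK0]])
    ultimately show "s \<in> L0" using is_subfield_closed(4)[OF L0(1)] \<phi>iK0 L0(2) by auto
  qed
  have \<beta>S: "\<beta> \<in> S" unfolding S_def \<beta>_def using idG z(1) by (intro rev_image_eqI[of "\<lambda>x\<in>F. x"]) auto
  have faK0: "lin_prod S \<in> polys_over K0" using specialise_mem_base[OF K0 f0(1) aK0] fa by simp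
  have GL0: "galois_extension K0 L0"
    unfolding L0_def by (rule galois_simple_extension[OF K0 S(1) \<beta>S faK0 SL0[unfolded L0_def]])
  have L0L: "L0 \<subseteq> L" unfolding L0_def using K0K KL \<beta>L by (intro adjoin_least[OF L]) auto
  \<comment> \<open>The lift \<open>\<delta> h\<close> acts on the interpolation formula for
    \<open>z\<close> through \<open>h\<close> on the coefficients and fixes the \<open>y j\<close>.
    After specialisation the values of the \<open>y j\<close> lie in \<open>K\<close>, so
    \<open>h\<close> can be drawn out of the sum.\<close>
  have h\<beta>: "h \<beta> = \<phi> (\<psi> h z)" if h: "h \<in> H" for h
  proof -
    note sL = hom_on_simps[OF L GalD(3)[OF L h]] and sM = hom_on_simps[OF M \<delta>[OF h]]
    have \<l>j: "coeff \<l> j \<in> L" "coeff \<l> j \<in> M" "h (coeff \<l> j) \<in> C" for j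
      using polys_overD[OF \<l>L, of j] LM LC GalD(5)[OF L h polys_overD[OF \<l>L, of j]] by auto
    have yM: "y j \<in> M" "\<delta> h (y j) = y j" for j using ymem[of j] h by (auto simp: E_def)
    have \<phi>yL: "\<phi> (y j) \<in> L" if "j < n" for j using yR(2)[OF that] KL by blast
    have "\<psi> h z = \<delta> h z" using \<delta>F[OF h z(1)] by simp
    also have "\<dots> = \<delta> h (\<Sum>j<n. coeff \<l> j * y j)" using z_sum by simp
    also have "\<dots> = (\<Sum>j<n. \<delta> h (coeff \<l> j * y j))"
      by (rule sM(10)) (rule cM(4)[OF \<l>j(2) yM(1)])
    also have "\<dots> = (\<Sum>j<n. h (coeff \<l> j) * y j)"
      using sM(4)[OF \<l>j(2) yM(1)] yM(2) \<delta>L[OF h \<l>j(1)] by simp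
    finally have "\<phi> (\<psi> h z) = (\<Sum>j<n. h (coeff \<l> j) * \<phi> (y j))"
      using combR[of "\<lambda>j. h (coeff \<l> j)", OF \<l>j(3)] by simp
    also have "\<dots> = (\<Sum>j<n. h (coeff \<l> j * \<phi> (y j)))"
    proof (rule sum.cong[OF refl])
      fix j assume "j \<in> {..<n}"
      then have j: "j < n" by simp
      show "h (coeff \<l> j) * \<phi> (y j) = h (coeff \<l> j * \<phi> (y j))"
        using sL(4)[OF \<l>j(1) \<phi>yL[OF j]] GalD(4)[OF L h yR(2)[OF j]] by simp
    qed
    also have "\<dots> = h \<beta>"
      unfolding \<beta>_sum using \<phi>yL \<l>j(1) is_subfield_closed(4)[OF L] by (intro sL(10)[symmetric]) auto
    finally show ?thesis by simp
  qed
  \<comment> \<open>Injectivity of \<open>\<psi>\<close> enters here: specialisation keeps the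
    conjugates of \<open>z\<close> apart, so no nontrivial \<open>h\<close> fixes \<beta>, and
    \<beta> generates \<open>L\<close> over \<open>K\<close>.\<close>
  have "inj_on (\<lambda>h. h \<beta>) H"
  proof (rule inj_onI)
    fix h g assume hg: "h \<in> H" "g \<in> H" "h \<beta> = g \<beta>"
    have "\<phi> (\<psi> h z) = \<phi> (\<psi> g z)" using h\<beta>[OF hg(1)] h\<beta>[OF hg(2)] hg(3) by simp
    then have "\<psi> h = \<psi> g" by (rule \<phi>inj[OF \<psi>G[OF hg(1)] \<psi>G[OF hg(2)]])
    then show "h = g" using inj_onD[OF \<psi>(2)] hg by blast
  qed
  then have L\<beta>: "L = adjoin K {\<beta>}" by (rule galois_separating_primitive[OF GL \<beta>L])
  have LL0K: "L = adjoin L0 K"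
  proof
    show "L \<subseteq> adjoin L0 K"
      unfolding L\<beta> using adjoin_gens[of K L0] adjoin_base[of L0 K] L0(3)
      by (intro adjoin_least[OF adjoin_is_subfield]) auto
    show "adjoin L0 K \<subseteq> L" by (rule adjoin_least[OF L L0L KL])
  qed

  \<comment> \<open>The embedding of Gal(L0/K0)\<close>
  have exs: "\<exists>\<sigma>\<in>G. \<tau> \<beta> = \<phi> (\<sigma> z)" if \<tau>: "\<tau> \<in> Gal K0 L0" for \<tau>
  proof -
    have "\<tau> ` S = S"
      by (rule hom_maps_roots[OF L0(1) GalD(3)[OF L0(1) \<tau>] S(1) SL0])
         (rule GalD(4)[OF L0(1) \<tau> polys_overD[OF faK0]])
    then have "\<tau> \<beta> \<in> S" using \<beta>S by blast
    then show ?thesis by (auto simp: S_def)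
  qed
  then have "\<forall>\<tau>\<in>Gal K0 L0. \<exists>\<sigma>. \<sigma> \<in> G \<and> \<tau> \<beta> = \<phi> (\<sigma> z)" by blast
  then obtain \<chi> where \<chi>0: "\<forall>\<tau>\<in>Gal K0 L0. \<chi> \<tau> \<in> G \<and> \<tau> \<beta> = \<phi> (\<chi> \<tau> z)"
    using bchoice[of "Gal K0 L0" "\<lambda>\<tau> \<sigma>. \<sigma> \<in> G \<and> \<tau> \<beta> = \<phi> (\<sigma> z)"] by blast
  have \<chi>: "\<chi> \<tau> \<in> G" "\<tau> \<beta> = \<phi> (\<chi> \<tau> z)" if "\<tau> \<in> Gal K0 L0" for \<tau> using \<chi>0 that by auto
  \<comment> \<open>One formula Q over \<open>K0\<close> expresses \<rho>(z) through
    \<open>z\<close> and its image through \<beta>. As \<open>\<chi> \<tau>\<close> moves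
    \<open>z\<close> in the way \<tau> moves \<beta>, the two actions agree on all conjugates, which
    makes \<open>\<chi>\<close> multiplicative.\<close>
  have eqv: "\<tau> (\<phi> (\<rho> z)) = \<phi> (\<chi> \<tau> (\<rho> z))" if \<tau>: "\<tau> \<in> Gal K0 L0" and \<rho>: "\<rho> \<in> G" for \<tau> \<rho>
  proof -
    obtain Q where Q: "Q \<in> polys2_over K0" "\<rho> z = poly (specialise Q t) z * i" using rep[OF GT[OF \<rho>]] by blast
    let ?\<sigma> = "\<chi> \<tau>"
    have s: "?\<sigma> \<in> G" by (rule \<chi>(1)[OF \<tau>])
    note sF = hom_on_simps[OF F GalD(3)[OF F s]] and sL0 = hom_on_simps[OF L0(1) GalD(3)[OF L0(1) \<tau>]]
    have Qk0: "specialise Q t \<in> polys_over k0" by (rule specialise_mem[OF Q(1)])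
    have QF: "specialise Q t \<in> polys_over F" using Qk0 polys_over_mono[OF k0F] by blast
    have "map_poly ?\<sigma> (specialise Q t) = specialise Q t"
      by (rule map_poly_id_on[OF _ Qk0 is_subfield_closed(1)[OF k0(1)]]) (rule GalD(4)[OF F s])
    then have 1: "?\<sigma> (poly (specialise Q t) z) = poly (specialise Q t) (?\<sigma> z)"
      using map_poly_hom(2)[OF F GalD(3)[OF F s] QF z(1)] by simp
    have "?\<sigma> (\<rho> z) = ?\<sigma> (poly (specialise Q t) z) * ?\<sigma> i"
      unfolding Q(2) using poly_mem_subfield[OF F QF z(1)] ik0 k0F by (intro sF(4)) auto
    then have "?\<sigma> (\<rho> z) = poly (specialise Q t) (?\<sigma> z) * i" using 1 GalD(4)[OF F s ik0] by simp
    then have A: "\<phi> (?\<sigma> (\<rho> z)) = poly (specialise Q a) (\<tau> \<beta>) * \<phi> i"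
      using \<phi>T[OF Q(1) \<sigma>zR[OF s]] \<chi>(2)[OF \<tau>] by simp
    have QK0: "specialise Q a \<in> polys_over K0" by (rule specialise_mem_base[OF K0 Q(1) aK0])
    have QL0: "specialise Q a \<in> polys_over L0" using QK0 polys_over_mono[OF L0(2)] by blast
    have "map_poly \<tau> (specialise Q a) = specialise Q a"
      by (rule map_poly_id_on[OF _ QK0 is_subfield_closed(1)[OF K0]]) (rule GalD(4)[OF L0(1) \<tau>])
    then have 2: "\<tau> (poly (specialise Q a) \<beta>) = poly (specialise Q a) (\<tau> \<beta>)"
      using map_poly_hom(2)[OF L0(1) GalD(3)[OF L0(1) \<tau>] QL0 L0(3)] by simp
    have "\<tau> (\<phi> (\<rho> z)) = \<tau> (poly (specialise Q a) \<beta> * \<phi> i)" unfolding Q(2) \<phi>T[OF Q(1) zR] \<beta>_def ..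
    also have "\<dots> = \<tau> (poly (specialise Q a) \<beta>) * \<tau> (\<phi> i)"
      using poly_mem_subfield[OF L0(1) QL0 L0(3)] \<phi>iK0 L0(2) by (intro sL0(4)) auto
    finally show ?thesis using A 2 GalD(4)[OF L0(1) \<tau> \<phi>iK0] by simp
  qed
  have "\<chi> \<in> hom (galois_group K0 L0) (galois_group k0 F)"
  proof (rule homI)
    fix \<tau> \<tau>' assume \<tau>: "\<tau> \<in> Gal K0 L0" "\<tau>' \<in> Gal K0 L0"
    have c: "compose L0 \<tau> \<tau>' \<in> Gal K0 L0" by (rule Gal_compose[OF L0(1,2) \<tau>])
    have c': "compose F (\<chi> \<tau>) (\<chi> \<tau>') \<in> G" by (rule Gal_compose[OF F k0F \<chi>(1)[OF \<tau>(1)] \<chi>(1)[OF \<tau>(2)]])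
    have "\<phi> (\<chi> (compose L0 \<tau> \<tau>') z) = compose L0 \<tau> \<tau>' \<beta>" using \<chi>(2)[OF c] by simp
    also have "\<dots> = \<tau> (\<phi> (\<chi> \<tau>' z))" using \<chi>(2)[OF \<tau>(2)] L0(3) by (simp add: compose_def)
    also have "\<dots> = \<phi> (\<chi> \<tau> (\<chi> \<tau>' z))" by (rule eqv[OF \<tau>(1) \<chi>(1)[OF \<tau>(2)]])
    also have "\<dots> = \<phi> (compose F (\<chi> \<tau>) (\<chi> \<tau>') z)" using z(1) by (simp add: compose_def)
    finally have "\<chi> (compose L0 \<tau> \<tau>') = compose F (\<chi> \<tau>) (\<chi> \<tau>')" by (rule \<phi>inj[OF \<chi>(1)[OF c] c'])
    then show "\<chi> (\<tau> \<otimes>\<^bsub>galois_group K0 L0\<^esub> \<tau>') = \<chi> \<tau> \<otimes>\<^bsub>galois_group k0 F\<^esub> \<chi> \<tau>'"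
      by (simp add: Gal_mult[OF L0(1) \<tau>] Gal_mult[OF F \<chi>(1)[OF \<tau>(1)] \<chi>(1)[OF \<tau>(2)]])
  qed (rule \<chi>(1))
  moreover have "inj_on \<chi> (Gal K0 L0)"
  proof (rule inj_onI)
    fix \<tau> \<tau>' assume \<tau>: "\<tau> \<in> Gal K0 L0" "\<tau>' \<in> Gal K0 L0" "\<chi> \<tau> = \<chi> \<tau>'"
    have eq: "\<tau> \<beta> = \<tau>' \<beta>" using \<chi>(2)[OF \<tau>(1)] \<chi>(2)[OF \<tau>(2)] \<tau>(3) by simp
    have "\<tau> x = \<tau>' x" if "x \<in> L0" for x
    proof (rule hom_eq_adjoin[OF L0(1,2) _ GalD(3)[OF L0(1) \<tau>(1)] GalD(3)[OF L0(1) \<tau>(2)]])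
      show "{\<beta>} \<subseteq> L0" using L0(3) by simp
      show "\<tau> x = \<tau>' x" if "x \<in> K0" for x using GalD(4)[OF L0(1) \<tau>(1) that] GalD(4)[OF L0(1) \<tau>(2) that] by simp
      show "\<tau> x = \<tau>' x" if "x \<in> {\<beta>}" for x using that eq by simp
      show "x \<in> adjoin K0 {\<beta>}" using that by (simp add: L0_def)
    qed
    then show "\<tau> = \<tau>'" by (rule Gal_eqI[OF L0(1) \<tau>(1,2)])
  qed
  ultimately show ?thesis using GL0 L0L LL0K by blast
qed

section \<open>Descent along a PAC extension\<close>

lemma algebraic_closure_mono:
  assumes "is_subfield K0" "is_subfield K" "K0 \<subseteq> K"
  shows "algebraic_closure_of K0 \<subseteq> algebraic_closure_of K"
proof
  fix x assume "x \<in> algebraic_closure_of K0"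
  then obtain p where "p \<in> polys_over K0" "p \<noteq> 0" "poly p x = 0"
    using algebraic_iff[OF assms(1), of x] by (auto simp: algebraic_closure_of_def)
  then have "(ring.algebraic ambient over K) x"
    using algebraic_iff[OF assms(2), of x] polys_over_mono[OF assms(3)] by blast
  then show "x \<in> algebraic_closure_of K" by (simp add: algebraic_closure_of_def)
qed

lemma infinite_adjoin_transcendental:
  assumes K: "is_subfield K" and t: "(ring.transcendental ambient over K) t"
  shows "infinite (adjoin K {t})"
proof -
  have "inj (\<lambda>i::nat. t ^ i)"
  proof (rule injI)
    fix i j :: nat assume eq: "t ^ i = t ^ j"
    let ?p = "monom 1 i - monom 1 j :: 'a poly"
    have "?p \<in> polys_over K" by (intro polys_over_closed[OF K] is_subfield_closed[OF K])
    moreover have "poly ?p t = 0" using eq by (simp add: poly_monom)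
    ultimately have "?p = 0" using t unfolding transcendental_iff[OF K] by blast
    then have "coeff (monom 1 i) i = coeff (monom (1 :: 'a) j) i" by simp
    then show "i = j" by (simp split: if_splits)
  qed
  then have "infinite (range (\<lambda>i::nat. t ^ i))" by (rule range_inj_infinite)
  moreover have "range (\<lambda>i::nat. t ^ i) \<subseteq> adjoin K {t}"
    using adjoin_gens[of "{t}" K] is_subfield_closed(9)[OF adjoin_is_subfield, of t K "{t}"] by auto
  ultimately show ?thesis using finite_subset by blast
qed

text \<open>Clearing denominators: if \<open>d = q(t)\<close> clears the denominators of the minimal polynomial of \<open>z0\<close>,
  then the minimal polynomial of \<open>d z0\<close> has coefficients in \<open>K[t]\<close>.\<close>

lemma integral_separating_element:
  assumes K: "is_subfield K" and t: "(ring.transcendental ambient over K) t"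
    and GF: "galois_extension (adjoin K {t}) F" and fin: "finite (Gal (adjoin K {t}) F)"
  shows "\<exists>z f. z \<in> F \<and> inj_on (\<lambda>\<sigma>. \<sigma> z) (Gal (adjoin K {t}) F) \<and> f \<in> polys2_over K \<and> lead_coeff f = 1 \<and>
     specialise f t = lin_prod ((\<lambda>\<sigma>. \<sigma> z) ` Gal (adjoin K {t}) F)"
proof -
  let ?k = "adjoin K {t}"
  let ?G = "Gal ?k F"
  have F: "is_subfield F" "?k \<subseteq> F" and k: "is_subfield ?k" using GF unfolding galois_extension_iff by auto
  obtain z0 where z0: "z0 \<in> F" "inj_on (\<lambda>\<sigma>. \<sigma> z0) ?G"
    using galois_separating_element[OF GF fin infinite_adjoin_transcendental[OF K t]] by blast
  define p0 where "p0 = lin_prod ((\<lambda>\<sigma>. \<sigma> z0) ` ?G)"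
  have p0: "p0 \<in> polys_over ?k" unfolding p0_def by (rule galois_orbit_poly(1)[OF GF fin z0(1)])
  have min0: "is_min_poly ?k z0 p0" unfolding p0_def by (rule galois_orbit_poly(2)[OF GF fin z0(1)])
  define n where "n = card ?G"
  have deg0: "degree p0 = n" unfolding p0_def degree_lin_prod n_def by (rule card_image[OF z0(2)])
  have lc0: "coeff p0 n = 1" using min0 deg0 by (simp add: is_min_poly_def)
  obtain q P where q: "q \<in> polys_over K" "P \<in> polys2_over K" "q \<noteq> 0" "specialise P t = smult (poly q t) p0"
    using clear_denominators[OF K t p0] by blast
  define d where "d = poly q t"
  have d0: "d \<noteq> 0" using t q(1,3) unfolding transcendental_iff[OF K] d_def by blast
  have dk: "d \<in> ?k" unfolding d_def by (rule poly_mem_adjoin[OF q(1)])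
  define z where "z = d * z0"
  have zF: "z \<in> F" unfolding z_def using dk F(2) z0(1) is_subfield_closed(4)[OF F(1)] by blast
  have \<sigma>z: "\<sigma> z = d * \<sigma> z0" if s: "\<sigma> \<in> ?G" for \<sigma>
    using hom_on_simps(4)[OF F(1) GalD(3)[OF F(1) s], of d z0] dk F(2) z0(1) GalD(4)[OF F(1) s dk]
    by (auto simp: z_def)
  have inj: "inj_on (\<lambda>\<sigma>. \<sigma> z) ?G"
  proof (rule inj_onI)
    fix \<sigma> \<tau> assume s: "\<sigma> \<in> ?G" "\<tau> \<in> ?G" "\<sigma> z = \<tau> z"
    then have "\<sigma> z0 = \<tau> z0" using \<sigma>z[OF s(1)] \<sigma>z[OF s(2)] d0 by simp
    then show "\<sigma> = \<tau>" using inj_onD[OF z0(2)] s by blast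
  qed
  \<comment> \<open>This is d^n p0(X / d) with d = q(t), whose coefficient at X^i is d^(n - i) times
    that of \<open>p0\<close>. For i < n one factor d turns the coefficient of \<open>p0\<close>
    into the value of \<open>coeff P i\<close> at \<open>t\<close>, which leaves the exponent n - 1
    - i.\<close>
  define f where "f = monom 1 n + (\<Sum>i<n. monom (q ^ (n - 1 - i) * coeff P i) i)"
  have cf: "coeff f i = (if i = n then 1 else if i < n then q ^ (n - 1 - i) * coeff P i else 0)" for i
  proof -
    have "(\<Sum>j<n. coeff (monom (q ^ (n - 1 - j) * coeff P j) j) i) = (if i < n then q ^ (n - 1 - i) * coeff P i else 0)"
      unfolding coeff_monom by (simp add: sum.delta)
    then show ?thesis by (simp add: f_def coeff_sum)
  qed
  have "f \<in> polys2_over K"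
    by (rule polys_overI) (auto simp: cf intro!: polys_over_closed[OF K] polys_overD[OF q(2)] q(1))
  moreover have degf: "degree f = n"
    by (rule antisym) (auto intro!: degree_le le_degree simp: cf)
  then have lcf: "lead_coeff f = 1" by (simp add: cf)
  moreover have "specialise f t = lin_prod ((\<lambda>\<sigma>. \<sigma> z) ` ?G)"
  proof (rule monic_eq_lin_prod)
    show "finite ((\<lambda>\<sigma>. \<sigma> z) ` ?G)" using fin by simp
    show "lead_coeff (specialise f t) = 1" using monic_specialise[OF lcf] by blast
    show "degree (specialise f t) = card ((\<lambda>\<sigma>. \<sigma> z) ` ?G)"
      using monic_specialise[OF lcf, of t] degf card_image[OF inj] by (simp add: n_def)
    fix s assume "s \<in> (\<lambda>\<sigma>. \<sigma> z) ` ?G"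
    then obtain \<sigma> where s: "\<sigma> \<in> ?G" "s = d * \<sigma> z0" using \<sigma>z by auto
    have ci: "coeff (specialise f t) i = d ^ (n - i) * coeff p0 i" if "i \<le> n" for i
    proof (cases "i = n")
      case True
      then show ?thesis by (simp add: coeff_specialise cf lc0)
    next
      case False
      then have i: "i < n" using that by simp
      then have "n - i = Suc (n - 1 - i)" by simp
      then have "d ^ (n - i) * coeff p0 i = d ^ (n - 1 - i) * (d * coeff p0 i)" by simp
      also have "d * coeff p0 i = poly (coeff P i) t"
        using arg_cong[OF q(4), of "\<lambda>r. coeff r i"] by (simp add: coeff_specialise d_def)
      finally show ?thesis using i by (simp add: coeff_specialise cf d_def)
    qed
    have "poly (specialise f t) s = (\<Sum>i\<le>n. coeff (specialise f t) i * s ^ i)"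
      using monic_specialise[OF lcf, of t] degf by (simp add: poly_altdef)
    also have "\<dots> = (\<Sum>i\<le>n. d ^ n * (coeff p0 i * \<sigma> z0 ^ i))"
    proof (rule sum.cong[OF refl])
      fix i assume "i \<in> {..n}"
      then have i: "i \<le> n" by simp
      have "d ^ n = d ^ (n - i) * d ^ i" using i by (simp flip: power_add)
      then show "coeff (specialise f t) i * s ^ i = d ^ n * (coeff p0 i * \<sigma> z0 ^ i)"
        using ci[OF i] s(2) by (simp add: power_mult_distrib)
    qed
    also have "\<dots> = d ^ n * poly p0 (\<sigma> z0)" by (simp add: poly_altdef deg0 sum_distrib_left)
    also have "poly p0 (\<sigma> z0) = 0"
      unfolding p0_def using poly_lin_prod[of "(\<lambda>\<sigma>. \<sigma> z0) ` ?G" "\<sigma> z0"] fin s(1) by simp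
    finally show "poly (specialise f t) s = 0" by simp
  qed
  ultimately show ?thesis using zF inj by blast
qed

text \<open>The minimal polynomial of \<open>z\<close> persists from K0(t) to the constants
  algebraic over \<open>K0\<close> by linear disjointness, and from there to C(t) by specialising
  \<open>t\<close> to constants; this supplies \<open>min_C\<close>.\<close>

lemma pac_descent:
  fixes K0 K L :: "'a::alg_closed_field set"
  assumes K0: "is_subfield K0" and K: "is_subfield K" and K0K: "K0 \<subseteq> K" and pac: "pac_in_domain K0 K"
    and GL: "galois_extension K L" and finL: "finite (Gal K L)"
    and t: "(ring.transcendental ambient over K) t"
    and GF: "galois_extension (adjoin K0 {t}) F" and finF: "finite (Gal (adjoin K0 {t}) F)"
    and ld: "\<And>(I :: (nat \<times> nat) set) v. finite I \<Longrightarrow> v ` I \<subseteq> F \<Longrightarrow> indep K0 I v \<Longrightarrow>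
       indep (algebraic_closure_of K0) I v"
    and \<psi>: "\<psi> \<in> hom (galois_group K L) (galois_group (adjoin K0 {t}) F)" "inj_on \<psi> (Gal K L)"
  shows "\<exists>L0 \<chi>. galois_extension K0 L0 \<and> L0 \<subseteq> L \<and> L = adjoin L0 K \<and>
     \<chi> \<in> hom (galois_group K0 L0) (galois_group (adjoin K0 {t}) F) \<and> inj_on \<chi> (Gal K0 L0)"
proof -
  let ?k0 = "adjoin K0 {t}" and ?CC = "algebraic_closure_of K0" and ?C = "algebraic_closure_of K"
  have tK0: "(ring.transcendental ambient over K0) t"
    using t polys_over_mono[OF K0K] unfolding transcendental_iff[OF K] transcendental_iff[OF K0] by blast
  obtain z f0 where z: "z \<in> F" "inj_on (\<lambda>\<sigma>. \<sigma> z) (Gal ?k0 F)"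
    and f0: "f0 \<in> polys2_over K0" "lead_coeff f0 = 1" "specialise f0 t = lin_prod ((\<lambda>\<sigma>. \<sigma> z) ` Gal ?k0 F)"
    using integral_separating_element[OF K0 tK0 GF finF] by blast
  have F: "is_subfield F" "?k0 \<subseteq> F" using GF unfolding galois_extension_iff by auto
  have tF: "t \<in> F" using F(2) adjoin_gens[of "{t}" K0] by auto
  have C0: "is_subfield ?CC" "K0 \<subseteq> ?CC"
    by (rule algebraic_closure_is_subfield[OF K0] algebraic_closure_base[OF K0])+
  have m0: "is_min_poly ?k0 z (specialise f0 t)" unfolding f0(3) by (rule galois_orbit_poly(2)[OF GF finF z(1)])
  have "is_min_poly (adjoin ?CC {t}) z (specialise f0 t)"
    by (rule min_poly_linearly_disjoint[OF K0 C0 F(1) transcendental_over_closure[OF K0 tK0] tF z(1) _ m0])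
       (rule ld)
  moreover have "f0 \<in> polys2_over ?CC" using f0(1) polys_over_mono[OF polys_over_mono[OF C0(2)]] by blast
  ultimately have "is_min_poly (adjoin ?C {t}) z (specialise f0 t)"
    by (intro min_poly_larger_constants[OF K0 K algebraic_closure_mono[OF K0 K K0K]
          transcendental_over_closure[OF K t] _ f0(2)])
  then interpret twisting K0 K L F t z
    by (intro twisting.intro K0 K K0K GL finL t GF finF z) (simp add: f0(3))
  show ?thesis by (rule descent[OF pac \<psi> f0])
qed

lemma iso_to_subgroupI:
  assumes G: "group G" and H: "group H" and \<theta>: "\<theta> \<in> hom G H" "inj_on \<theta> (carrier G)"
  shows "iso_to_subgroup G H"
proof -
  interpret group_hom G H \<theta> using G H \<theta>(1) by (simp add: group_hom_def group_hom_axioms_def)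
  have "\<theta> \<in> iso G (H\<lparr>carrier := \<theta> ` carrier G\<rparr>)"
    using \<theta> by (auto simp: iso_def hom_def bij_betw_def)
  then show ?thesis unfolding iso_to_subgroup_def is_iso_def using img_is_subgroup by blast
qed

lemma hom_on_to_universal: "hom_on UNIV (to_universal :: 'a::field \<Rightarrow> 'a universal_domain)"
  unfolding hom_on_def to_universal_def
  by (simp add: single_add mult_single flip: to_ac_add to_ac_mult to_ac_1 One_fract_def)

definition universal_var :: "'a::field universal_domain" where
  "universal_var = to_ac (Fract (Poly_Mapping.single (Poly_Mapping.single 0 1) 1) 1)"

text \<open>A relation is the image of a polynomial in the variable of index 0 under the injective
  map from polynomials to the universal domain.\<close>

lemma universal_var_transcendental:
  fixes K :: "'a::field set"
  assumes K: "is_subfield K"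
  shows "(ring.transcendental ambient over (to_universal ` K)) universal_var"
proof -
  define emb :: "'a mpoly \<Rightarrow> 'a universal_domain" where "emb m = to_ac (Fract m 1)" for m
  have emb_add: "emb (m + m') = emb m + emb m'" and emb_mult: "emb (m * m') = emb m * emb m'" for m m'
    by (simp_all add: emb_def flip: to_ac_add to_ac_mult)
  have emb_0: "emb 0 = 0" by (simp add: emb_def fract_collapse)
  have emb_sum: "emb (sum g A) = (\<Sum>i\<in>A. emb (g i))" for g :: "nat \<Rightarrow> 'a mpoly" and A
    by (induction A rule: infinite_finite_induct) (simp_all add: emb_0 emb_add)
  have emb_inj: "m = 0" if "emb m = 0" for m
  proof -
    have "hom_on UNIV (to_ac :: 'a mpoly fract \<Rightarrow> _)" by (simp add: hom_on_def)
    then have "Fract m 1 = 0" using hom_on_simps(13)[OF is_subfield_UNIV, of to_ac "Fract m 1"] that by (simp add: emb_def)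
    then show ?thesis by (simp add: Zero_fract_def eq_fract)
  qed
  have emb_var: "emb (Poly_Mapping.single (Poly_Mapping.single 0 i) 1) = universal_var ^ i" for i
  proof (induction i)
    case 0
    show ?case by (simp add: emb_def fract_collapse)
  next
    case (Suc i)
    have "(Poly_Mapping.single (Poly_Mapping.single 0 (Suc i)) 1 :: 'a mpoly) =
        Poly_Mapping.single (Poly_Mapping.single 0 1) 1 * Poly_Mapping.single (Poly_Mapping.single 0 i) 1"
      by (simp add: mult_single flip: single_add)
    then show ?case using Suc by (simp add: emb_mult) (simp add: emb_def universal_var_def)
  qed
  let ?\<iota> = "to_universal :: 'a \<Rightarrow> 'a universal_domain"
  have \<iota>K: "hom_on K ?\<iota>" by (rule hom_on_mono[OF hom_on_to_universal]) simp
  show ?thesis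
    unfolding transcendental_iff[OF is_subfield_image[OF K \<iota>K]]
  proof (intro ballI impI)
    fix p assume p: "p \<in> polys_over (?\<iota> ` K)" "poly p universal_var = 0"
    have "\<forall>i. \<exists>c. coeff p i = ?\<iota> c" using polys_overD[OF p(1)] by blast
    then obtain c where c: "\<And>i. coeff p i = ?\<iota> (c i)" by metis
    define m where "m = (\<Sum>i\<le>degree p. Poly_Mapping.single (Poly_Mapping.single (0::nat) i) (c i))"
    have "emb (Poly_Mapping.single (Poly_Mapping.single 0 i) (c i)) = coeff p i * universal_var ^ i" for i
    proof -
      have "Poly_Mapping.single (Poly_Mapping.single 0 i) (c i) =
          Poly_Mapping.single 0 (c i) * Poly_Mapping.single (Poly_Mapping.single (0::nat) i) 1"
        by (simp add: mult_single)
      then show ?thesis using emb_var[of i] c[of i] by (simp add: emb_mult) (simp add: emb_def to_universal_def)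
    qed
    then have "emb m = poly p universal_var" unfolding m_def emb_sum poly_altdef by simp
    then have m0: "m = 0" using p(2) emb_inj by simp
    have "c i = 0" if "i \<le> degree p" for i
    proof -
      have "Poly_Mapping.lookup m (Poly_Mapping.single 0 i) = (\<Sum>j\<le>degree p. if j = i then c j else 0)"
        unfolding m_def lookup_sum
        by (intro sum.cong) (auto simp: lookup_single when_def dest: injD[OF inj_single])
      also have "\<dots> = c i" using that by simp
      finally show ?thesis using m0 by simp
    qed
    then have "lead_coeff p = 0" using c[of "degree p"] hom_on_simps(1)[OF is_subfield_UNIV hom_on_to_universal] by simp
    then show "p = 0" by simp
  qed
qed

theorem theorem7:
  fixes K0 K L :: "'a::field set" and G0 :: "('g, 'm) monoid_scheme"
  assumes "pac_extension K0 K"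
    and "finite_field_extension K L" and "galois_extension K L"
    and "group G0" and "finite (carrier G0)" and "regular_group_over G0 K0"
    and "iso_to_subgroup (galois_group K L) G0"
  shows "\<exists>L0. galois_extension K0 L0 \<and> iso_to_subgroup (galois_group K0 L0) G0 \<and>
           L = compositum L0 K"
proof -
  let ?\<iota> = "to_universal :: 'a \<Rightarrow> 'a universal_domain"
  have K0: "is_subfield K0" and K: "is_subfield K" and K0K: "K0 \<subseteq> K"
    and pac: "pac_in_domain (?\<iota> ` K0) (?\<iota> ` K)"
    using assms(1) by (auto simp: pac_extension_def field_extension_def)
  have L: "is_subfield L" and KL: "K \<subseteq> L" using assms(3) unfolding galois_extension_iff by auto
  have \<iota>: "hom_on A ?\<iota>" for A by (rule hom_on_mono[OF hom_on_to_universal]) simp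
  have K0': "is_subfield (?\<iota> ` K0)" and K': "is_subfield (?\<iota> ` K)" and L': "is_subfield (?\<iota> ` L)"
    by (rule is_subfield_image[OF K0 \<iota>] is_subfield_image[OF K \<iota>] is_subfield_image[OF L \<iota>])+
  have K0K': "?\<iota> ` K0 \<subseteq> ?\<iota> ` K" and KL': "?\<iota> ` K \<subseteq> ?\<iota> ` L" using K0K KL by auto
  have GL': "galois_extension (?\<iota> ` K) (?\<iota> ` L)" by (rule galois_extension_image[OF assms(3) \<iota>])
  let ?t = "universal_var :: 'a universal_domain"
  have t: "(ring.transcendental ambient over (?\<iota> ` K)) ?t" by (rule universal_var_transcendental[OF K])
  have tK0: "(ring.transcendental ambient over (?\<iota> ` K0)) ?t" by (rule universal_var_transcendental[OF K0])
  let ?k0 = "adjoin (?\<iota> ` K0) {?t}"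
  have reg: "regular_in_domain G0 (?\<iota> ` K0)" using assms(6) by (simp add: regular_group_over_def)
  \<comment> \<open>The element of the given realisation is transcendental over the image of
    \<open>K0\<close> but perhaps algebraic over that of \<open>K\<close>; hence the move to
    \<open>universal_var\<close>, which is transcendental over both.\<close>
  obtain F where GF: "galois_extension ?k0 F" and isoF: "galois_group ?k0 F \<cong> G0"
    and ld: "\<And>(I :: (nat \<times> nat) set) v. finite I \<Longrightarrow> v ` I \<subseteq> F \<Longrightarrow> indep (?\<iota> ` K0) I v \<Longrightarrow>
        indep (algebraic_closure_of (?\<iota> ` K0)) I v"
    using regular_realisation_at[OF K0' reg tK0] by blast
  have F: "is_subfield F" "?k0 \<subseteq> F" using GF unfolding galois_extension_iff by auto
  have grpF: "group (galois_group ?k0 F)" by (rule galois_group_group[OF F])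
  obtain d where d: "d \<in> iso (galois_group ?k0 F) G0" using isoF by (auto simp: is_iso_def)
  have finF: "finite (Gal ?k0 F)"
    using d assms(5) bij_betw_finite[of d "Gal ?k0 F" "carrier G0"] by (simp add: iso_def)
  obtain c where c: "c \<in> iso G0 (galois_group ?k0 F)"
    using group.iso_sym[OF grpF isoF] by (auto simp: is_iso_def)
  obtain U where U: "subgroup U G0" and isoU: "galois_group K L \<cong> G0\<lparr>carrier := U\<rparr>"
    using assms(7) by (auto simp: iso_to_subgroup_def)
  have grpL: "group (galois_group K L)" by (rule galois_group_group[OF L KL])
  obtain b where b: "b \<in> iso (galois_group (?\<iota> ` K) (?\<iota> ` L)) (G0\<lparr>carrier := U\<rparr>)"
    using iso_trans[OF group.iso_sym[OF grpL galois_group_image[OF L KL \<iota>]] isoU] by (auto simp: is_iso_def)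
  have UG: "U \<subseteq> carrier G0" by (rule subgroup.subset[OF U])
  have bU: "b \<in> Gal (?\<iota> ` K) (?\<iota> ` L) \<rightarrow> U" "bij_betw b (Gal (?\<iota> ` K) (?\<iota> ` L)) U"
    and bm: "\<And>x y. x \<in> Gal (?\<iota> ` K) (?\<iota> ` L) \<Longrightarrow> y \<in> Gal (?\<iota> ` K) (?\<iota> ` L) \<Longrightarrow>
       b (x \<otimes>\<^bsub>galois_group (?\<iota> ` K) (?\<iota> ` L)\<^esub> y) = b x \<otimes>\<^bsub>G0\<^esub> b y"
    using b by (auto simp: iso_def hom_def)
  have finL: "finite (Gal (?\<iota> ` K) (?\<iota> ` L))"
    using bij_betw_finite[OF bU(2)] finite_subset[OF UG assms(5)] by blast
  let ?\<psi> = "\<lambda>x. c (b x)"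
  have cb: "bij_betw c (carrier G0) (Gal ?k0 F)" "c \<in> hom G0 (galois_group ?k0 F)" using c by (auto simp: iso_def)
  have \<psi>: "?\<psi> \<in> hom (galois_group (?\<iota> ` K) (?\<iota> ` L)) (galois_group ?k0 F)"
  proof (rule homI)
    fix x y assume xy: "x \<in> Gal (?\<iota> ` K) (?\<iota> ` L)" "y \<in> Gal (?\<iota> ` K) (?\<iota> ` L)"
    then have "b x \<in> carrier G0" "b y \<in> carrier G0" using bU(1) UG by auto
    then show "c (b (x \<otimes>\<^bsub>galois_group (?\<iota> ` K) (?\<iota> ` L)\<^esub> y)) = c (b x) \<otimes>\<^bsub>galois_group ?k0 F\<^esub> c (b y)"
      unfolding bm[OF xy] using hom_mult[OF cb(2)] by simp
  next
    fix x assume "x \<in> Gal (?\<iota> ` K) (?\<iota> ` L)"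
    then have "b x \<in> carrier G0" using bU(1) UG by auto
    then show "c (b x) \<in> Gal ?k0 F" using cb(2) by (auto simp: hom_def)
  qed
  have \<psi>inj: "inj_on ?\<psi> (Gal (?\<iota> ` K) (?\<iota> ` L))"
  proof (rule inj_onI)
    fix x y assume xy: "x \<in> Gal (?\<iota> ` K) (?\<iota> ` L)" "y \<in> Gal (?\<iota> ` K) (?\<iota> ` L)" "c (b x) = c (b y)"
    have "b x \<in> carrier G0" "b y \<in> carrier G0" using xy(1,2) bU(1) UG by auto
    then have "b x = b y" using xy(3) cb(1) by (auto simp: bij_betw_def dest: inj_onD)
    then show "x = y" using bU(2) xy(1,2) by (auto simp: bij_betw_def dest: inj_onD)
  qed
  have "\<exists>L0' \<chi>. galois_extension (?\<iota> ` K0) L0' \<and> L0' \<subseteq> ?\<iota> ` L \<and> ?\<iota> ` L = adjoin L0' (?\<iota> ` K) \<and>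
      \<chi> \<in> hom (galois_group (?\<iota> ` K0) L0') (galois_group ?k0 F) \<and> inj_on \<chi> (Gal (?\<iota> ` K0) L0')"
    by (rule pac_descent[OF K0' K' K0K' pac GL' finL t GF finF _ \<psi> \<psi>inj]) (rule ld)
  then obtain L0' \<chi> where L0': "galois_extension (?\<iota> ` K0) L0'" "L0' \<subseteq> ?\<iota> ` L" "?\<iota> ` L = adjoin L0' (?\<iota> ` K)"
    and \<chi>: "\<chi> \<in> hom (galois_group (?\<iota> ` K0) L0') (galois_group ?k0 F)" "inj_on \<chi> (Gal (?\<iota> ` K0) L0')"
    by (elim exE conjE)
  let ?g = "inv_into L ?\<iota>"
  have g: "hom_on (?\<iota> ` L) ?g" by (rule hom_on_inv_into[OF L \<iota>])
  have g\<iota>: "?g ` ?\<iota> ` A = A" if "A \<subseteq> L" for A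
    using inv_into_image_cancel[OF hom_on_simps(12)[OF L \<iota>] that] .
  have gL0': "hom_on L0' ?g" by (rule hom_on_mono[OF g L0'(2)])
  have L0s: "is_subfield L0'" "?\<iota> ` K0 \<subseteq> L0'" using L0'(1) unfolding galois_extension_iff by auto
  \<comment> \<open>\<open>L0'\<close> lies inside the image of \<open>L\<close>, so the embedding
    can be inverted on it.\<close>
  define L0 where "L0 = ?g ` L0'"
  have gK0: "?g ` ?\<iota> ` K0 = K0" by (rule g\<iota>) (use K0K KL in blast)
  have 1: "galois_extension K0 L0" unfolding L0_def using galois_extension_image[OF L0'(1) gL0'] gK0 by simp
  have "L = ?g ` ?\<iota> ` L" using g\<iota>[of L] by simp
  also have "\<dots> = ?g ` adjoin L0' (?\<iota> ` K)" using L0'(3) by simp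
  also have "\<dots> = adjoin L0 K"
    unfolding hom_image_adjoin[OF L' L0'(2) KL' g] L0_def g\<iota>[OF KL] ..
  finally have 2: "L = compositum L0 K" .
  have L0sub: "is_subfield L0" "K0 \<subseteq> L0" using 1 unfolding galois_extension_iff by auto
  have grp0: "group (galois_group K0 L0)" by (rule galois_group_group[OF L0sub])
  have grp0': "group (galois_group (?\<iota> ` K0) L0')" by (rule galois_group_group[OF L0s])
  have "galois_group (?\<iota> ` K0) L0' \<cong> galois_group K0 L0"
    unfolding L0_def using galois_group_image[OF L0s gL0'] gK0 by simp
  then obtain e where e: "e \<in> iso (galois_group K0 L0) (galois_group (?\<iota> ` K0) L0')"
    using group.iso_sym[OF grp0'] by (auto simp: is_iso_def)
  have e': "e \<in> hom (galois_group K0 L0) (galois_group (?\<iota> ` K0) L0')" "bij_betw e (Gal K0 L0) (Gal (?\<iota> ` K0) L0')"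
    using e by (auto simp: iso_def)
  have em: "e x \<in> Gal (?\<iota> ` K0) L0'" if "x \<in> Gal K0 L0" for x using e'(2) that by (auto simp: bij_betw_def)
  have d': "d \<in> hom (galois_group ?k0 F) G0" "inj_on d (Gal ?k0 F)" using d by (auto simp: iso_def bij_betw_def)
  have \<chi>m: "\<chi> x \<in> Gal ?k0 F" if "x \<in> Gal (?\<iota> ` K0) L0'" for x using \<chi>(1) that by (auto simp: hom_def)
  have "iso_to_subgroup (galois_group K0 L0) G0"
  proof (rule iso_to_subgroupI[OF grp0 assms(4)])
    show "(\<lambda>x. d (\<chi> (e x))) \<in> hom (galois_group K0 L0) G0"
    proof (rule homI)
      fix x y assume xy: "x \<in> Gal K0 L0" "y \<in> Gal K0 L0"
      show "d (\<chi> (e (x \<otimes>\<^bsub>galois_group K0 L0\<^esub> y))) = d (\<chi> (e x)) \<otimes>\<^bsub>G0\<^esub> d (\<chi> (e y))"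
        using hom_mult[OF e'(1) xy] hom_mult[OF \<chi>(1) em[OF xy(1)] em[OF xy(2)]]
          hom_mult[OF d'(1) \<chi>m[OF em[OF xy(1)]] \<chi>m[OF em[OF xy(2)]]] by simp
    next
      fix x assume x: "x \<in> Gal K0 L0"
      show "d (\<chi> (e x)) \<in> carrier G0" using d'(1) \<chi>m[OF em[OF x]] by (auto simp: hom_def)
    qed
    show "inj_on (\<lambda>x. d (\<chi> (e x))) (Gal K0 L0)"
    proof (rule inj_onI)
      fix x y assume xy: "x \<in> Gal K0 L0" "y \<in> Gal K0 L0" "d (\<chi> (e x)) = d (\<chi> (e y))"
      have "\<chi> (e x) = \<chi> (e y)" by (rule inj_onD[OF d'(2) xy(3) \<chi>m[OF em[OF xy(1)]] \<chi>m[OF em[OF xy(2)]]])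
      then have "e x = e y" by (rule inj_onD[OF \<chi>(2) _ em[OF xy(1)] em[OF xy(2)]])
      then show "x = y" using e'(2) xy(1,2) by (auto simp: bij_betw_def dest: inj_onD)
    qed
  qed
  then show ?thesis using 1 2 by blast
qed

end
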